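(* (Chain rule.) Let $F$ be a natural bundle on $\mathcal{M}f_n$, $M$ an $n$-dimensional manifold, $P$ a principal $G$-bundle over $M$, $N,N'$ manifolds with smooth left $G$-actions, $f\colon N\to N'$ a $G$-equivariant map, and $\omega\colon TN\to V$, $\omega'\colon TN'\to V'$ $G$-equivariant $1$-forms with values in $G$-modules $V,V'$. Assume that there is a $G$-equivariant map $\varphi\colon N\to\mathrm{Hom}_{\mathbb R}(V,V')$ such that $(f^*\omega')_z=\varphi(z)\circ\omega_z$ for each $z\in N$. Then for every fiber bundle map $h\colon F(M)\to P\times_GN$ over $M$, every $G$-invariant vector field $\widetilde X$ on $P$, and every $y\in F(M)$ $$\pounds^{\omega'}_{\widetilde X}\big((\mathrm{id}\times_Gf)\circ h\big)(y)=\big((\mathrm{id}\times_G\varphi)(h(y))\big)\big(\pounds^{\omega}_{\widetilde X}h(y)\big).$$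
   Context: All manifolds and maps are smooth. $\Phi^t_X$ denotes the (local) flow of a vector field $X$, defined at time $t$ on the open set $U^X_t$. Natural bundles. $\mathcal{M}f_n$ is the category of $n$-dimensional manifolds with local diffeomorphisms as morphisms. A natural bundle on $\mathcal{M}f_n$ is a functor $F$ from $\mathcal{M}f_n$ to smooth manifolds together with a natural transformation $p_M\colon F(M)\to M$ such that each $p_M$ is a fiber bundle and, for each morphism $f\colon M\to M'$, $F(f)$ covers $f$ and is a fiberwise diffeomorphism. For a vector field $X$ on $M$, its canonical lift $\mathcal F(X)$ is the unique vector field on $F(M)$ whose flow satisfies $U^{\mathcal F(X)}_t=\mathrm{Im}\,F(\iota_t)$ and $\Phi^t_{\mathcal F(X)}\circ F(\iota_t)=F(\iota_{-t})\circ F(\Phi^t_X)$, where $\iota_t\colon U^X_t\hookrightarrow M$ is the inclusion and $\Phi^t_X\colon U^X_t\to U^X_{-t}$. Associated bundles. For a manifold $N$ with left $G$-action, $P\times_G N=(P\times N)/G$ for the action $(p,y)g=(pg,g^{-1}y)$; classes are written $[p,y]$. For a $G$-equivariant map $f\colon N\to N'$, $\mathrm{id}\times_Gf\colon P\times_GN\to P\times_GN'$ is $[p,y]\mapsto[p,f(y)]$. The pullback is $f^*\omega'=\omega'\circ Tf\colon TN\to V'$. $G$ acts on $\mathrm{Hom}_{\mathbb R}(V,V')$ by $(g\alpha)(v)=g\alpha(g^{-1}v)$, and elements of $P\times_G\mathrm{Hom}_{\mathbb R}(V,V')$ act on elements of $P\times_GV$ over the same point of $M$ by $[p,\alpha]([p,v])=[p,\alpha(v)]\in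 P\times_GV'$. Darboux-Lie derivative. Let $\omega\colon TN\to V$ be a $G$-equivariant $1$-form with values in a $G$-module, $\widetilde X$ a $G$-invariant vector field on $P$ over the vector field $X$ on $M$, and $\widetilde X_N$ the vector field on $P\times_GN$ with flow $[p,y]\mapsto[\Phi^t_{\widetilde X}p,y]$. For a bundle map $h\colon F(M)\to P\times_GN$ over $\mathrm{id}_M$, the vector $T_yh(\mathcal F(X)_y)-(\widetilde X_N)_{h(y)}$ is vertical, hence of the form $\left.\frac{d}{dt}\right|_0[p,\gamma(t)]$ with $p\in P$ fixed and $\gamma$ a curve in $N$; set $\pounds^\omega_{\widetilde X}h(y)=[p,\omega(\dot\gamma(0))]\in P\times_GV$. *)

theory Defs
  imports "HOL-Analysis.Analysis" "HOL-Algebra.Group_Action"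
begin

text \<open>
  Manifolds are modelled on finite-dimensional types of class \<^class>\<open>real_normed_vector\<close> rather
  than \<^class>\<open>euclidean_space\<close>, because the latter excludes dimension 0 (discrete groups, discrete
  fibres). The type \<^typ>\<open>unit\<close> is the zero-dimensional model.
\<close>

instantiation unit :: real_normed_vector
begin

definition zero_unit :: unit where "zero_unit = ()"
definition plus_unit :: "unit \<Rightarrow> unit \<Rightarrow> unit" where "plus_unit _ _ = ()"
definition minus_unit :: "unit \<Rightarrow> unit \<Rightarrow> unit" where "minus_unit _ _ = ()"
definition uminus_unit :: "unit \<Rightarrow> unit" where "uminus_unit _ = ()"
definition scaleR_unit :: "real \<Rightarrow> unit \<Rightarrow> unit" where "scaleR_unit _ _ = ()"
definition norm_unit :: "unit \<Rightarrow> real" where "norm_unit _ = 0"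
definition dist_unit :: "unit \<Rightarrow> unit \<Rightarrow> real" where "dist_unit _ _ = 0"
definition sgn_unit :: "unit \<Rightarrow> unit" where "sgn_unit _ = ()"
definition uniformity_unit :: "(unit \<times> unit) filter"
  where "uniformity_unit = (INF e\<in>{0<..}. principal {(x, y). dist x y < e})"
definition open_unit :: "unit set \<Rightarrow> bool"
  where "open_unit U \<longleftrightarrow> (\<forall>x\<in>U. eventually (\<lambda>(x', y). x' = x \<longrightarrow> y \<in> U) uniformity)"

instance
  by standard (simp_all add: norm_unit_def dist_unit_def uniformity_unit_def open_unit_def)

end

definition finite_dim :: "'e::real_normed_vector itself \<Rightarrow> bool"
  where "finite_dim _ \<longleftrightarrow> (\<exists>B :: 'e set. finite B \<and> span B = UNIV)"


section \<open>Smooth manifolds\<close>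

text \<open>
  For open \<open>S\<close> in a finite-dimensional space this is \<open>C\<^sup>k\<close>: all iterated directional derivatives
  up to order \<open>k\<close> exist and are continuous.
\<close>

fun Ck_on :: "nat \<Rightarrow> 'e::real_normed_vector set \<Rightarrow> ('e \<Rightarrow> 'f::real_normed_vector) \<Rightarrow> bool" where
  "Ck_on 0 S f \<longleftrightarrow> continuous_on S f"
| "Ck_on (Suc k) S f \<longleftrightarrow>
     (\<forall>x\<in>S. f differentiable (at x)) \<and> (\<forall>v. Ck_on k S (\<lambda>x. frechet_derivative f (at x) v))"

definition smooth_on :: "'e::real_normed_vector set \<Rightarrow> ('e \<Rightarrow> 'f::real_normed_vector) \<Rightarrow> bool"
  where "smooth_on S f \<longleftrightarrow> (\<forall>k. Ck_on k S f)"

text \<open>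
  A chart is a domain together with a coordinate map; the values of the latter outside the domain
  are irrelevant. A manifold is represented by its maximal atlas, which determines the underlying
  set and the topology.
\<close>

type_synonym ('a, 'e) chart = "'a set \<times> ('a \<Rightarrow> 'e)"
type_synonym ('a, 'e) manifold = "('a, 'e) chart set"

abbreviation chart_inv :: "('a, 'e) chart \<Rightarrow> 'e \<Rightarrow> 'a"
  where "chart_inv c \<equiv> inv_into (fst c) (snd c)"

definition is_chart :: "('a, 'e::real_normed_vector) chart \<Rightarrow> bool"
  where "is_chart c \<longleftrightarrow> inj_on (snd c) (fst c) \<and> open (snd c ` fst c)"

definition smooth_transition :: "('a, 'e::real_normed_vector) chart \<Rightarrow> ('a, 'e) chart \<Rightarrow> bool"
  where "smooth_transition c d \<longleftrightarrow>
    open (snd c ` (fst c \<inter> fst d)) \<and> smooth_on (snd c ` (fst c \<inter> fst d)) (snd d \<circ> chart_inv c)"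

definition compatible :: "('a, 'e::real_normed_vector) chart \<Rightarrow> ('a, 'e) chart \<Rightarrow> bool"
  where "compatible c d \<longleftrightarrow> smooth_transition c d \<and> smooth_transition d c"

definition points :: "('a, 'e) chart set \<Rightarrow> 'a set"
  where "points A = (\<Union>c\<in>A. fst c)"

definition smooth_atlas :: "('a, 'e::real_normed_vector) chart set \<Rightarrow> bool"
  where "smooth_atlas A \<longleftrightarrow> (\<forall>c\<in>A. is_chart c) \<and> (\<forall>c\<in>A. \<forall>d\<in>A. compatible c d)"

definition generated :: "('a, 'e::real_normed_vector) chart set \<Rightarrow> ('a, 'e) manifold"
  where "generated A = {c. is_chart c \<and> fst c \<subseteq> points A \<and> (\<forall>d\<in>A. compatible c d)}"

definition mtopology :: "('a, 'e::real_normed_vector) manifold \<Rightarrow> 'a topology"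
  where "mtopology M = topology (\<lambda>U. U \<subseteq> points M \<and> (\<forall>c\<in>M. open (snd c ` (U \<inter> fst c))))"

definition is_manifold :: "('a, 'e::real_normed_vector) manifold \<Rightarrow> bool"
  where "is_manifold M \<longleftrightarrow>
    finite_dim TYPE('e) \<and> smooth_atlas M \<and> generated M = M \<and>
    Hausdorff_space (mtopology M) \<and> second_countable (mtopology M)"

definition std_manifold :: "('e, 'e::real_normed_vector) manifold"
  where "std_manifold = generated {(UNIV, \<lambda>x. x)}"

definition open_submanifold :: "('a, 'e) manifold \<Rightarrow> 'a set \<Rightarrow> ('a, 'e) manifold"
  where "open_submanifold M U = {c\<in>M. fst c \<subseteq> U}"

definition prod_manifold ::
  "('a, 'e::real_normed_vector) manifold \<Rightarrow> ('b, 'f::real_normed_vector) manifold \<Rightarrow>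
   ('a \<times> 'b, 'e \<times> 'f) manifold"
  where "prod_manifold M N =
    generated {(fst c \<times> fst d, map_prod (snd c) (snd d)) | c d. c \<in> M \<and> d \<in> N}"

definition smooth_map ::
  "('a, 'e::real_normed_vector) manifold \<Rightarrow> ('b, 'f::real_normed_vector) manifold \<Rightarrow>
   ('a \<Rightarrow> 'b) \<Rightarrow> bool"
  where "smooth_map M N f \<longleftrightarrow>
    f ` points M \<subseteq> points N \<and>
    (\<forall>x\<in>points M. \<exists>c\<in>M. \<exists>d\<in>N. x \<in> fst c \<and> f ` fst c \<subseteq> fst d \<and>
       smooth_on (snd c ` fst c) (snd d \<circ> f \<circ> chart_inv c))"

definition diffeomorphism ::
  "('a, 'e::real_normed_vector) manifold \<Rightarrow> ('b, 'f::real_normed_vector) manifold \<Rightarrow>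
   ('a \<Rightarrow> 'b) \<Rightarrow> bool"
  where "diffeomorphism M N f \<longleftrightarrow>
    bij_betw f (points M) (points N) \<and> smooth_map M N f \<and>
    smooth_map N M (inv_into (points M) f)"

definition local_diffeomorphism ::
  "('a, 'e::real_normed_vector) manifold \<Rightarrow> ('b, 'f::real_normed_vector) manifold \<Rightarrow>
   ('a \<Rightarrow> 'b) \<Rightarrow> bool"
  where "local_diffeomorphism M N f \<longleftrightarrow>
    smooth_map M N f \<and>
    (\<forall>x\<in>points M. \<exists>U. x \<in> U \<and> openin (mtopology M) U \<and> openin (mtopology N) (f ` U) \<and>
       diffeomorphism (open_submanifold M U) (open_submanifold N (f ` U)) f)"


section \<open>Tangent vectors, vector fields and flows\<close>

text \<open>
  A tangent vector at \<open>x\<close> is the family of its coordinate representations in the charts around \<open>x\<close>,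
  extended by 0 to all other pairs \<open>(U, \<phi>)\<close>, so that the vector space operations of
  the tangent space are pointwise. \<open>tangent_vector M x c w\<close> is the vector with coordinates
  \<open>w\<close> in the chart \<open>c\<close>.
\<close>

type_synonym ('a, 'e) tangent = "('a, 'e) chart \<Rightarrow> 'e"

definition tangent_vector ::
  "('a, 'e::real_normed_vector) manifold \<Rightarrow> 'a \<Rightarrow> ('a, 'e) chart \<Rightarrow> 'e \<Rightarrow> ('a, 'e) tangent"
  where "tangent_vector M x c w = (\<lambda>d. if d \<in> M \<and> x \<in> fst d
    then frechet_derivative (snd d \<circ> chart_inv c) (at (snd c x)) w else 0)"

definition tangent_space ::
  "('a, 'e::real_normed_vector) manifold \<Rightarrow> 'a \<Rightarrow> ('a, 'e) tangent set"
  where "tangent_space M x = {tangent_vector M x c w | c w. c \<in> M \<and> x \<in> fst c}"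

definition tangent_map ::
  "('a, 'e::real_normed_vector) manifold \<Rightarrow> ('b, 'f::real_normed_vector) manifold \<Rightarrow>
   ('a \<Rightarrow> 'b) \<Rightarrow> 'a \<Rightarrow> ('a, 'e) tangent \<Rightarrow> ('b, 'f) tangent"
  where "tangent_map M N f x v = (let c = (SOME c. c \<in> M \<and> x \<in> fst c) in
    (\<lambda>d. if d \<in> N \<and> f x \<in> fst d
      then frechet_derivative (snd d \<circ> f \<circ> chart_inv c) (at (snd c x)) (v c) else 0))"

text \<open>
  The curve \<open>\<gamma>\<close> is differentiable at time \<open>t\<close> with velocity \<open>v\<close>. The clause with
  \<^const>\<open>eventually\<close> makes \<open>\<gamma>\<close> stay in the chart domain near \<open>t\<close>.
\<close>

definition has_velocity ::
  "('a, 'e::real_normed_vector) manifold \<Rightarrow> (real \<Rightarrow> 'a) \<Rightarrow> real \<Rightarrow> ('a, 'e) tangent \<Rightarrow> bool"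
  where "has_velocity M \<gamma> t v \<longleftrightarrow>
    \<gamma> t \<in> points M \<and>
    (\<forall>d. if d \<in> M \<and> \<gamma> t \<in> fst d
      then (\<forall>\<^sub>F s in nhds t. \<gamma> s \<in> fst d) \<and> (snd d \<circ> \<gamma> has_vector_derivative v d) (at t)
      else v d = 0)"

definition smooth_curve ::
  "('a, 'e::real_normed_vector) manifold \<Rightarrow> real set \<Rightarrow> (real \<Rightarrow> 'a) \<Rightarrow> bool"
  where "smooth_curve M I \<gamma> \<longleftrightarrow>
    open I \<and> is_interval I \<and> smooth_map (open_submanifold std_manifold I) M \<gamma>"

definition vector_field ::
  "('a, 'e::real_normed_vector) manifold \<Rightarrow> ('a \<Rightarrow> ('a, 'e) tangent) \<Rightarrow> bool"
  where "vector_field M X \<longleftrightarrow>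
    (\<forall>x\<in>points M. X x \<in> tangent_space M x) \<and>
    (\<forall>c\<in>M. smooth_on (snd c ` fst c) (\<lambda>u. X (chart_inv c u) c))"

definition integral_curve ::
  "('a, 'e::real_normed_vector) manifold \<Rightarrow> ('a \<Rightarrow> ('a, 'e) tangent) \<Rightarrow> 'a \<Rightarrow> real set \<Rightarrow>
   (real \<Rightarrow> 'a) \<Rightarrow> bool"
  where "integral_curve M X x I \<gamma> \<longleftrightarrow>
    open I \<and> is_interval I \<and> 0 \<in> I \<and> \<gamma> 0 = x \<and> (\<forall>s\<in>I. has_velocity M \<gamma> s (X (\<gamma> s)))"

definition flow_domain ::
  "('a, 'e::real_normed_vector) manifold \<Rightarrow> ('a \<Rightarrow> ('a, 'e) tangent) \<Rightarrow> real \<Rightarrow> 'a set"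
  where "flow_domain M X t = {x\<in>points M. \<exists>I \<gamma>. integral_curve M X x I \<gamma> \<and> t \<in> I}"

definition flow ::
  "('a, 'e::real_normed_vector) manifold \<Rightarrow> ('a \<Rightarrow> ('a, 'e) tangent) \<Rightarrow> real \<Rightarrow> 'a \<Rightarrow> 'a"
  where "flow M X t x = (THE y. \<exists>I \<gamma>. integral_curve M X x I \<gamma> \<and> t \<in> I \<and> y = \<gamma> t)"


section \<open>Fiber bundles and natural bundles\<close>

definition local_trivialization ::
  "('t, 'u::real_normed_vector) manifold \<Rightarrow> ('a, 'e::real_normed_vector) manifold \<Rightarrow>
   ('t \<Rightarrow> 'a) \<Rightarrow> ('s, 'k::real_normed_vector) manifold \<Rightarrow> 'a set \<Rightarrow> ('t \<Rightarrow> 'a \<times> 's) \<Rightarrow> bool"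
  where "local_trivialization E B p S U \<Psi> \<longleftrightarrow>
    openin (mtopology B) U \<and>
    diffeomorphism (open_submanifold E {y\<in>points E. p y \<in> U})
      (prod_manifold (open_submanifold B U) S) \<Psi> \<and>
    (\<forall>y\<in>points E. p y \<in> U \<longrightarrow> fst (\<Psi> y) = p y)"

text \<open>
  The total space is modelled on the product of the model of the base and the model of the standard
  fibre. Asking the standard fibre to be carried by the type of the total space is no restriction,
  since the fibres themselves are.
\<close>

definition fiber_bundle ::
  "('t, 'e::real_normed_vector \<times> 'k::real_normed_vector) manifold \<Rightarrow> ('a, 'e) manifold \<Rightarrow>
   ('t \<Rightarrow> 'a) \<Rightarrow> bool"
  where "fiber_bundle E B p \<longleftrightarrow>
    is_manifold E \<and> is_manifold B \<and> smooth_map E B p \<and>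
    (\<exists>S :: ('t, 'k) manifold. is_manifold S \<and>
      (\<forall>x\<in>points B. \<exists>U \<Psi>. x \<in> U \<and> local_trivialization E B p S U \<Psi>))"

definition fiber_manifold ::
  "('t, 'e::real_normed_vector \<times> 'k::real_normed_vector) manifold \<Rightarrow> ('a, 'e) manifold \<Rightarrow>
   ('t \<Rightarrow> 'a) \<Rightarrow> 'a \<Rightarrow> ('t, 'k) manifold"
  where "fiber_manifold E B p x =
    generated {({y\<in>points E. p y = x \<and> snd (\<Psi> y) \<in> fst c}, snd c \<circ> snd \<circ> \<Psi>) | S U \<Psi> c.
      is_manifold (S :: ('t, 'k) manifold) \<and> local_trivialization E B p S U \<Psi> \<and> x \<in> U \<and> c \<in> S}"

text \<open>
  The category of manifolds of dimension \<open>n = dim 'e\<close> is represented by the manifolds modelled on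
  \<open>'e\<close> whose points belong to the type \<open>'m\<close>. A morphism consists of its source, its target and a
  function, of which only the restriction to the points of the source counts; hence the
  congruence condition below.
\<close>

record ('m, 'e, 't, 'k) bundle_functor =
  obj :: "('m, 'e) manifold \<Rightarrow> ('t, 'e \<times> 'k) manifold"
  arr :: "('m, 'e) manifold \<Rightarrow> ('m, 'e) manifold \<Rightarrow> ('m \<Rightarrow> 'm) \<Rightarrow> 't \<Rightarrow> 't"
  proj :: "('m, 'e) manifold \<Rightarrow> 't \<Rightarrow> 'm"

definition Mf_morphism ::
  "('m, 'e::real_normed_vector) manifold \<Rightarrow> ('m, 'e) manifold \<Rightarrow> ('m \<Rightarrow> 'm) \<Rightarrow> bool"
  where "Mf_morphism M M' f \<longleftrightarrow> is_manifold M \<and> is_manifold M' \<and> local_diffeomorphism M M' f"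

definition natural_bundle ::
  "('m, 'e::real_normed_vector, 't, 'k::real_normed_vector) bundle_functor \<Rightarrow> bool"
  where "natural_bundle F \<longleftrightarrow>
    (\<forall>M. is_manifold M \<longrightarrow> fiber_bundle (obj F M) M (proj F M)) \<and>
    (\<forall>M M' f. Mf_morphism M M' f \<longrightarrow> smooth_map (obj F M) (obj F M') (arr F M M' f)) \<and>
    (\<forall>M M' f g. Mf_morphism M M' f \<and> Mf_morphism M M' g \<and> (\<forall>x\<in>points M. f x = g x) \<longrightarrow>
      (\<forall>y\<in>points (obj F M). arr F M M' f y = arr F M M' g y)) \<and>
    (\<forall>M. is_manifold M \<longrightarrow> (\<forall>y\<in>points (obj F M). arr F M M (\<lambda>x. x) y = y)) \<and>
    (\<forall>M M' M'' f g. Mf_morphism M M' f \<and> Mf_morphism M' M'' g \<longrightarrow>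
      (\<forall>y\<in>points (obj F M). arr F M M'' (g \<circ> f) y = arr F M' M'' g (arr F M M' f y))) \<and>
    (\<forall>M M' f. Mf_morphism M M' f \<longrightarrow>
      (\<forall>y\<in>points (obj F M). proj F M' (arr F M M' f y) = f (proj F M y)) \<and>
      (\<forall>x\<in>points M. diffeomorphism (fiber_manifold (obj F M) M (proj F M) x)
         (fiber_manifold (obj F M') M' (proj F M') (f x)) (arr F M M' f)))"

text \<open>
  \<open>Y\<close> is the canonical lift of \<open>X\<close>. The first two conjuncts about \<open>t\<close> only record that the flow
  of \<open>X\<close> at time \<open>t\<close> is a morphism, so that \<open>F\<close> may be applied to it.
\<close>

definition canonical_lift ::
  "('m, 'e::real_normed_vector, 't, 'k::real_normed_vector) bundle_functor \<Rightarrow>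
   ('m, 'e) manifold \<Rightarrow> ('m \<Rightarrow> ('m, 'e) tangent) \<Rightarrow> ('t \<Rightarrow> ('t, 'e \<times> 'k) tangent) \<Rightarrow> bool"
  where "canonical_lift F M X Y \<longleftrightarrow>
    vector_field (obj F M) Y \<and>
    (\<forall>t. let U = (\<lambda>s. flow_domain M X s);
             MU = (\<lambda>s. open_submanifold M (U s));
             F\<iota> = (\<lambda>s. arr F (MU s) M (\<lambda>x. x))
         in openin (mtopology M) (U t) \<and>
            Mf_morphism (MU t) (MU (- t)) (flow M X t) \<and>
            flow_domain (obj F M) Y t = F\<iota> t ` points (obj F (MU t)) \<and>
            (\<forall>z\<in>points (obj F (MU t)).
               flow (obj F M) Y t (F\<iota> t z) =
                 F\<iota> (- t) (arr F (MU t) (MU (- t)) (flow M X t) z)))"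


section \<open>Lie groups, principal bundles and associated bundles\<close>

definition lie_group :: "('g, 'b) monoid_scheme \<Rightarrow> ('g, 'h::real_normed_vector) manifold \<Rightarrow> bool"
  where "lie_group G GM \<longleftrightarrow>
    group G \<and> is_manifold GM \<and> points GM = carrier G \<and>
    smooth_map (prod_manifold GM GM) GM (\<lambda>(g, h). g \<otimes>\<^bsub>G\<^esub> h) \<and>
    smooth_map GM GM (\<lambda>g. inv\<^bsub>G\<^esub> g)"

text \<open>
  \<^locale>\<open>group_action\<close> takes the maps \<open>a g\<close> to be undefined outside \<open>points N\<close>; this only
  normalizes irrelevant values.
\<close>

definition smooth_action ::
  "('g, 'b) monoid_scheme \<Rightarrow> ('g, 'h::real_normed_vector) manifold \<Rightarrow>
   ('n, 'f::real_normed_vector) manifold \<Rightarrow> ('g \<Rightarrow> 'n \<Rightarrow> 'n) \<Rightarrow> bool"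
  where "smooth_action G GM N a \<longleftrightarrow>
    is_manifold N \<and> group_action G (points N) a \<and>
    smooth_map (prod_manifold GM N) N (\<lambda>(g, z). a g z)"

definition G_module ::
  "('g, 'b) monoid_scheme \<Rightarrow> ('g, 'h::real_normed_vector) manifold \<Rightarrow>
   ('g \<Rightarrow> 'v \<Rightarrow> 'v::real_normed_vector) \<Rightarrow> bool"
  where "G_module G GM \<rho> \<longleftrightarrow>
    smooth_action G GM std_manifold \<rho> \<and> (\<forall>g\<in>carrier G. linear (\<rho> g))"

text \<open>In finite dimensions the bounded linear maps are all linear maps.\<close>

definition hom_action ::
  "('g, 'b) monoid_scheme \<Rightarrow> ('g \<Rightarrow> 'v \<Rightarrow> 'v::real_normed_vector) \<Rightarrow>
   ('g \<Rightarrow> 'w \<Rightarrow> 'w::real_normed_vector) \<Rightarrow> 'g \<Rightarrow> ('v \<Rightarrow>\<^sub>L 'w) \<Rightarrow> ('v \<Rightarrow>\<^sub>L 'w)"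
  where "hom_action G \<rho> \<rho>' g \<alpha> = Blinfun (\<lambda>v. \<rho>' g (blinfun_apply \<alpha> (\<rho> (inv\<^bsub>G\<^esub> g) v)))"

definition equivariant ::
  "('g, 'b) monoid_scheme \<Rightarrow> 'n set \<Rightarrow> ('g \<Rightarrow> 'n \<Rightarrow> 'n) \<Rightarrow> ('g \<Rightarrow> 'q \<Rightarrow> 'q) \<Rightarrow> ('n \<Rightarrow> 'q) \<Rightarrow> bool"
  where "equivariant G N a b f \<longleftrightarrow> (\<forall>g\<in>carrier G. \<forall>z\<in>N. f (a g z) = b g (f z))"

record ('p, 'q, 'm, 'g) principal =
  total :: "('p, 'q) manifold"
  pproj :: "'p \<Rightarrow> 'm"
  ract :: "'p \<Rightarrow> 'g \<Rightarrow> 'p"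

definition principal_bundle ::
  "('g, 'b) monoid_scheme \<Rightarrow> ('g, 'h::real_normed_vector) manifold \<Rightarrow>
   ('m, 'e::real_normed_vector) manifold \<Rightarrow> ('p, 'q::real_normed_vector, 'm, 'g) principal \<Rightarrow> bool"
  where "principal_bundle G GM M P \<longleftrightarrow>
    is_manifold M \<and> is_manifold (total P) \<and> smooth_map (total P) M (pproj P) \<and>
    smooth_map (prod_manifold (total P) GM) (total P) (\<lambda>(p, g). ract P p g) \<and>
    (\<forall>p\<in>points (total P). ract P p \<one>\<^bsub>G\<^esub> = p) \<and>
    (\<forall>p\<in>points (total P). \<forall>g\<in>carrier G. \<forall>h\<in>carrier G.
       ract P (ract P p g) h = ract P p (g \<otimes>\<^bsub>G\<^esub> h)) \<and>
    (\<forall>p\<in>points (total P). \<forall>g\<in>carrier G. pproj P (ract P p g) = pproj P p) \<and>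
    (\<forall>x\<in>points M. \<exists>U \<Psi>. x \<in> U \<and> local_trivialization (total P) M (pproj P) GM U \<Psi> \<and>
       (\<forall>p\<in>points (total P). \<forall>g\<in>carrier G. pproj P p \<in> U \<longrightarrow>
          \<Psi> (ract P p g) = (pproj P p, snd (\<Psi> p) \<otimes>\<^bsub>G\<^esub> g)))"

definition invariant_field ::
  "('g, 'b) monoid_scheme \<Rightarrow> ('p, 'q::real_normed_vector, 'm, 'g) principal \<Rightarrow>
   ('p \<Rightarrow> ('p, 'q) tangent) \<Rightarrow> bool"
  where "invariant_field G P Xt \<longleftrightarrow>
    vector_field (total P) Xt \<and>
    (\<forall>p\<in>points (total P). \<forall>g\<in>carrier G.
       Xt (ract P p g) = tangent_map (total P) (total P) (\<lambda>q. ract P q g) p (Xt p))"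

definition field_over ::
  "('m, 'e::real_normed_vector) manifold \<Rightarrow> ('p, 'q::real_normed_vector, 'm, 'g) principal \<Rightarrow>
   ('p \<Rightarrow> ('p, 'q) tangent) \<Rightarrow> ('m \<Rightarrow> ('m, 'e) tangent) \<Rightarrow> bool"
  where "field_over M P Xt X \<longleftrightarrow>
    vector_field M X \<and>
    (\<forall>p\<in>points (total P). tangent_map (total P) M (pproj P) p (Xt p) = X (pproj P p))"

text \<open>\<open>assoc_class G P a p z\<close> is the class \<open>[p, z]\<close>, as a subset of \<open>P \<times> N\<close>.\<close>

definition assoc_class ::
  "('g, 'b) monoid_scheme \<Rightarrow> ('p, 'q, 'm, 'g) principal \<Rightarrow> ('g \<Rightarrow> 'n \<Rightarrow> 'n) \<Rightarrow> 'p \<Rightarrow> 'n \<Rightarrow>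
   ('p \<times> 'n) set"
  where "assoc_class G P a p z = {(ract P p g, a (inv\<^bsub>G\<^esub> g) z) | g. g \<in> carrier G}"

definition assoc_proj ::
  "('g, 'b) monoid_scheme \<Rightarrow> ('p, 'q, 'm, 'g) principal \<Rightarrow> ('n, 'f) manifold \<Rightarrow>
   ('g \<Rightarrow> 'n \<Rightarrow> 'n) \<Rightarrow> ('p \<times> 'n) set \<Rightarrow> 'm"
  where "assoc_proj G P N a \<xi> = (THE x. \<exists>p\<in>points (total P). \<exists>z\<in>points N.
    \<xi> = assoc_class G P a p z \<and> x = pproj P p)"

text \<open>
  The smooth structure of \<open>P \<times>\<^sub>G N\<close>: a local section \<open>s\<close> of \<open>P\<close> over a chart domain of \<open>M\<close> and a
  chart of \<open>N\<close> give coordinates on the classes \<open>[s x, z]\<close>.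
\<close>

definition assoc_manifold ::
  "('g, 'b) monoid_scheme \<Rightarrow> ('m, 'e::real_normed_vector) manifold \<Rightarrow>
   ('p, 'q::real_normed_vector, 'm, 'g) principal \<Rightarrow> ('n, 'f::real_normed_vector) manifold \<Rightarrow>
   ('g \<Rightarrow> 'n \<Rightarrow> 'n) \<Rightarrow> (('p \<times> 'n) set, 'e \<times> 'f) manifold"
  where "assoc_manifold G M P N a =
    generated {({assoc_class G P a (s x) z | x z. x \<in> fst c \<and> z \<in> fst d},
        \<lambda>\<xi>. THE w. \<exists>x\<in>fst c. \<exists>z\<in>fst d. \<xi> = assoc_class G P a (s x) z \<and> w = (snd c x, snd d z)) | c d s.
      c \<in> M \<and> d \<in> N \<and> smooth_map (open_submanifold M (fst c)) (total P) s \<and>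
      (\<forall>x\<in>fst c. pproj P (s x) = x)}"

text \<open>The map \<open>id \<times>\<^sub>G f\<close>, where \<open>N\<close> is the set of points of the domain of \<open>f\<close>.\<close>

definition assoc_map ::
  "('g, 'b) monoid_scheme \<Rightarrow> ('p, 'q, 'm, 'g) principal \<Rightarrow> 'n set \<Rightarrow> ('g \<Rightarrow> 'n \<Rightarrow> 'n) \<Rightarrow>
   ('g \<Rightarrow> 'r \<Rightarrow> 'r) \<Rightarrow> ('n \<Rightarrow> 'r) \<Rightarrow> ('p \<times> 'n) set \<Rightarrow> ('p \<times> 'r) set"
  where "assoc_map G P N a b f \<xi> = (THE \<eta>. \<exists>p\<in>points (total P). \<exists>z\<in>N.
    \<xi> = assoc_class G P a p z \<and> \<eta> = assoc_class G P b p (f z))"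

text \<open>The evaluation \<open>[p, \<alpha>]([p, v]) = [p, \<alpha>(v)]\<close>.\<close>

definition assoc_eval ::
  "('g, 'b) monoid_scheme \<Rightarrow> ('p, 'q, 'm, 'g) principal \<Rightarrow> ('g \<Rightarrow> 'v \<Rightarrow> 'v::real_normed_vector) \<Rightarrow>
   ('g \<Rightarrow> 'w \<Rightarrow> 'w::real_normed_vector) \<Rightarrow> ('p \<times> ('v \<Rightarrow>\<^sub>L 'w)) set \<Rightarrow> ('p \<times> 'v) set \<Rightarrow> ('p \<times> 'w) set"
  where "assoc_eval G P \<rho> \<rho>' A \<xi> = (THE \<eta>. \<exists>p\<in>points (total P). \<exists>\<alpha> v.
    A = assoc_class G P (hom_action G \<rho> \<rho>') p \<alpha> \<and> \<xi> = assoc_class G P \<rho> p v \<and>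
    \<eta> = assoc_class G P \<rho>' p (blinfun_apply \<alpha> v))"

text \<open>
  The generator of the local flow \<open>[p, z] \<mapsto> [\<Phi>\<^sup>t p, z]\<close> on \<open>P \<times>\<^sub>G N\<close>, where \<open>\<Phi>\<close> is the flow of \<open>Xt\<close>.
\<close>

definition assoc_field ::
  "('g, 'b) monoid_scheme \<Rightarrow> ('m, 'e::real_normed_vector) manifold \<Rightarrow>
   ('p, 'q::real_normed_vector, 'm, 'g) principal \<Rightarrow> ('n, 'f::real_normed_vector) manifold \<Rightarrow>
   ('g \<Rightarrow> 'n \<Rightarrow> 'n) \<Rightarrow> ('p \<Rightarrow> ('p, 'q) tangent) \<Rightarrow> ('p \<times> 'n) set \<Rightarrow>
   (('p \<times> 'n) set, 'e \<times> 'f) tangent"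
  where "assoc_field G M P N a Xt \<xi> = (THE v. \<exists>p\<in>points (total P). \<exists>z\<in>points N.
    \<xi> = assoc_class G P a p z \<and>
    has_velocity (assoc_manifold G M P N a) (\<lambda>t. assoc_class G P a (flow (total P) Xt t p) z) 0 v)"


section \<open>Vector-valued 1-forms and the Darboux-Lie derivative\<close>

definition one_form ::
  "('n, 'f::real_normed_vector) manifold \<Rightarrow>
   ('n \<Rightarrow> ('n, 'f) tangent \<Rightarrow> 'v::real_normed_vector) \<Rightarrow> bool"
  where "one_form N \<omega> \<longleftrightarrow> (\<forall>c\<in>N.
    (\<forall>z\<in>fst c. linear (\<lambda>w. \<omega> z (tangent_vector N z c w))) \<and>
    (\<forall>w. smooth_on (snd c ` fst c)
       (\<lambda>u. \<omega> (chart_inv c u) (tangent_vector N (chart_inv c u) c w))))"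

definition equivariant_form ::
  "('g, 'b) monoid_scheme \<Rightarrow> ('n, 'f::real_normed_vector) manifold \<Rightarrow> ('g \<Rightarrow> 'n \<Rightarrow> 'n) \<Rightarrow>
   ('g \<Rightarrow> 'v \<Rightarrow> 'v) \<Rightarrow> ('n \<Rightarrow> ('n, 'f) tangent \<Rightarrow> 'v::real_normed_vector) \<Rightarrow> bool"
  where "equivariant_form G N a \<rho> \<omega> \<longleftrightarrow>
    one_form N \<omega> \<and>
    (\<forall>g\<in>carrier G. \<forall>z\<in>points N. \<forall>v\<in>tangent_space N z.
       \<omega> (a g z) (tangent_map N N (a g) z v) = \<rho> g (\<omega> z v))"

definition pullback ::
  "('n, 'f::real_normed_vector) manifold \<Rightarrow> ('r, 'k::real_normed_vector) manifold \<Rightarrow>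
   ('n \<Rightarrow> 'r) \<Rightarrow> ('r \<Rightarrow> ('r, 'k) tangent \<Rightarrow> 'v) \<Rightarrow> 'n \<Rightarrow> ('n, 'f) tangent \<Rightarrow> 'v"
  where "pullback N N' f \<omega>' z v = \<omega>' (f z) (tangent_map N N' f z v)"

text \<open>Fiber bundle maps \<open>h : E \<rightarrow> P \<times>\<^sub>G N\<close> over the identity of \<open>M\<close>, with \<open>pE : E \<rightarrow> M\<close>.\<close>

definition bundle_map_to_assoc ::
  "('g, 'b) monoid_scheme \<Rightarrow> ('m, 'e::real_normed_vector) manifold \<Rightarrow>
   ('p, 'q::real_normed_vector, 'm, 'g) principal \<Rightarrow> ('n, 'f::real_normed_vector) manifold \<Rightarrow>
   ('g \<Rightarrow> 'n \<Rightarrow> 'n) \<Rightarrow> ('t, 'u::real_normed_vector) manifold \<Rightarrow> ('t \<Rightarrow> 'm) \<Rightarrow>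
   ('t \<Rightarrow> ('p \<times> 'n) set) \<Rightarrow> bool"
  where "bundle_map_to_assoc G M P N a E pE h \<longleftrightarrow>
    smooth_map E (assoc_manifold G M P N a) h \<and>
    (\<forall>y\<in>points E. assoc_proj G P N a (h y) = pE y)"

text \<open>
  \<open>E\<close> is the total space \<open>F(M)\<close> and \<open>FX\<close> the canonical lift to it of the vector field under \<open>Xt\<close>.
\<close>

definition darboux_lie ::
  "('g, 'b) monoid_scheme \<Rightarrow> ('m, 'e::real_normed_vector) manifold \<Rightarrow>
   ('p, 'q::real_normed_vector, 'm, 'g) principal \<Rightarrow> ('n, 'f::real_normed_vector) manifold \<Rightarrow>
   ('g \<Rightarrow> 'n \<Rightarrow> 'n) \<Rightarrow> ('g \<Rightarrow> 'v \<Rightarrow> 'v) \<Rightarrow> ('n \<Rightarrow> ('n, 'f) tangent \<Rightarrow> 'v) \<Rightarrow>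
   ('t, 'u::real_normed_vector) manifold \<Rightarrow> ('t \<Rightarrow> ('t, 'u) tangent) \<Rightarrow>
   ('p \<Rightarrow> ('p, 'q) tangent) \<Rightarrow> ('t \<Rightarrow> ('p \<times> 'n) set) \<Rightarrow> 't \<Rightarrow> ('p \<times> 'v) set"
  where "darboux_lie G M P N a \<rho> \<omega> E FX Xt h y = (THE \<xi>.
    \<exists>p\<in>points (total P). \<exists>I \<gamma> v. 0 \<in> I \<and> smooth_curve N I \<gamma> \<and> has_velocity N \<gamma> 0 v \<and>
      has_velocity (assoc_manifold G M P N a) (\<lambda>t. assoc_class G P a p (\<gamma> t)) 0
        (\<lambda>c. tangent_map E (assoc_manifold G M P N a) h y (FX y) c -
             assoc_field G M P N a Xt (h y) c) \<and>
      assoc_class G P a p (\<gamma> 0) = h y \<and>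
      \<xi> = assoc_class G P \<rho> p (\<omega> (\<gamma> 0) v))"

end

theory Submission
  imports Defs
begin

text \<open>
  Write \<open>D = T\<^sub>yh(FX) - X\<^sub>N\<close> for the vertical vector whose \<open>\<omega>\<close>-value is the Darboux-Lie derivative.
  The map \<open>id \<times>\<^sub>G f\<close> is smooth and sends the flow \<open>[\<Phi>\<^sup>t p, z]\<close> to \<open>[\<Phi>\<^sup>t p, f z]\<close>, so its tangent map sends
  \<open>D\<close> to the corresponding vertical vector of \<open>(id \<times>\<^sub>G f) \<circ> h\<close>. Hence if \<open>[p, \<gamma>]\<close> represents \<open>D\<close>, then
  \<open>[p, f \<circ> \<gamma>]\<close> represents its image, and \<open>\<omega>'\<close> of its velocity is \<open>\<phi>(\<gamma>(0))\<close> applied to \<open>\<omega>\<close> of the velocity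
  of \<open>\<gamma>\<close>. All the effort lies in well-definedness: flows exist and are unique, associated bundles are
  manifolds, \<open>D\<close> is vertical because the canonical lift projects to the given field, and by equivariance
  the value does not depend on the representative \<open>[p, \<gamma>]\<close>.
\<close>

section \<open>Finite-dimensional normed spaces\<close>

text \<open>The model spaces are finite-dimensional normed spaces that are not assumed to be
  instances of \<open>banach\<close> or \<open>euclidean_space\<close>, so bounded coordinate
  functionals, composition of smooth functions and local existence of flows are derived from a
  finite spanning set. Manifold arguments run through \<open>premanifold\<close>; Hausdorffness
  enters through the uniqueness of integral curves on \<open>total P\<close>, \<open>M\<close> and
  \<open>obj F M\<close>. No flow is constructed on the associated bundle:
  \<open>assoc_field\<close> is handled as the velocity at time 0 of a single curve. Tangent vectors
  are families indexed by all charts, with value 0 away from the point, so a velocity is unique as a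
  function; identities between tangent maps are proved by following one curve and comparing its
  velocities. \<open>assoc_proj\<close>, \<open>assoc_map\<close>, \<open>assoc_eval\<close>,
  \<open>assoc_field\<close> and \<open>darboux_lie\<close> are definite descriptions, and each is
  first evaluated on an arbitrary representative. Freeness of the right action, which separates
  [p, z] from [p, w], is read off trivializations.\<close>

lemma coordinates_bound:
  fixes B :: "'e::real_normed_vector set"
  assumes "finite B" "independent B"
  shows "\<exists>C>0. \<forall>c. \<forall>b\<in>B. \<bar>c b\<bar> \<le> C * norm (\<Sum>b\<in>B. c b *\<^sub>R b)"
  using assms
proof (induction B rule: finite_induct)
  case empty
  show ?case by (intro exI[of _ 1]) auto
next
  case (insert b B)
  have indB: "independent B" and bspan: "b \<notin> span B"
    using insert.prems insert.hyps by (auto simp: independent_insert)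
  from insert.IH[OF indB] obtain C where C: "C > 0"
    "\<And>c b. b \<in> B \<Longrightarrow> \<bar>c b\<bar> \<le> C * norm (\<Sum>b\<in>B. c b *\<^sub>R b)" by blast
  \<comment> \<open>The new vector keeps a positive distance from \<open>span B\<close>. Otherwise
    points of the span converge to \<open>b\<close>; the inductive bound makes their coordinates
    Cauchy sequences of reals, and the limits of these are coordinates of \<open>b\<close>
    itself.\<close>
  have "\<exists>\<delta>>0. \<forall>y\<in>span B. norm (b - y) \<ge> \<delta>"
  proof (rule ccontr)
    assume neg: "\<not> ?thesis"
    have "\<exists>c. norm (b - (\<Sum>x\<in>B. c x *\<^sub>R x)) < inverse (Suc n)" for n :: nat
    proof -
      from neg have "\<not> (\<forall>y\<in>span B. norm (b - y) \<ge> inverse (real (Suc n)))"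
        by (auto simp del: of_nat_Suc)
      then obtain y where y: "y \<in> span B" "norm (b - y) < inverse (real (Suc n))" by auto
      then obtain c where "y = (\<Sum>x\<in>B. c x *\<^sub>R x)" using span_finite[OF insert.hyps(1)] by auto
      with y show ?thesis by blast
    qed
    then obtain c where c: "\<And>n :: nat. norm (b - (\<Sum>x\<in>B. c n x *\<^sub>R x)) < inverse (Suc n)" by metis
    define s where "s n = (\<Sum>x\<in>B. c n x *\<^sub>R x)" for n
    have "(\<lambda>n. norm (b - s n)) \<longlonglongrightarrow> 0"
      by (rule tendsto_sandwich[OF _ _ tendsto_const LIMSEQ_inverse_real_of_nat])
        (auto simp: s_def simp del: of_nat_Suc intro!: always_eventually less_imp_le c)
    then have "(\<lambda>n. b - s n) \<longlonglongrightarrow> 0" by (rule tendsto_norm_zero_cancel)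
    then have "(\<lambda>n. b - (b - s n)) \<longlonglongrightarrow> b - 0" by (intro tendsto_diff tendsto_const)
    then have lim: "s \<longlonglongrightarrow> b" by simp
    have "\<exists>l. (\<lambda>n. c n x) \<longlonglongrightarrow> l" if x: "x \<in> B" for x
    proof -
      have *: "\<bar>c m x - c n x\<bar> \<le> C * norm (s m - s n)" for m n
        using C(2)[OF x, of "\<lambda>x. c m x - c n x"]
        by (simp add: s_def scaleR_left_diff_distrib sum_subtractf)
      have "Cauchy s" using lim by (auto intro: LIMSEQ_imp_Cauchy)
      have "Cauchy (\<lambda>n. c n x)"
      proof (rule metric_CauchyI)
        fix e :: real assume "e > 0"
        then obtain K where K: "\<And>m n. m \<ge> K \<Longrightarrow> n \<ge> K \<Longrightarrow> dist (s m) (s n) < e / C"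
          using metric_CauchyD[OF \<open>Cauchy s\<close>, of "e / C"] C(1) by auto
        have "dist (c m x) (c n x) < e" if "m \<ge> K" "n \<ge> K" for m n
          using *[of m n] K[OF that] C(1) by (simp add: dist_norm field_simps)
        then show "\<exists>K. \<forall>m\<ge>K. \<forall>n\<ge>K. dist (c m x) (c n x) < e" by blast
      qed
      then show ?thesis using Cauchy_convergent_iff convergent_def by blast
    qed
    then obtain l where l: "\<And>x. x \<in> B \<Longrightarrow> (\<lambda>n. c n x) \<longlonglongrightarrow> l x" by metis
    have "s \<longlonglongrightarrow> (\<Sum>x\<in>B. l x *\<^sub>R x)"
      unfolding s_def by (intro tendsto_sum tendsto_scaleR l tendsto_const)
    with lim have "b = (\<Sum>x\<in>B. l x *\<^sub>R x)" by (rule LIMSEQ_unique)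
    then have "b \<in> span B" by (auto intro!: span_sum span_scale intro: span_base)
    with bspan show False by simp
  qed
  then obtain \<delta> where \<delta>: "\<delta> > 0" "\<And>y. y \<in> span B \<Longrightarrow> norm (b - y) \<ge> \<delta>" by blast
  \<comment> \<open>Division by \<open>c b\<close> turns the sum into \<open>b\<close> minus a point
    of \<open>span B\<close>.\<close>
  have b1: "\<bar>c b\<bar> * \<delta> \<le> norm (\<Sum>x\<in>insert b B. c x *\<^sub>R x)" for c
  proof (cases "c b = 0")
    case False
    define y where "y = - (\<Sum>x\<in>B. (c x / c b) *\<^sub>R x)"
    have "y \<in> span B" unfolding y_def by (auto intro!: span_neg span_sum span_scale intro: span_base)
    then have "\<delta> \<le> norm (b - y)" by (rule \<delta>)
    moreover have "c b *\<^sub>R (b - y) = (\<Sum>x\<in>insert b B. c x *\<^sub>R x)"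
      using insert.hyps False by (simp add: y_def scaleR_right_distrib scaleR_sum_right)
    ultimately show ?thesis
      by (metis abs_ge_zero mult_left_mono norm_scaleR)
  qed simp
  \<comment> \<open>\<open>1 / \<delta>\<close> bounds the new coordinate. The other summand bounds
    the old ones: \<open>c b *\<^sub>R b\<close> is moved to the other side before the inductive
    constant \<open>C\<close> applies.\<close>
  define K where "K = 1 / \<delta> + C * (1 + norm b / \<delta>)"
  have Kpos: "K > 0" unfolding K_def using C \<delta> by (intro add_pos_nonneg mult_nonneg_nonneg) auto
  have "\<bar>c x\<bar> \<le> K * norm (\<Sum>x\<in>insert b B. c x *\<^sub>R x)" if x: "x \<in> insert b B" for c x
  proof -
    let ?S = "norm (\<Sum>x\<in>insert b B. c x *\<^sub>R x)"
    have cb: "\<bar>c b\<bar> \<le> ?S / \<delta>" using b1[of c] \<delta> by (simp add: field_simps)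
    show ?thesis
    proof (cases "x = b")
      case True
      have "?S / \<delta> \<le> K * ?S" unfolding K_def using C \<delta>
        by (simp add: algebra_simps)
      with cb True show ?thesis by simp
    next
      case False
      with x have "x \<in> B" by simp
      have "(\<Sum>x\<in>B. c x *\<^sub>R x) = (\<Sum>x\<in>insert b B. c x *\<^sub>R x) - c b *\<^sub>R b"
        using insert.hyps by simp
      then have "norm (\<Sum>x\<in>B. c x *\<^sub>R x) \<le> ?S + \<bar>c b\<bar> * norm b"
        by (metis norm_scaleR norm_triangle_ineq4)
      also have "\<dots> \<le> ?S + ?S / \<delta> * norm b" using mult_right_mono[OF cb norm_ge_zero[of b]] by simp
      finally have "C * norm (\<Sum>x\<in>B. c x *\<^sub>R x) \<le> C * (?S + ?S / \<delta> * norm b)"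
        using C(1) by (simp add: mult_left_mono)
      also have "\<dots> \<le> K * ?S" unfolding K_def using \<delta> by (simp add: algebra_simps)
      finally show ?thesis using C(2)[OF \<open>x \<in> B\<close>, of c] by linarith
    qed
  qed
  with Kpos show ?case by blast
qed

text \<open>A basis with its dual functionals; duality encodes independence. Boundedness is demanded
  for every \<open>b\<close>, also outside \<open>B\<close>, so that it can be used without
  membership conditions.\<close>

definition coordinates :: "'e::real_normed_vector set \<Rightarrow> ('e \<Rightarrow> 'e \<Rightarrow> real) \<Rightarrow> bool"
  where "coordinates B \<kappa> \<longleftrightarrow> finite B \<and> (\<forall>b. bounded_linear (\<kappa> b)) \<and>
    (\<forall>x. x = (\<Sum>b\<in>B. \<kappa> b x *\<^sub>R b)) \<and> (\<forall>b\<in>B. \<forall>c\<in>B. \<kappa> b c = (if b = c then 1 else 0))"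

lemma coordinatesD:
  assumes "coordinates B \<kappa>"
  shows "finite B" "bounded_linear (\<kappa> b)" "x = (\<Sum>b\<in>B. \<kappa> b x *\<^sub>R b)"
    "b \<in> B \<Longrightarrow> c \<in> B \<Longrightarrow> \<kappa> b c = (if b = c then 1 else 0)"
proof -
  note * = assms[unfolded coordinates_def]
  show "finite B" by (rule conjunct1[OF *])
  show "bounded_linear (\<kappa> b)" by (rule spec[OF *[THEN conjunct2, THEN conjunct1]])
  show "x = (\<Sum>b\<in>B. \<kappa> b x *\<^sub>R b)" by (rule spec[OF *[THEN conjunct2, THEN conjunct2, THEN conjunct1]])
  show "b \<in> B \<Longrightarrow> c \<in> B \<Longrightarrow> \<kappa> b c = (if b = c then 1 else 0)" 
    by (rule bspec[OF bspec[OF *[THEN conjunct2, THEN conjunct2, THEN conjunct2]]])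
qed

lemma finite_dim_coordinates:
  assumes "finite_dim TYPE('e::real_normed_vector)"
  shows "\<exists>(B :: 'e::real_normed_vector set) \<kappa>. coordinates B \<kappa>"
proof -
  from assms obtain S :: "'e set" where S: "finite S" "span S = UNIV" by (auto simp: finite_dim_def)
  obtain B where B: "B \<subseteq> S" "independent B" "S \<subseteq> span B"
    using maximal_independent_subset[of S] by blast
  have fin: "finite B" using B(1) S(1) finite_subset by blast
  have sp: "span B = UNIV" using B(3) S(2) by (metis span_minimal subspace_span top.extremum_unique)
  define \<kappa> where "\<kappa> b x = (if b \<in> B then representation B x b else 0)" for b x
  have rep: "x = (\<Sum>b\<in>B. \<kappa> b x *\<^sub>R b)" for x
    using real_vector.sum_representation_eq[OF B(2), of x B] fin sp by (simp add: \<kappa>_def)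
  obtain C where C: "C > 0" "\<And>c b. b \<in> B \<Longrightarrow> \<bar>c b\<bar> \<le> C * norm (\<Sum>b\<in>B. c b *\<^sub>R b)"
    using coordinates_bound[OF fin B(2)] by blast
  have bl: "bounded_linear (\<kappa> b)" for b
  proof (rule bounded_linear_intro[where K=C])
    show "\<kappa> b (x + y) = \<kappa> b x + \<kappa> b y" for x y
      using sp by (simp add: \<kappa>_def real_vector.representation_add[OF B(2)])
    show "\<kappa> b (r *\<^sub>R x) = r *\<^sub>R \<kappa> b x" for r x
      using sp by (simp add: \<kappa>_def real_vector.representation_scale[OF B(2)])
    show "norm (\<kappa> b x) \<le> norm x * C" for x
    proof (cases "b \<in> B")
      case True
      then show ?thesis using C(2)[OF True, of "\<lambda>b. \<kappa> b x"] rep[of x] by (simp add: mult.commute)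
    qed (use C(1) in \<open>simp add: \<kappa>_def\<close>)
  qed
  have dual: "\<kappa> b c = (if b = c then 1 else 0)" if "b \<in> B" "c \<in> B" for b c
    using that real_vector.representation_basis[OF B(2) that(2)] by (auto simp: \<kappa>_def)
  have "coordinates B \<kappa>"
    unfolding coordinates_def by (intro conjI allI ballI fin bl dual) (rule rep)
  then show ?thesis by blast
qed

text \<open>A linear map is a finite sum of bounded coordinate functionals times fixed vectors. This
  makes the operators of a G-module bounded, as \<open>Blinfun\<close> in \<open>hom_action\<close>
  requires.\<close>

lemma finite_dim_linear_bounded:
  fixes f :: "'e::real_normed_vector \<Rightarrow> 'f::real_normed_vector"
  assumes "finite_dim TYPE('e)" "linear f"
  shows "bounded_linear f"
proof -
  obtain B :: "'e set" and \<kappa> where "coordinates B \<kappa>"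
    using finite_dim_coordinates[OF assms(1)] by blast
  note B = coordinatesD[OF this]
  have "f = (\<lambda>x. \<Sum>b\<in>B. \<kappa> b x *\<^sub>R f b)"
  proof
    fix x
    have "f x = f (\<Sum>b\<in>B. \<kappa> b x *\<^sub>R b)" by (rule arg_cong[OF B(3)])
    then show "f x = (\<Sum>b\<in>B. \<kappa> b x *\<^sub>R f b)"
      by (simp add: linear_sum[OF assms(2)] linear_cmul[OF assms(2)])
  qed
  moreover have "bounded_linear (\<lambda>x. \<Sum>b\<in>B. \<kappa> b x *\<^sub>R f b)"
    by (intro bounded_linear_sum bounded_linear_compose[OF bounded_linear_scaleR_left] B(2))
  ultimately show ?thesis by simp
qed

lemma finite_dim_prod:
  assumes "finite_dim TYPE('e::real_normed_vector)" "finite_dim TYPE('f::real_normed_vector)"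
  shows "finite_dim TYPE('e::real_normed_vector \<times> 'f::real_normed_vector)"
proof -
  from assms obtain A :: "'e set" and B :: "'f set"
    where A: "finite A" "span A = UNIV" and B: "finite B" "span B = UNIV" by (auto simp: finite_dim_def)
  let ?S = "(\<lambda>x. (x, 0)) ` A \<union> Pair 0 ` B :: ('e \<times> 'f) set"
  have 1: "linear (\<lambda>x::'e. (x, 0::'f))" and 2: "linear (Pair (0::'e) :: 'f \<Rightarrow> _)"
    by (auto intro!: linearI)
  have "(x, y) \<in> span ?S" for x y
  proof -
    have "(x, 0) \<in> span ((\<lambda>x. (x, 0::'f)) ` A)" "(0, y) \<in> span (Pair (0::'e) ` B)"
      using linear_span_image[OF 1, of A] linear_span_image[OF 2, of B] A B by auto
    then have "(x, 0) + (0, y) \<in> span ?S"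
      by (meson Un_upper1 Un_upper2 in_mono span_add span_mono)
    then show ?thesis by simp
  qed
  then have "span ?S = UNIV" by auto
  then show ?thesis unfolding finite_dim_def using A(1) B(1) by (intro exI[of _ ?S]) simp
qed

section \<open>Calculus of smooth functions\<close>

lemma Ck_on_cong:
  assumes "open S" "\<And>x. x \<in> S \<Longrightarrow> f x = g x" "Ck_on k S f"
  shows "Ck_on k S g"
  using assms(2,3)
proof (induction k arbitrary: f g)
  case 0
  then show ?case using continuous_on_cong by (simp cong: continuous_on_cong)
next
  case (Suc k)
  have diff: "f differentiable at x" if "x \<in> S" for x using Suc.prems that by simp
  have "g differentiable at x" if "x \<in> S" for x
  proof -
    have "(f has_derivative frechet_derivative f (at x)) (at x)"
      using diff[OF that] frechet_derivative_works by blast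
    then have "(g has_derivative frechet_derivative f (at x)) (at x)"
      by (rule has_derivative_transform_within_open[OF _ assms(1) that Suc.prems(1)])
    then show ?thesis by (auto simp: differentiable_def)
  qed
  moreover have "Ck_on k S (\<lambda>x. frechet_derivative g (at x) v)" for v
  proof (rule Suc.IH)
    show "Ck_on k S (\<lambda>x. frechet_derivative f (at x) v)" using Suc.prems by simp
    show "frechet_derivative f (at x) v = frechet_derivative g (at x) v" if "x \<in> S" for x
      using frechet_derivative_transform_within_open[OF diff[OF that] assms(1) that Suc.prems(1)] by simp
  qed
  ultimately show ?case by simp
qed

lemma Ck_on_subset: "Ck_on k S f \<Longrightarrow> T \<subseteq> S \<Longrightarrow> Ck_on k T f"
  by (induction k arbitrary: f) (auto intro: continuous_on_subset)

lemma Ck_on_local: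
  assumes "\<And>x. x \<in> S \<Longrightarrow> \<exists>T. open T \<and> x \<in> T \<and> Ck_on k T f"
  shows "Ck_on k S f"
  using assms
proof (induction k arbitrary: f)
  case 0
  have "isCont f x" if "x \<in> S" for x using 0[OF that] by (auto simp: continuous_on_eq_continuous_at)
  then show ?case by (auto intro: continuous_at_imp_continuous_on)
next
  case (Suc k)
  have "f differentiable at x" if "x \<in> S" for x using Suc.prems[OF that] by auto
  moreover have "Ck_on k S (\<lambda>x. frechet_derivative f (at x) v)" for v
    by (rule Suc.IH) (metis Suc.prems Ck_on.simps(2))
  ultimately show ?case by simp
qed

lemma Ck_on_SucD: "Ck_on (Suc k) S f \<Longrightarrow> Ck_on k S f"
proof (induction k arbitrary: f)
  case 0
  then show ?case
    by (auto intro!: continuous_at_imp_continuous_on differentiable_imp_continuous_within)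
next
  case (Suc k)
  have "Ck_on (Suc k) S (\<lambda>x. frechet_derivative f (at x) v)" for v
    using Suc.prems by (simp only: Ck_on.simps(2)[of "Suc k"])
  then have "Ck_on k S (\<lambda>x. frechet_derivative f (at x) v)" for v by (rule Suc.IH)
  then show ?case using Suc.prems by simp
qed

text \<open>Derivative computations give \<open>frechet_derivative\<close> only on \<open>S\<close>, hence the openness of \<open>S\<close>.\<close>

lemma Ck_on_SucI:
  assumes "open S" "\<And>x. x \<in> S \<Longrightarrow> (f has_derivative D x) (at x)" "\<And>v. Ck_on k S (\<lambda>x. D x v)"
  shows "Ck_on (Suc k) S f"
proof -
  have eq: "frechet_derivative f (at x) = D x" if "x \<in> S" for x
    using frechet_derivative_at[OF assms(2)[OF that]] by simp
  have "Ck_on k S (\<lambda>x. frechet_derivative f (at x) v)" for v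
    by (rule Ck_on_cong[OF assms(1) _ assms(3)[of v]]) (simp add: eq)
  then show ?thesis using assms(2) by (auto simp: differentiable_def)
qed

lemma Ck_on_has_derivative:
  "Ck_on (Suc k) S f \<Longrightarrow> x \<in> S \<Longrightarrow> (f has_derivative frechet_derivative f (at x)) (at x)"
  by (simp add: frechet_derivative_works)

lemma Ck_on_const: "open S \<Longrightarrow> Ck_on k S (\<lambda>x. c)"
  by (induction k arbitrary: c) auto

lemma Ck_on_bounded_linear:
  assumes "bounded_linear L" "open S" "Ck_on k S f"
  shows "Ck_on k S (\<lambda>x. L (f x))"
  using assms(3)
proof (induction k arbitrary: f)
  case 0
  then show ?case by (simp add: bounded_linear.continuous_on[OF assms(1)])
next
  case (Suc k)
  show ?case
  proof (rule Ck_on_SucI[OF assms(2)])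
    show "((\<lambda>x. L (f x)) has_derivative (\<lambda>v. L (frechet_derivative f (at x) v))) (at x)" if "x \<in> S" for x
      by (rule bounded_linear.has_derivative[OF assms(1) Ck_on_has_derivative[OF Suc.prems that]])
    show "Ck_on k S (\<lambda>x. L (frechet_derivative f (at x) v))" for v
      using Suc.prems by (intro Suc.IH) simp
  qed
qed

lemma Ck_on_add:
  assumes "open S" "Ck_on k S f" "Ck_on k S g"
  shows "Ck_on k S (\<lambda>x. f x + g x)"
  using assms(2,3)
proof (induction k arbitrary: f g)
  case 0
  then show ?case by (simp add: continuous_on_add)
next
  case (Suc k)
  show ?case
  proof (rule Ck_on_SucI[OF assms(1)])
    show "((\<lambda>x. f x + g x) has_derivative
        (\<lambda>v. frechet_derivative f (at x) v + frechet_derivative g (at x) v)) (at x)" if "x \<in> S" for x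
      by (rule has_derivative_add[OF Suc.prems[THEN Ck_on_has_derivative, OF that]])
    show "Ck_on k S (\<lambda>x. frechet_derivative f (at x) v + frechet_derivative g (at x) v)" for v
      using Suc.prems by (intro Suc.IH) auto
  qed
qed

lemma Ck_on_sum:
  assumes "open S" "finite I" "\<And>i. i \<in> I \<Longrightarrow> Ck_on k S (f i)"
  shows "Ck_on k S (\<lambda>x. \<Sum>i\<in>I. f i x)"
  using assms(2,3)
  by (induction I rule: finite_induct) (auto intro: Ck_on_add Ck_on_const assms(1))

lemma Ck_on_scaleR:
  assumes "open S" "Ck_on k S f" "Ck_on k S g"
  shows "Ck_on k S (\<lambda>x. f x *\<^sub>R g x)"
  using assms(2,3)
proof (induction k arbitrary: f g)
  case 0
  then show ?case by (simp add: continuous_on_scaleR)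
next
  case (Suc k)
  show ?case
  proof (rule Ck_on_SucI[OF assms(1)])
    show "((\<lambda>x. f x *\<^sub>R g x) has_derivative
        (\<lambda>v. f x *\<^sub>R frechet_derivative g (at x) v + frechet_derivative f (at x) v *\<^sub>R g x)) (at x)"
      if "x \<in> S" for x
      by (rule has_derivative_scaleR[OF Suc.prems[THEN Ck_on_has_derivative, OF that]])
    \<comment> \<open>The product rule leaves \<open>f\<close> and \<open>g\<close> undifferentiated
      in one factor each, so their order is lowered by \<open>Ck_on_SucD\<close> before the
      induction hypothesis applies.\<close>
    show "Ck_on k S (\<lambda>x. f x *\<^sub>R frechet_derivative g (at x) v + frechet_derivative f (at x) v *\<^sub>R g x)" for v
      using Suc.prems Suc.prems[THEN Ck_on_SucD] by (intro Ck_on_add assms(1) Suc.IH) auto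
  qed
qed

lemma Ck_on_Pair:
  assumes "open S" "Ck_on k S f" "Ck_on k S g"
  shows "Ck_on k S (\<lambda>x. (f x, g x))"
proof -
  have "Ck_on k S (\<lambda>x. (f x, 0) + (0, g x))"
    by (intro Ck_on_add Ck_on_bounded_linear[of "\<lambda>y. (y, 0)"] Ck_on_bounded_linear[of "Pair 0"]
        bounded_linear_Pair bounded_linear_ident bounded_linear_zero assms)
  then show ?thesis by simp
qed

text \<open>\<open>Ck_on\<close> controls derivatives in fixed directions only, whereas the chain
  rule differentiates \<open>g\<close> in the moving direction given by the derivative of
  \<open>f\<close>. Expanding that direction in a basis of the middle space gives a finite sum of
  products, each of class k by induction.\<close>

lemma Ck_on_compose:
  fixes f :: "'e::real_normed_vector \<Rightarrow> 'f::real_normed_vector" and g :: "'f \<Rightarrow> 'g::real_normed_vector"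
  assumes "finite_dim TYPE('f)" "open S" "f ` S \<subseteq> T" "Ck_on k S f" "Ck_on k T g"
  shows "Ck_on k S (\<lambda>x. g (f x))"
  using assms(4,5)
proof (induction k arbitrary: g)
  case 0
  then show ?case using continuous_on_compose2[OF _ _ assms(3)] by simp
next
  case (Suc k)
  obtain B :: "'f set" and \<kappa> where "coordinates B \<kappa>"
    using finite_dim_coordinates[OF assms(1)] by blast
  note B = coordinatesD[OF this]
  let ?D = "\<lambda>x v. \<Sum>b\<in>B. \<kappa> b (frechet_derivative f (at x) v) *\<^sub>R frechet_derivative g (at (f x)) b"
  show ?case
  proof (rule Ck_on_SucI[OF assms(2)])
    fix x assume x: "x \<in> S"
    have g': "(g has_derivative frechet_derivative g (at (f x))) (at (f x))"
      using Ck_on_has_derivative[OF Suc.prems(2)] x assms(3) by auto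
    have lin: "linear (frechet_derivative g (at (f x)))"
      using g' has_derivative_linear by blast
    have "frechet_derivative g (at (f x)) (frechet_derivative f (at x) v) = ?D x v" for v
    proof -
      let ?w = "frechet_derivative f (at x) v"
      have "frechet_derivative g (at (f x)) ?w = frechet_derivative g (at (f x)) (\<Sum>b\<in>B. \<kappa> b ?w *\<^sub>R b)"
        by (rule arg_cong[OF B(3)])
      then show ?thesis by (simp add: linear_sum[OF lin] linear_cmul[OF lin])
    qed
    then show "((\<lambda>x. g (f x)) has_derivative ?D x) (at x)"
      using has_derivative_compose[OF Ck_on_has_derivative[OF Suc.prems(1) x] g'] by simp
  next
    fix v
    show "Ck_on k S (\<lambda>x. ?D x v)"
    proof (rule Ck_on_sum[OF assms(2) B(1)], rule Ck_on_scaleR[OF assms(2)])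
      show "Ck_on k S (\<lambda>x. \<kappa> b (frechet_derivative f (at x) v))" for b
        using Suc.prems by (intro Ck_on_bounded_linear[OF B(2) assms(2)]) simp
      show "Ck_on k S (\<lambda>x. frechet_derivative g (at (f x)) b)" for b
        using Suc.prems by (intro Suc.IH Ck_on_SucD[OF Suc.prems(1)]) simp
    qed
  qed
qed

lemma smooth_on_cong:
  "open S \<Longrightarrow> (\<And>x. x \<in> S \<Longrightarrow> f x = g x) \<Longrightarrow> smooth_on S f \<Longrightarrow> smooth_on S g"
  unfolding smooth_on_def using Ck_on_cong by blast

lemma smooth_on_subset: "smooth_on S f \<Longrightarrow> T \<subseteq> S \<Longrightarrow> smooth_on T f"
  unfolding smooth_on_def using Ck_on_subset by blast

lemma smooth_on_local:
  "(\<And>x. x \<in> S \<Longrightarrow> \<exists>T. open T \<and> x \<in> T \<and> smooth_on T f) \<Longrightarrow> smooth_on S f"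
  unfolding smooth_on_def by (metis Ck_on_local)

lemma smooth_on_bounded_linear:
  "bounded_linear L \<Longrightarrow> open S \<Longrightarrow> smooth_on S f \<Longrightarrow> smooth_on S (\<lambda>x. L (f x))"
  unfolding smooth_on_def using Ck_on_bounded_linear by blast

lemma smooth_on_const: "open S \<Longrightarrow> smooth_on S (\<lambda>x. c)"
  unfolding smooth_on_def using Ck_on_const by blast

lemma smooth_on_ident: "open S \<Longrightarrow> smooth_on S (\<lambda>x. x)"
  unfolding smooth_on_def
proof
  fix k assume S: "open S"
  show "Ck_on k S (\<lambda>x. x)"
  proof (cases k)
    case (Suc j)
    show ?thesis unfolding Suc by (rule Ck_on_SucI[OF S has_derivative_ident Ck_on_const[OF S]])
  qed simp
qed

lemma smooth_on_Pair:
  "open S \<Longrightarrow> smooth_on S f \<Longrightarrow> smooth_on S g \<Longrightarrow> smooth_on S (\<lambda>x. (f x, g x))"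
  unfolding smooth_on_def using Ck_on_Pair by blast

lemma smooth_on_add:
  "open S \<Longrightarrow> smooth_on S f \<Longrightarrow> smooth_on S g \<Longrightarrow> smooth_on S (\<lambda>x. f x + g x)"
  unfolding smooth_on_def using Ck_on_add by blast

lemma smooth_on_compose:
  fixes f :: "'e::real_normed_vector \<Rightarrow> 'f::real_normed_vector" and g :: "'f \<Rightarrow> 'g::real_normed_vector"
  assumes "finite_dim TYPE('f)" "open S" "f ` S \<subseteq> T" "smooth_on S f" "smooth_on T g"
  shows "smooth_on S (\<lambda>x. g (f x))"
  using assms Ck_on_compose unfolding smooth_on_def by blast

lemma smooth_on_continuous: "smooth_on S f \<Longrightarrow> continuous_on S f"
  unfolding smooth_on_def using Ck_on.simps(1) by blast

lemma smooth_on_has_derivative: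
  "smooth_on S f \<Longrightarrow> x \<in> S \<Longrightarrow> (f has_derivative frechet_derivative f (at x)) (at x)"
  unfolding smooth_on_def using Ck_on_has_derivative by blast

lemma smooth_on_fst: "open S \<Longrightarrow> smooth_on S fst"
  by (rule smooth_on_bounded_linear[OF bounded_linear_fst _ smooth_on_ident])

lemma smooth_on_snd: "open S \<Longrightarrow> smooth_on S snd"
  by (rule smooth_on_bounded_linear[OF bounded_linear_snd _ smooth_on_ident])

section \<open>Charts and smooth maps\<close>

text \<open>
  The part of \<open>is_manifold\<close> that matters for smooth maps. Unlike \<open>generated M = M\<close> and the separation
  axioms, it passes to open submanifolds, products and associated bundles without further work.
\<close>

definition premanifold :: "('a, 'e::real_normed_vector) manifold \<Rightarrow> bool"
  where "premanifold M \<longleftrightarrow> finite_dim TYPE('e) \<and> smooth_atlas M \<and>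
    (\<forall>c\<in>M. \<forall>W. W \<subseteq> fst c \<longrightarrow> open (snd c ` W) \<longrightarrow> (W, snd c) \<in> M)"

lemma chart_inv_chart: "is_chart c \<Longrightarrow> x \<in> fst c \<Longrightarrow> chart_inv c (snd c x) = x"
  unfolding is_chart_def by (simp add: inv_into_f_f)

lemma chart_mem_iff: "is_chart c \<Longrightarrow> x \<in> fst c \<Longrightarrow> W \<subseteq> fst c \<Longrightarrow> snd c x \<in> snd c ` W \<longleftrightarrow> x \<in> W"
  unfolding is_chart_def by (rule inj_on_image_mem_iff) auto

lemma chart_image_Int:
  "is_chart c \<Longrightarrow> V \<subseteq> fst c \<Longrightarrow> W \<subseteq> fst c \<Longrightarrow> snd c ` (V \<inter> W) = snd c ` V \<inter> snd c ` W"
  unfolding is_chart_def by (metis inj_on_image_Int)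

lemma compatible_open: "compatible c d \<Longrightarrow> open (snd c ` (fst c \<inter> fst d))"
  by (simp add: compatible_def smooth_transition_def)

lemma compatible_smooth:
  "compatible c d \<Longrightarrow> smooth_on (snd c ` (fst c \<inter> fst d)) (\<lambda>u. snd d (chart_inv c u))"
  by (simp add: compatible_def smooth_transition_def comp_def)

lemma compatible_sym: "compatible c d \<Longrightarrow> compatible d c"
  by (simp add: compatible_def)

text \<open>The image under \<open>d\<close> is the preimage of the image under \<open>c\<close> by
  the continuous transition map from \<open>d\<close> to \<open>c\<close>.\<close>

lemma compatible_image_open:
  assumes "compatible c d" "is_chart c" "is_chart d" "W \<subseteq> fst c" "W \<subseteq> fst d" "open (snd c ` W)"
  shows "open (snd d ` W)"
proof -
  let ?T = "snd d ` (fst d \<inter> fst c)"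
  have "continuous_on ?T (\<lambda>u. snd c (chart_inv d u))"
    using assms(1) compatible_sym compatible_smooth smooth_on_continuous by blast
  then have "open (?T \<inter> (\<lambda>u. snd c (chart_inv d u)) -` (snd c ` W))"
    using assms compatible_open compatible_sym by (intro continuous_open_preimage) blast+
  moreover have "?T \<inter> (\<lambda>u. snd c (chart_inv d u)) -` (snd c ` W) = snd d ` W"
    using assms(4,5) chart_mem_iff[OF assms(2) _ assms(4)]
    by (auto simp: chart_inv_chart[OF assms(3)]) (metis image_eqI)
  ultimately show ?thesis by simp
qed

lemma is_chart_restrict: "is_chart c \<Longrightarrow> W \<subseteq> fst c \<Longrightarrow> open (snd c ` W) \<Longrightarrow> is_chart (W, snd c)"
  unfolding is_chart_def by (auto intro: inj_on_subset)

lemma compatible_restrict: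
  assumes "compatible c d" "is_chart c" "is_chart d" "W \<subseteq> fst c" "open (snd c ` W)"
  shows "compatible (W, snd c) d"
proof -
  have W: "is_chart (W, snd c)" using is_chart_restrict assms by blast
  have eq: "snd c ` (W \<inter> fst d) = snd c ` W \<inter> snd c ` (fst c \<inter> fst d)"
    using chart_image_Int[OF assms(2,4), of "fst c \<inter> fst d"] assms(4) by (simp add: Int_absorb2 flip: Int_assoc)
  have o: "open (snd c ` (W \<inter> fst d))"
    unfolding eq using assms(1,5) compatible_open by blast
  have o': "open (snd d ` (W \<inter> fst d))"
    by (rule compatible_image_open[OF assms(1-3)]) (use o assms(4) in auto)
  have 1: "smooth_on (snd c ` (W \<inter> fst d)) (\<lambda>u. snd d (inv_into W (snd c) u))"
    by (rule smooth_on_cong[OF o _ smooth_on_subset[OF compatible_smooth[OF assms(1)]]])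
      (use assms(4) chart_inv_chart[OF W] chart_inv_chart[OF assms(2)] in auto)
  have 2: "smooth_on (snd d ` (W \<inter> fst d)) (\<lambda>u. snd c (chart_inv d u))"
    by (rule smooth_on_subset[OF compatible_smooth[OF compatible_sym[OF assms(1)]]]) (use assms(4) in auto)
  show ?thesis using o o' 1 2
    by (simp add: compatible_def smooth_transition_def comp_def Int_commute)
qed

lemma premanifold_finite_dim: "premanifold (M :: ('a, 'e::real_normed_vector) manifold) \<Longrightarrow> finite_dim TYPE('e)"
  by (simp add: premanifold_def)

lemma premanifold_chart: "premanifold M \<Longrightarrow> c \<in> M \<Longrightarrow> is_chart c"
  by (simp add: premanifold_def smooth_atlas_def)

lemma premanifold_compatible: "premanifold M \<Longrightarrow> c \<in> M \<Longrightarrow> d \<in> M \<Longrightarrow> compatible c d"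
  by (simp add: premanifold_def smooth_atlas_def)

lemma premanifold_restrict:
  "premanifold M \<Longrightarrow> c \<in> M \<Longrightarrow> W \<subseteq> fst c \<Longrightarrow> open (snd c ` W) \<Longrightarrow> (W, snd c) \<in> M"
  by (simp add: premanifold_def)

lemma premanifold_chart_open: "premanifold M \<Longrightarrow> c \<in> M \<Longrightarrow> open (snd c ` fst c)"
  using premanifold_chart is_chart_def by blast

lemma points_chart: "x \<in> points M \<Longrightarrow> \<exists>c\<in>M. x \<in> fst c"
  by (auto simp: points_def)

lemma chart_points: "c \<in> M \<Longrightarrow> x \<in> fst c \<Longrightarrow> x \<in> points M"
  by (auto simp: points_def)

text \<open>Charts of the generated family are only known to be compatible with \<open>A\<close>.
  Near a common point the transition factors through a chart \<open>e\<close> of \<open>A\<close>,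
  as the transition from \<open>c\<close> to \<open>e\<close> followed by that from \<open>e\<close>
  to \<open>d\<close>.\<close>

lemma compatible_generated:
  fixes A :: "('a, 'e::real_normed_vector) chart set"
  assumes fd: "finite_dim TYPE('e)" and A: "smooth_atlas A" and c: "c \<in> generated A" and d: "d \<in> generated A"
  shows "smooth_transition c d"
proof -
  let ?S = "snd c ` (fst c \<inter> fst d)"
  have ch: "is_chart c" "is_chart d" using c d by (auto simp: generated_def)
  have loc: "\<exists>T. open T \<and> u \<in> T \<and> T \<subseteq> ?S \<and> smooth_on T (\<lambda>u. snd d (chart_inv c u))" if u: "u \<in> ?S" for u
  proof -
    from u obtain x where x: "u = snd c x" "x \<in> fst c" "x \<in> fst d" by auto
    then have "x \<in> points A" using c by (auto simp: generated_def)
    then obtain e where e: "e \<in> A" "x \<in> fst e" by (auto simp: points_def)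
    have che: "is_chart e" using A e by (simp add: smooth_atlas_def)
    have "compatible c e" "compatible d e" using c d e by (auto simp: generated_def)
    note ce = this(1) compatible_sym[OF this(2)] compatible_sym[OF this(1)]
    \<comment> \<open>The triple overlap is written as an intersection of two overlaps with
      \<open>e\<close>, whose images in the coordinates of \<open>e\<close> are open.\<close>
    let ?W = "fst e \<inter> fst c \<inter> (fst e \<inter> fst d)"
    have "open (snd e ` ?W)"
      using chart_image_Int[OF che, of "fst e \<inter> fst c" "fst e \<inter> fst d"] compatible_open[OF ce(2)]
        compatible_open[OF ce(3)] by auto
    then have o: "open (snd c ` ?W)"
      using compatible_image_open[OF ce(3) che ch(1), of ?W] by blast
    have "smooth_on (snd c ` ?W) (\<lambda>u. snd d (chart_inv e (snd e (chart_inv c u))))"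
      by (rule smooth_on_compose[OF fd o _ smooth_on_subset[OF compatible_smooth[OF ce(1)]] compatible_smooth[OF ce(2)]])
        (auto simp: chart_inv_chart[OF ch(1)])
    then have "smooth_on (snd c ` ?W) (\<lambda>u. snd d (chart_inv c u))"
      by (rule smooth_on_cong[OF o, rotated]) (auto simp: chart_inv_chart[OF ch(1)] chart_inv_chart[OF che])
    then show ?thesis using o x e by (intro exI[of _ "snd c ` ?W"]) auto
  qed
  have "open ?S" by (subst open_subopen) (use loc in blast)
  moreover have "smooth_on ?S (\<lambda>u. snd d (chart_inv c u))" by (rule smooth_on_local) (use loc in blast)
  ultimately show ?thesis by (simp add: smooth_transition_def comp_def)
qed

lemma atlas_subset_generated: "smooth_atlas A \<Longrightarrow> A \<subseteq> generated A"
  by (auto simp: generated_def smooth_atlas_def points_def)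

lemma points_generated: "smooth_atlas A \<Longrightarrow> points (generated A) = points A"
  using atlas_subset_generated[of A] by (fastforce simp: points_def generated_def)

lemma premanifold_generated:
  fixes A :: "('a, 'e::real_normed_vector) chart set"
  assumes fd: "finite_dim TYPE('e)" and A: "smooth_atlas A"
  shows "premanifold (generated A)"
  unfolding premanifold_def
proof (intro conjI ballI allI impI)
  show "finite_dim TYPE('e)" by fact
  show "smooth_atlas (generated A)"
    unfolding smooth_atlas_def compatible_def
    using compatible_generated[OF fd A] by (auto simp: generated_def)
next
  fix c W assume c: "c \<in> generated A" and W: "W \<subseteq> fst c" "open (snd c ` W)"
  have ch: "is_chart c" using c by (simp add: generated_def)
  show "(W, snd c) \<in> generated A"
    unfolding generated_def
  proof (intro CollectI conjI ballI)
    show "is_chart (W, snd c)" by (rule is_chart_restrict[OF ch W])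
    show "fst (W, snd c) \<subseteq> points A" using c W by (auto simp: generated_def)
    show "compatible (W, snd c) d" if "d \<in> A" for d
      using c that A W by (intro compatible_restrict[OF _ ch]) (auto simp: generated_def smooth_atlas_def)
  qed
qed

lemma is_manifold_premanifold: "is_manifold M \<Longrightarrow> premanifold M"
  unfolding is_manifold_def using premanifold_generated by metis

lemma premanifold_open: "premanifold M \<Longrightarrow> premanifold (open_submanifold M U)"
  by (auto simp: premanifold_def open_submanifold_def smooth_atlas_def)

lemma smooth_atlas_std: "smooth_atlas {(UNIV :: 'e::real_normed_vector set, \<lambda>x. x)}"
  by (auto simp: smooth_atlas_def is_chart_def compatible_def smooth_transition_def comp_def
      intro!: smooth_on_cong[OF open_UNIV _ smooth_on_ident[OF open_UNIV]] inv_into_f_eq[symmetric])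

lemma std_chart: "(UNIV, \<lambda>x. x) \<in> (std_manifold :: ('e::real_normed_vector, 'e) manifold)"
  unfolding std_manifold_def using atlas_subset_generated[OF smooth_atlas_std] by blast

lemma premanifold_std: "finite_dim TYPE('e::real_normed_vector) \<Longrightarrow> premanifold (std_manifold :: ('e::real_normed_vector, 'e) manifold)"
  unfolding std_manifold_def by (rule premanifold_generated[OF _ smooth_atlas_std])

lemma points_std: "points std_manifold = UNIV"
  using std_chart by (auto simp: points_def)

section \<open>The manifold topology\<close>

lemma istopology_manifold:
  assumes "premanifold M"
  shows "istopology (\<lambda>U. U \<subseteq> points M \<and> (\<forall>c\<in>M. open (snd c ` (U \<inter> fst c))))"
  unfolding istopology_def
proof (intro conjI allI impI ballI)
  fix S T c assume "S \<subseteq> points M \<and> (\<forall>c\<in>M. open (snd c ` (S \<inter> fst c)))"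
    "T \<subseteq> points M \<and> (\<forall>c\<in>M. open (snd c ` (T \<inter> fst c)))" and c: "c \<in> M"
  then have "open (snd c ` (S \<inter> fst c) \<inter> snd c ` (T \<inter> fst c))" by auto
  also have "snd c ` (S \<inter> fst c) \<inter> snd c ` (T \<inter> fst c) = snd c ` (S \<inter> fst c \<inter> (T \<inter> fst c))"
    using chart_image_Int[OF premanifold_chart[OF assms c]] by simp
  also have "S \<inter> fst c \<inter> (T \<inter> fst c) = S \<inter> T \<inter> fst c" by auto
  finally show "open (snd c ` (S \<inter> T \<inter> fst c))" .
next
  fix K c assume K: "\<forall>S\<in>K. S \<subseteq> points M \<and> (\<forall>c\<in>M. open (snd c ` (S \<inter> fst c)))" and c: "c \<in> M"
  have "open (\<Union>S\<in>K. snd c ` (S \<inter> fst c))" using K c by auto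
  also have "(\<Union>S\<in>K. snd c ` (S \<inter> fst c)) = snd c ` (\<Union>K \<inter> fst c)" by auto
  finally show "open (snd c ` (\<Union>K \<inter> fst c))" .
qed auto

lemma openin_mtopology:
  "premanifold M \<Longrightarrow> openin (mtopology M) U \<longleftrightarrow> U \<subseteq> points M \<and> (\<forall>c\<in>M. open (snd c ` (U \<inter> fst c)))"
  unfolding mtopology_def by (subst topology_inverse'[OF istopology_manifold]) simp_all

lemma openin_chart_image:
  "premanifold M \<Longrightarrow> openin (mtopology M) U \<Longrightarrow> c \<in> M \<Longrightarrow> open (snd c ` (U \<inter> fst c))"
  by (simp add: openin_mtopology)

lemma openin_points: "premanifold M \<Longrightarrow> openin (mtopology M) (points M)"
  unfolding openin_mtopology
proof (intro conjI ballI)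
  fix c assume M: "premanifold M" and c: "c \<in> M"
  have "points M \<inter> fst c = fst c" using chart_points[OF c] by blast
  then show "open (snd c ` (points M \<inter> fst c))" using premanifold_chart_open[OF M c] by simp
qed simp

lemma topspace_mtopology: "premanifold M \<Longrightarrow> topspace (mtopology M) = points M"
  by (metis openin_mtopology openin_points openin_topspace openin_subset subset_antisym)

lemma openin_chart_subset:
  assumes M: "premanifold M" and c: "c \<in> M" and W: "W \<subseteq> fst c" "open (snd c ` W)"
  shows "openin (mtopology M) W"
  unfolding openin_mtopology[OF M]
proof (intro conjI ballI)
  show "W \<subseteq> points M" using chart_points[OF c] W by blast
  fix d assume d: "d \<in> M"
  have "open (snd c ` (W \<inter> fst d))"
    using compatible_open[OF compatible_restrict[OF premanifold_compatible[OF M c d] premanifold_chart[OF M c]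
        premanifold_chart[OF M d] W]] by simp
  then show "open (snd d ` (W \<inter> fst d))"
    using W by (intro compatible_image_open[OF premanifold_compatible[OF M c d] premanifold_chart[OF M c]
        premanifold_chart[OF M d]]) auto
qed

lemma chart_openin: "premanifold M \<Longrightarrow> c \<in> M \<Longrightarrow> openin (mtopology M) (fst c)"
  by (rule openin_chart_subset[OF _ _ order_refl premanifold_chart_open])

lemma chart_at_in_open:
  assumes M: "premanifold M" and U: "openin (mtopology M) U" and x: "x \<in> U"
  shows "\<exists>c\<in>M. x \<in> fst c \<and> fst c \<subseteq> U"
proof -
  from U x have "x \<in> points M" using openin_mtopology[OF M] by blast
  then obtain c where c: "c \<in> M" "x \<in> fst c" by (auto simp: points_def)
  have "(U \<inter> fst c, snd c) \<in> M"
    using openin_chart_image[OF M U c(1)] by (intro premanifold_restrict[OF M c(1)]) auto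
  then show ?thesis using c x by (intro bexI[of _ "(U \<inter> fst c, snd c)"]) auto
qed

lemma points_open:
  "premanifold M \<Longrightarrow> openin (mtopology M) U \<Longrightarrow> points (open_submanifold M U) = U"
  using chart_at_in_open[of M U] by (auto simp: points_def open_submanifold_def)

section \<open>Smooth maps and their behaviour under restriction and composition\<close>

lemma smooth_map_points: "smooth_map M N f \<Longrightarrow> x \<in> points M \<Longrightarrow> f x \<in> points N"
  by (auto simp: smooth_map_def)

text \<open>\<open>smooth_map\<close> provides one suitable pair of charts per point. In any other
  pair the coordinate expression is the given one composed with a transition map on either side,
  near each point of the set where it is defined.\<close>

lemma smooth_map_in_charts:
  assumes M: "premanifold M" and N: "premanifold N" and f: "smooth_map M N f" and c: "c \<in> M" and d: "d \<in> N"
  defines "S \<equiv> snd c ` {w \<in> fst c. f w \<in> fst d}"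
  shows "open S" "smooth_on S (\<lambda>u. snd d (f (chart_inv c u)))"
proof -
  have ch: "is_chart c" "is_chart d" using premanifold_chart[OF M] premanifold_chart[OF N] c d by blast+
  have loc: "\<exists>T. open T \<and> u \<in> T \<and> T \<subseteq> S \<and> smooth_on T (\<lambda>u. snd d (f (chart_inv c u)))" if u: "u \<in> S" for u
  proof -
    from u obtain x where x: "u = snd c x" "x \<in> fst c" "f x \<in> fst d" by (auto simp: S_def)
    then have "x \<in> points M" using chart_points[OF c] by blast
    with f obtain c0 d0 where c0: "c0 \<in> M" "d0 \<in> N" "x \<in> fst c0" "f ` fst c0 \<subseteq> fst d0"
      and sm: "smooth_on (snd c0 ` fst c0) (\<lambda>u. snd d0 (f (chart_inv c0 u)))"
      unfolding smooth_map_def comp_def by blast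
    have ch0: "is_chart c0" "is_chart d0" using premanifold_chart[OF M] premanifold_chart[OF N] c0 by blast+
    have cm: "compatible c c0" "compatible c0 c" "compatible d0 d"
      using premanifold_compatible[OF M] premanifold_compatible[OF N] c d c0 by blast+
    let ?F = "\<lambda>u. snd d0 (f (chart_inv c0 u))"
    let ?W = "{w \<in> fst c0 \<inter> fst c. f w \<in> fst d}"
    \<comment> \<open>Openness of the neighbourhood: it is a preimage under the coordinate
      expression \<open>?F\<close>, which is continuous.\<close>
    have "snd c0 ` ?W = snd c0 ` (fst c0 \<inter> fst c) \<inter> ?F -` (snd d0 ` (fst d0 \<inter> fst d))"
      using c0(4) inj_onD[of "snd d0" "fst d0"] ch0(2)
      by (fastforce simp: chart_inv_chart[OF ch0(1)] image_subset_iff is_chart_def)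
    also have "open \<dots>"
      by (rule continuous_open_preimage[OF continuous_on_subset[OF smooth_on_continuous[OF sm]]])
        (use compatible_open[OF cm(2)] compatible_open[OF cm(3)] in auto)
    finally have o: "open (snd c ` ?W)" by (rule compatible_image_open[OF cm(2) ch0(1) ch(1), rotated 2]) auto
    have F: "smooth_on (snd c ` ?W) (\<lambda>u. ?F (snd c0 (chart_inv c u)))"
      by (rule smooth_on_compose[OF premanifold_finite_dim[OF M] o _ smooth_on_subset[OF compatible_smooth[OF cm(1)]] sm])
        (auto simp: chart_inv_chart[OF ch(1)])
    have "smooth_on (snd c ` ?W) (\<lambda>u. snd d (chart_inv d0 (?F (snd c0 (chart_inv c u)))))"
      by (rule smooth_on_compose[OF premanifold_finite_dim[OF N] o _ F compatible_smooth[OF cm(3)]])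
        (use c0(4) in \<open>auto simp: chart_inv_chart[OF ch(1)] chart_inv_chart[OF ch0(1)]\<close>)
    then have "smooth_on (snd c ` ?W) (\<lambda>u. snd d (f (chart_inv c u)))"
      by (rule smooth_on_cong[OF o, rotated])
        (use c0(4) in \<open>auto simp: chart_inv_chart[OF ch(1)] chart_inv_chart[OF ch0(1)] chart_inv_chart[OF ch0(2)] image_subset_iff\<close>)
    then show ?thesis using o x c0(3) by (intro exI[of _ "snd c ` ?W"]) (auto simp: S_def)
  qed
  show "open S" by (subst open_subopen) (use loc in blast)
  show "smooth_on S (\<lambda>u. snd d (f (chart_inv c u)))" by (rule smooth_on_local) (use loc in blast)
qed

text \<open>In contrast to the local clause of \<open>smooth_map\<close>, the neighbourhood
  \<open>W\<close> may be smaller than the chart domain. The shrinking of charts is thus done once,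
  in \<open>smooth_mapI\<close>.\<close>

definition smooth_at ::
  "('a, 'e::real_normed_vector) manifold \<Rightarrow> ('b, 'f::real_normed_vector) manifold \<Rightarrow> ('a \<Rightarrow> 'b) \<Rightarrow> 'a \<Rightarrow> bool"
  where "smooth_at M N f x \<longleftrightarrow> (\<exists>c\<in>M. \<exists>d\<in>N. \<exists>W. x \<in> W \<and> W \<subseteq> fst c \<and> open (snd c ` W) \<and>
    f ` W \<subseteq> fst d \<and> smooth_on (snd c ` W) (\<lambda>u. snd d (f (chart_inv c u))))"

lemma smooth_mapI:
  assumes M: "premanifold M" and loc: "\<And>x. x \<in> points M \<Longrightarrow> smooth_at M N f x"
  shows "smooth_map M N f"
  unfolding smooth_map_def
proof (intro conjI ballI subsetI)
  fix y assume "y \<in> f ` points M"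
  then obtain x where x: "x \<in> points M" "y = f x" by blast
  from loc[OF x(1)] obtain d W where "d \<in> N" "x \<in> W" "f ` W \<subseteq> fst d" unfolding smooth_at_def by blast
  then show "y \<in> points N" using chart_points[of d N y] x(2) by blast
next
  fix x assume "x \<in> points M"
  from loc[OF this] obtain c d W where *: "c \<in> M" "d \<in> N" "x \<in> W" "W \<subseteq> fst c" "open (snd c ` W)"
    "f ` W \<subseteq> fst d" "smooth_on (snd c ` W) (\<lambda>u. snd d (f (chart_inv c u)))" unfolding smooth_at_def by blast
  have ch: "is_chart c" "is_chart (W, snd c)" using premanifold_chart[OF M *(1)] is_chart_restrict[OF _ *(4,5)] by blast+
  have "smooth_on (snd c ` W) (snd d \<circ> f \<circ> inv_into W (snd c))"
    by (rule smooth_on_cong[OF *(5) _ *(7)])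
      (use *(4) chart_inv_chart[OF ch(1)] chart_inv_chart[OF ch(2)] in auto)
  then show "\<exists>c\<in>M. \<exists>d\<in>N. x \<in> fst c \<and> f ` fst c \<subseteq> fst d \<and> smooth_on (snd c ` fst c) (snd d \<circ> f \<circ> chart_inv c)"
    using * premanifold_restrict[OF M *(1,4,5)] by (intro bexI[of _ "(W, snd c)"] bexI[of _ d]) auto
qed

lemma smooth_map_compose:
  assumes M: "premanifold M" and N: "premanifold N" and Q: "premanifold Q"
    and f: "smooth_map M N f" and g: "smooth_map N Q g"
  shows "smooth_map M Q (\<lambda>x. g (f x))"
proof (rule smooth_mapI[OF M])
  fix x assume x: "x \<in> points M"
  then obtain c d e where c: "c \<in> M" "x \<in> fst c" and d: "d \<in> N" "f x \<in> fst d" and e: "e \<in> Q" "g (f x) \<in> fst e"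
    using points_chart smooth_map_points f g by metis
  note fc = smooth_map_in_charts[OF M N f c(1) d(1)]
  note gc = smooth_map_in_charts[OF N Q g d(1) e(1)]
  have ch: "is_chart c" "is_chart d" using premanifold_chart[OF M] premanifold_chart[OF N] c d by blast+
  let ?W = "{w \<in> fst c. f w \<in> fst d \<and> g (f w) \<in> fst e}"
  have "snd c ` ?W = snd c ` {w \<in> fst c. f w \<in> fst d} \<inter>
      (\<lambda>u. snd d (f (chart_inv c u))) -` (snd d ` {y \<in> fst d. g y \<in> fst e})"
    using inj_onD[of "snd d" "fst d"] ch(2)
    by (fastforce simp: chart_inv_chart[OF ch(1)] is_chart_def)
  also have "open \<dots>"
    by (rule continuous_open_preimage[OF smooth_on_continuous[OF fc(2)] fc(1) gc(1)])
  finally have o: "open (snd c ` ?W)" .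
  have "smooth_on (snd c ` ?W) (\<lambda>u. snd e (g (chart_inv d (snd d (f (chart_inv c u))))))"
    by (rule smooth_on_compose[OF premanifold_finite_dim[OF N] o _ smooth_on_subset[OF fc(2)] gc(2)])
      (auto simp: chart_inv_chart[OF ch(1)])
  then have "smooth_on (snd c ` ?W) (\<lambda>u. snd e (g (f (chart_inv c u))))"
    by (rule smooth_on_cong[OF o, rotated]) (auto simp: chart_inv_chart[OF ch(1)] chart_inv_chart[OF ch(2)])
  then show "smooth_at M Q (\<lambda>x. g (f x)) x"
      unfolding smooth_at_def
    using o c d e by (intro bexI[of _ c] bexI[of _ e] exI[of _ ?W]) auto
qed

lemma smooth_map_cong:
  assumes "premanifold M" "\<And>x. x \<in> points M \<Longrightarrow> f x = g x" "smooth_map M N f"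
  shows "smooth_map M N g"
  unfolding smooth_map_def
proof (intro conjI ballI)
  show "g ` points M \<subseteq> points N" using assms(2,3) smooth_map_points by fastforce
  fix x assume "x \<in> points M"
  then obtain c d where *: "c \<in> M" "d \<in> N" "x \<in> fst c" "f ` fst c \<subseteq> fst d"
    "smooth_on (snd c ` fst c) (snd d \<circ> f \<circ> chart_inv c)"
    using assms(3) unfolding smooth_map_def by blast
  have eq: "f y = g y" if "y \<in> fst c" for y using that *(1) assms(2) chart_points by metis
  have "smooth_on (snd c ` fst c) (snd d \<circ> g \<circ> chart_inv c)"
    by (rule smooth_on_cong[OF premanifold_chart_open[OF assms(1) *(1)] _ *(5)])
      (auto simp: chart_inv_chart[OF premanifold_chart[OF assms(1) *(1)]] eq)
  then show "\<exists>c\<in>M. \<exists>d\<in>N. x \<in> fst c \<and> g ` fst c \<subseteq> fst d \<and> smooth_on (snd c ` fst c) (snd d \<circ> g \<circ> chart_inv c)"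
    using * eq by (intro bexI[of _ c] bexI[of _ d]) (auto simp: image_subset_iff)
qed

lemma smooth_map_open_preimage:
  assumes M: "premanifold M" and N: "premanifold N" and f: "smooth_map M N f" and V: "openin (mtopology N) V"
  shows "openin (mtopology M) {x \<in> points M. f x \<in> V}"
  unfolding openin_mtopology[OF M]
proof (intro conjI ballI)
  fix c assume c: "c \<in> M"
  show "open (snd c ` ({x \<in> points M. f x \<in> V} \<inter> fst c))"
  proof (subst open_subopen, intro ballI)
    fix u assume "u \<in> snd c ` ({x \<in> points M. f x \<in> V} \<inter> fst c)"
    then obtain x where x: "u = snd c x" "x \<in> fst c" "f x \<in> V" by auto
    obtain d where d: "d \<in> N" "f x \<in> fst d" "fst d \<subseteq> V" using chart_at_in_open[OF N V x(3)] by blast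
    show "\<exists>T. open T \<and> u \<in> T \<and> T \<subseteq> snd c ` ({x \<in> points M. f x \<in> V} \<inter> fst c)"
      using smooth_map_in_charts(1)[OF M N f c d(1)] x d c chart_points[OF c]
      by (intro exI[of _ "snd c ` {w \<in> fst c. f w \<in> fst d}"]) auto
  qed
qed auto

lemma smooth_map_restrict:
  assumes M: "premanifold M" and N: "premanifold N" and f: "smooth_map M N f" and U: "openin (mtopology M) U"
  shows "smooth_map (open_submanifold M U) N f"
proof (rule smooth_mapI[OF premanifold_open[OF M]], unfold points_open[OF M U])
  have UM: "U \<subseteq> points M" using U openin_mtopology[OF M] by blast
  fix x assume x: "x \<in> U"
  then obtain c where c: "c \<in> M" "x \<in> fst c" "fst c \<subseteq> U" using chart_at_in_open[OF M U] by blast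
  obtain d where d: "d \<in> N" "f x \<in> fst d" using points_chart[OF smooth_map_points[OF f subsetD[OF UM x]]] by blast
  show "smooth_at (open_submanifold M U) N f x"
      unfolding smooth_at_def
    using smooth_map_in_charts[OF M N f c(1) d(1)] c d
    by (intro bexI[of _ c] bexI[of _ d] exI[of _ "{w \<in> fst c. f w \<in> fst d}"]) (auto simp: open_submanifold_def)
qed

lemma smooth_map_into_open:
  assumes M: "premanifold M" and N: "premanifold N" and f: "smooth_map M N f" and V: "openin (mtopology N) V"
    and fV: "\<And>x. x \<in> points M \<Longrightarrow> f x \<in> V"
  shows "smooth_map M (open_submanifold N V) f"
proof (rule smooth_mapI[OF M])
  fix x assume x: "x \<in> points M"
  obtain c where c: "c \<in> M" "x \<in> fst c" using x by (auto simp: points_def)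
  obtain d where d: "d \<in> N" "f x \<in> fst d" "fst d \<subseteq> V" using chart_at_in_open[OF N V fV[OF x]] by blast
  show "smooth_at M (open_submanifold N V) f x"
      unfolding smooth_at_def
    using smooth_map_in_charts[OF M N f c(1) d(1)] c d
    by (intro bexI[of _ c] bexI[of _ d] exI[of _ "{w \<in> fst c. f w \<in> fst d}"]) (auto simp: open_submanifold_def)
qed

lemma smooth_map_local:
  assumes M: "premanifold M"
    and loc: "\<And>x. x \<in> points M \<Longrightarrow> \<exists>U. openin (mtopology M) U \<and> x \<in> U \<and> smooth_map (open_submanifold M U) N f"
  shows "smooth_map M N f"
  unfolding smooth_map_def
proof (intro conjI ballI subsetI)
  fix y assume "y \<in> f ` points M"
  then show "y \<in> points N" using loc smooth_map_points points_open[OF M] by (metis imageE)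
next
  fix x assume "x \<in> points M"
  from loc[OF this] obtain U where U: "openin (mtopology M) U" "x \<in> U" "smooth_map (open_submanifold M U) N f" by blast
  then have "x \<in> points (open_submanifold M U)" using points_open[OF M] by blast
  with U(3) show "\<exists>c\<in>M. \<exists>d\<in>N. x \<in> fst c \<and> f ` fst c \<subseteq> fst d \<and> smooth_on (snd c ` fst c) (snd d \<circ> f \<circ> chart_inv c)"
    unfolding smooth_map_def open_submanifold_def by blast
qed

lemma smooth_map_ident:
  assumes M: "premanifold M" shows "smooth_map M M (\<lambda>x. x)"
proof (rule smooth_mapI[OF M])
  fix x assume "x \<in> points M"
  then obtain c where c: "c \<in> M" "x \<in> fst c" by (auto simp: points_def)
  have "smooth_on (snd c ` fst c) (\<lambda>u. snd c (chart_inv c u))"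
    by (rule smooth_on_cong[OF premanifold_chart_open[OF M c(1)] _ smooth_on_ident[OF premanifold_chart_open[OF M c(1)]]])
      (auto simp: chart_inv_chart[OF premanifold_chart[OF M c(1)]])
  then show "smooth_at M M (\<lambda>x. x) x"
      unfolding smooth_at_def
    using c premanifold_chart_open[OF M c(1)]
    by (intro bexI[of _ c] exI[of _ "fst c"]) auto
qed

lemma smooth_map_inclusion:
  "premanifold M \<Longrightarrow> openin (mtopology M) U \<Longrightarrow> smooth_map (open_submanifold M U) M (\<lambda>x. x)"
  by (rule smooth_map_restrict[OF _ _ smooth_map_ident])

lemma smooth_map_const:
  assumes M: "premanifold M" and y: "y \<in> points N" shows "smooth_map M N (\<lambda>_. y)"
proof (rule smooth_mapI[OF M])
  fix x assume "x \<in> points M"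
  then obtain c d where c: "c \<in> M" "x \<in> fst c" "d \<in> N" "y \<in> fst d" using points_chart y by metis
  then show "smooth_at M N (\<lambda>_. y) x"
      unfolding smooth_at_def
    using premanifold_chart_open[OF M c(1)] smooth_on_const
    by (intro bexI[of _ c] bexI[of _ d] exI[of _ "fst c"]) auto
qed

subsection \<open>Products\<close>

definition prod_chart :: "('a, 'e) chart \<Rightarrow> ('b, 'f) chart \<Rightarrow> ('a \<times> 'b, 'e \<times> 'f) chart"
  where "prod_chart c d = (fst c \<times> fst d, map_prod (snd c) (snd d))"

lemma fst_prod_chart [simp]: "fst (prod_chart c d) = fst c \<times> fst d"
  and snd_prod_chart [simp]: "snd (prod_chart c d) = map_prod (snd c) (snd d)"
  by (simp_all add: prod_chart_def)

lemma map_prod_image_Times: "map_prod f g ` (A \<times> B) = f ` A \<times> g ` B"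
  by auto

lemma is_chart_prod: "is_chart c \<Longrightarrow> is_chart d \<Longrightarrow> is_chart (prod_chart c d)"
  unfolding is_chart_def by (auto simp: map_prod_image_Times intro: map_prod_inj_on open_Times)

lemma chart_inv_prod:
  assumes "is_chart c" "is_chart d" "x \<in> fst c" "y \<in> fst d"
  shows "chart_inv (prod_chart c d) (snd c x, snd d y) = (x, y)"
  using chart_inv_chart[OF is_chart_prod[OF assms(1,2)], of "(x, y)"] assms(3,4) by simp

lemma prod_transition:
  assumes "compatible c c'" "compatible d d'" and ch: "is_chart c" "is_chart c'" "is_chart d" "is_chart d'"
    and fd: "finite_dim TYPE('e::real_normed_vector)" "finite_dim TYPE('f::real_normed_vector)"
  shows "smooth_transition (prod_chart (c :: ('a, 'e::real_normed_vector) chart) (d :: ('b, 'f::real_normed_vector) chart)) (prod_chart c' d')"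
proof -
  let ?A = "snd c ` (fst c \<inter> fst c')" and ?B = "snd d ` (fst d \<inter> fst d')"
  have o: "open ?A" "open ?B" using compatible_open[OF assms(1)] compatible_open[OF assms(2)] by auto
  then have oo: "open (?A \<times> ?B)" by (rule open_Times)
  have eq: "map_prod (snd c) (snd d) ` (fst c \<times> fst d \<inter> fst c' \<times> fst d') = ?A \<times> ?B" by auto
  have "smooth_on (?A \<times> ?B) (\<lambda>u. (snd c' (chart_inv c (fst u)), snd d' (chart_inv d (snd u))))"
    by (intro smooth_on_Pair oo smooth_on_compose[OF fd(1) oo _ smooth_on_fst[OF oo] compatible_smooth[OF assms(1)]]
        smooth_on_compose[OF fd(2) oo _ smooth_on_snd[OF oo] compatible_smooth[OF assms(2)]]) auto
  then have "smooth_on (?A \<times> ?B) (map_prod (snd c') (snd d') \<circ> chart_inv (prod_chart c d))"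
    by (rule smooth_on_cong[OF oo, rotated])
      (auto simp: chart_inv_prod[OF ch(1,3)] chart_inv_chart[OF ch(1)] chart_inv_chart[OF ch(3)]
        simp del: fst_prod_chart snd_prod_chart)
  then show ?thesis by (simp add: smooth_transition_def eq oo)
qed

lemma prod_manifold_eq: "prod_manifold M N = generated {prod_chart c d | c d. c \<in> M \<and> d \<in> N}"
  by (simp add: prod_manifold_def prod_chart_def)

lemma smooth_atlas_prod:
  assumes "premanifold M" "premanifold N"
  shows "smooth_atlas {prod_chart c d | c d. c \<in> M \<and> d \<in> N}"
proof -
  have "is_chart (prod_chart c d)" if "c \<in> M" "d \<in> N" for c d
    using that premanifold_chart[OF assms(1)] premanifold_chart[OF assms(2)] by (intro is_chart_prod)
  moreover have "smooth_transition (prod_chart c d) (prod_chart c' d')"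
    if "c \<in> M" "d \<in> N" "c' \<in> M" "d' \<in> N" for c d c' d'
    by (intro prod_transition premanifold_compatible[OF assms(1)] premanifold_compatible[OF assms(2)]
        premanifold_chart[OF assms(1)] premanifold_chart[OF assms(2)]
        premanifold_finite_dim[OF assms(1)] premanifold_finite_dim[OF assms(2)] that)
  ultimately show ?thesis unfolding smooth_atlas_def compatible_def by blast
qed

lemma premanifold_prod: "premanifold M \<Longrightarrow> premanifold N \<Longrightarrow> premanifold (prod_manifold M N)"
  unfolding prod_manifold_eq
  by (intro premanifold_generated finite_dim_prod smooth_atlas_prod premanifold_finite_dim)

lemma prod_chart_in: "premanifold M \<Longrightarrow> premanifold N \<Longrightarrow> c \<in> M \<Longrightarrow> d \<in> N \<Longrightarrow> prod_chart c d \<in> prod_manifold M N"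
  unfolding prod_manifold_eq using atlas_subset_generated[OF smooth_atlas_prod] by blast

lemma points_prod:
  assumes "premanifold M" "premanifold N"
  shows "points (prod_manifold M N) = points M \<times> points N"
proof -
  have "points {prod_chart c d | c d. c \<in> M \<and> d \<in> N} = (\<Union>c\<in>M. \<Union>d\<in>N. fst c \<times> fst d)"
  proof (intro subset_antisym subsetI)
    fix x assume "x \<in> points {prod_chart c d | c d. c \<in> M \<and> d \<in> N}"
    then obtain e where "e \<in> {prod_chart c d | c d. c \<in> M \<and> d \<in> N}" "x \<in> fst e" unfolding points_def by blast
    then show "x \<in> (\<Union>c\<in>M. \<Union>d\<in>N. fst c \<times> fst d)" using fst_prod_chart by blast
  next
    fix x assume "x \<in> (\<Union>c\<in>M. \<Union>d\<in>N. fst c \<times> fst d)"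
    then obtain c d where "c \<in> M" "d \<in> N" "x \<in> fst (prod_chart c d)" unfolding fst_prod_chart by blast
    then show "x \<in> points {prod_chart c d | c d. c \<in> M \<and> d \<in> N}" unfolding points_def by blast
  qed
  also have "\<dots> = points M \<times> points N" unfolding points_def by blast
  finally show ?thesis
    unfolding prod_manifold_eq points_generated[OF smooth_atlas_prod[OF assms]] .
qed

lemma
  assumes M: "premanifold M" and N: "premanifold N"
  shows smooth_map_fst: "smooth_map (prod_manifold M N) M fst"
    and smooth_map_snd: "smooth_map (prod_manifold M N) N snd"
proof -
  have "smooth_at (prod_manifold M N) M fst x \<and> smooth_at (prod_manifold M N) N snd x"
    if "x \<in> points (prod_manifold M N)" for x
  proof -
    from that obtain c d where c: "c \<in> M" "fst x \<in> fst c" and d: "d \<in> N" "snd x \<in> fst d"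
      unfolding points_prod[OF M N] using points_chart by (metis mem_Times_iff)
    note ch = premanifold_chart[OF M c(1)] premanifold_chart[OF N d(1)]
    let ?C = "prod_chart c d"
    have o: "open (snd ?C ` fst ?C)" using is_chart_prod[OF ch] is_chart_def by blast
    have "smooth_on (snd ?C ` fst ?C) (\<lambda>u. snd c (fst (chart_inv ?C u)))"
      by (rule smooth_on_cong[OF o _ smooth_on_fst[OF o]]) (auto simp: chart_inv_prod[OF ch, simplified])
    moreover have "smooth_on (snd ?C ` fst ?C) (\<lambda>u. snd d (snd (chart_inv ?C u)))"
      by (rule smooth_on_cong[OF o _ smooth_on_snd[OF o]]) (auto simp: chart_inv_prod[OF ch, simplified])
    moreover have "x \<in> fst ?C" "fst ` fst ?C \<subseteq> fst c" "snd ` fst ?C \<subseteq> fst d"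
      using c d by (auto simp: mem_Times_iff)
    ultimately show ?thesis
      unfolding smooth_at_def using o c(1) d(1) prod_chart_in[OF M N c(1) d(1)] by blast
  qed
  then show "smooth_map (prod_manifold M N) M fst" "smooth_map (prod_manifold M N) N snd"
    using smooth_mapI[OF premanifold_prod[OF M N]] by blast+
qed

lemma smooth_map_Pair:
  assumes L: "premanifold L" and M: "premanifold M" and N: "premanifold N"
    and f: "smooth_map L M f" and g: "smooth_map L N g"
  shows "smooth_map L (prod_manifold M N) (\<lambda>x. (f x, g x))"
proof (rule smooth_mapI[OF L])
  fix x assume x: "x \<in> points L"
  then obtain b c d where b: "b \<in> L" "x \<in> fst b" and c: "c \<in> M" "f x \<in> fst c" and d: "d \<in> N" "g x \<in> fst d"
    using points_chart smooth_map_points f g by metis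
  note fc = smooth_map_in_charts[OF L M f b(1) c(1)]
  note gc = smooth_map_in_charts[OF L N g b(1) d(1)]
  let ?V = "{w \<in> fst b. f w \<in> fst c}" and ?W = "{w \<in> fst b. g w \<in> fst d}"
  have o: "open (snd b ` (?V \<inter> ?W))"
    using chart_image_Int[OF premanifold_chart[OF L b(1)], of ?V ?W] fc(1) gc(1) by auto
  have "smooth_on (snd b ` (?V \<inter> ?W)) (\<lambda>u. (snd c (f (chart_inv b u)), snd d (g (chart_inv b u))))"
    by (intro smooth_on_Pair o smooth_on_subset[OF fc(2)] smooth_on_subset[OF gc(2)]) auto
  then show "smooth_at L (prod_manifold M N) (\<lambda>x. (f x, g x)) x"
      unfolding smooth_at_def
    using o b c d prod_chart_in[OF M N c(1) d(1)]
    by (intro bexI[of _ b] bexI[of _ "prod_chart c d"] exI[of _ "?V \<inter> ?W"]) auto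
qed

section \<open>Velocities and tangent maps\<close>

lemma eventually_nhds_curve:
  assumes "(y has_vector_derivative w) (at t)" "open T" "y t \<in> T"
  shows "\<forall>\<^sub>F s in nhds t. y s \<in> T"
proof -
  have "(y \<longlongrightarrow> y t) (nhds t)"
    using has_vector_derivative_continuous[OF assms(1)]
    by (simp add: continuous_within tendsto_at_iff_tendsto_nhds)
  then show ?thesis using assms(2,3) by (rule topological_tendstoD)
qed

lemma vector_derivative_cong:
  assumes "(y has_vector_derivative w) (at t)" "\<forall>\<^sub>F s in nhds t. y s = z s"
  shows "(z has_vector_derivative w) (at t)"
proof -
  obtain S where "open S" "t \<in> S" "\<And>s. s \<in> S \<Longrightarrow> y s = z s"
    using assms(2) by (auto simp: eventually_nhds)
  then show ?thesis by (rule has_vector_derivative_transform_within_open[OF assms(1)])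
qed

lemma vector_derivative_compose_smooth:
  assumes "(y has_vector_derivative w) (at t)" "y t \<in> T" "smooth_on T F"
  shows "((\<lambda>s. F (y s)) has_vector_derivative frechet_derivative F (at (y t)) w) (at t)"
proof -
  have "(F has_derivative frechet_derivative F (at (y t))) (at (y t) within range y)"
    using smooth_on_has_derivative[OF assms(3,2)] by (rule has_derivative_at_withinI)
  then show ?thesis
    using vector_derivative_diff_chain_within[OF assms(1)] by (simp add: comp_def)
qed

lemma smooth_on_frechet_linear: "smooth_on T F \<Longrightarrow> x \<in> T \<Longrightarrow> linear (frechet_derivative F (at x))"
  using smooth_on_has_derivative has_derivative_linear by blast

text \<open>\<open>has_velocity\<close> speaks of all charts at once, yet one chart suffices: the
  chain rule for transition maps gives the other coordinates, and these are the entries of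
  \<open>tangent_vector\<close>.\<close>

lemma has_velocityI:
  assumes M: "premanifold M" and c: "c \<in> M" and x: "\<gamma> t \<in> fst c"
    and ev: "\<forall>\<^sub>F s in nhds t. \<gamma> s \<in> fst c" and der: "((\<lambda>s. snd c (\<gamma> s)) has_vector_derivative w) (at t)"
  shows "has_velocity M \<gamma> t (tangent_vector M (\<gamma> t) c w)"
  unfolding has_velocity_def
proof (intro conjI allI)
  show "\<gamma> t \<in> points M" using chart_points[OF c x] .
  fix d
  show "if d \<in> M \<and> \<gamma> t \<in> fst d
    then (\<forall>\<^sub>F s in nhds t. \<gamma> s \<in> fst d) \<and> (snd d \<circ> \<gamma> has_vector_derivative tangent_vector M (\<gamma> t) c w d) (at t)
    else tangent_vector M (\<gamma> t) c w d = 0"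
  proof (cases "d \<in> M \<and> \<gamma> t \<in> fst d")
    case True
    then have d: "d \<in> M" "\<gamma> t \<in> fst d" by auto
    note ch = premanifold_chart[OF M c] premanifold_chart[OF M d(1)]
    note cm = premanifold_compatible[OF M c d(1)]
    let ?W = "fst c \<inter> fst d"
    have "\<forall>\<^sub>F s in nhds t. snd c (\<gamma> s) \<in> snd c ` ?W"
      by (rule eventually_nhds_curve[OF der compatible_open[OF cm]]) (use x d in auto)
    with ev have evd: "\<forall>\<^sub>F s in nhds t. \<gamma> s \<in> ?W"
      by eventually_elim (use chart_mem_iff[OF ch(1), of _ ?W] in blast)
    have "((\<lambda>s. snd d (chart_inv c (snd c (\<gamma> s)))) has_vector_derivative
        frechet_derivative (\<lambda>u. snd d (chart_inv c u)) (at (snd c (\<gamma> t))) w) (at t)"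
      by (rule vector_derivative_compose_smooth[OF der _ compatible_smooth[OF cm]]) (use x d in auto)
    then have "((\<lambda>s. snd d (\<gamma> s)) has_vector_derivative
        frechet_derivative (\<lambda>u. snd d (chart_inv c u)) (at (snd c (\<gamma> t))) w) (at t)"
      by (rule vector_derivative_cong)
        (use evd in \<open>eventually_elim, simp add: chart_inv_chart[OF ch(1)]\<close>)
    moreover have "\<forall>\<^sub>F s in nhds t. \<gamma> s \<in> fst d" using evd by eventually_elim simp
    ultimately show ?thesis using d by (simp add: tangent_vector_def comp_def)
  qed (auto simp: tangent_vector_def)
qed

lemma has_velocity_points: "has_velocity M \<gamma> t v \<Longrightarrow> \<gamma> t \<in> points M"
  by (simp add: has_velocity_def)

lemma has_velocity_chart:
  assumes "has_velocity M \<gamma> t v" "c \<in> M" "\<gamma> t \<in> fst c"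
  shows "\<forall>\<^sub>F s in nhds t. \<gamma> s \<in> fst c" "((\<lambda>s. snd c (\<gamma> s)) has_vector_derivative v c) (at t)"
  using assms unfolding has_velocity_def comp_def by meson+

text \<open>Charts around the point determine the entries by uniqueness of derivatives, and all
  remaining entries are 0 by convention. This is the tool by which identities between tangent
  vectors are proved.\<close>

lemma has_velocity_unique:
  assumes "has_velocity M \<gamma> t v" "has_velocity M \<gamma> t w"
  shows "v = w"
proof
  fix d
  show "v d = w d"
  proof (cases "d \<in> M \<and> \<gamma> t \<in> fst d")
    case True
    then show ?thesis using has_velocity_chart(2)[OF assms(1)] has_velocity_chart(2)[OF assms(2)]
      by (meson vector_derivative_unique_at)
  next
    case False
    then show ?thesis using assms unfolding has_velocity_def by metis
  qed
qed

lemma has_velocity_tangent_vector: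
  assumes "premanifold M" "has_velocity M \<gamma> t v" "c \<in> M" "\<gamma> t \<in> fst c"
  shows "v = tangent_vector M (\<gamma> t) c (v c)"
  by (rule has_velocity_unique[OF assms(2) has_velocityI[OF assms(1,3,4) has_velocity_chart[OF assms(2-4)]]])

lemma has_velocity_tangent_space:
  assumes "premanifold M" "has_velocity M \<gamma> t v"
  shows "v \<in> tangent_space M (\<gamma> t)"
proof -
  obtain c where c: "c \<in> M" "\<gamma> t \<in> fst c" using points_chart[OF has_velocity_points[OF assms(2)]] by blast
  then show ?thesis unfolding tangent_space_def using has_velocity_tangent_vector[OF assms c] by blast
qed

lemma has_velocity_cong:
  assumes "has_velocity M \<gamma> t v" "\<forall>\<^sub>F s in nhds t. \<gamma> s = \<gamma>' s"
  shows "has_velocity M \<gamma>' t v"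
  unfolding has_velocity_def
proof (intro conjI allI)
  have eq: "\<gamma> t = \<gamma>' t" using assms(2) by (rule eventually_nhds_x_imp_x)
  then show "\<gamma>' t \<in> points M" using has_velocity_points[OF assms(1)] by simp
  fix d
  show "if d \<in> M \<and> \<gamma>' t \<in> fst d then (\<forall>\<^sub>F s in nhds t. \<gamma>' s \<in> fst d) \<and> (snd d \<circ> \<gamma>' has_vector_derivative v d) (at t)
    else v d = 0"
  proof (cases "d \<in> M \<and> \<gamma>' t \<in> fst d")
    case True
    then have d: "d \<in> M" "\<gamma> t \<in> fst d" using eq by auto
    have "\<forall>\<^sub>F s in nhds t. \<gamma>' s \<in> fst d"
      using has_velocity_chart(1)[OF assms(1) d] assms(2) by eventually_elim simp
    moreover have "((\<lambda>s. snd d (\<gamma>' s)) has_vector_derivative v d) (at t)"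
      by (rule vector_derivative_cong[OF has_velocity_chart(2)[OF assms(1) d]])
        (use assms(2) in \<open>eventually_elim, simp\<close>)
    ultimately show ?thesis using True by (simp add: comp_def)
  next
    case False
    then show ?thesis using assms(1) eq unfolding has_velocity_def by metis
  qed
qed

text \<open>\<open>tangent_map\<close> computes in a chart picked by \<open>SOME\<close>. The
  formula is stated as an equality of functions of \<open>v\<close>, so that one chart serves for
  several vectors at the same point.\<close>

lemma tangent_map_chart:
  assumes "x \<in> points M"
  obtains c where "c \<in> M" "x \<in> fst c"
    "tangent_map M N f x = (\<lambda>v d. if d \<in> N \<and> f x \<in> fst d
      then frechet_derivative (\<lambda>u. snd d (f (chart_inv c u))) (at (snd c x)) (v c) else 0)"
proof -
  define c where "c = (SOME c. c \<in> M \<and> x \<in> fst c)"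
  have "\<exists>c. c \<in> M \<and> x \<in> fst c" using points_chart[OF assms] by blast
  then have c: "c \<in> M" "x \<in> fst c" unfolding c_def by (metis (mono_tags, lifting) someI_ex)+
  show thesis by (rule that[OF c]) (unfold tangent_map_def[abs_def] Let_def c_def comp_def, rule refl)
qed

text \<open>The chain rule in the chart picked by \<open>tangent_map\<close>. Applied to a
  composition of maps and to its factors, it replaces a functoriality law for tangent maps.\<close>

lemma has_velocity_push:
  assumes M: "premanifold M" and N: "premanifold N" and f: "smooth_map M N f" and v: "has_velocity M \<gamma> t v"
  shows "has_velocity N (\<lambda>s. f (\<gamma> s)) t (tangent_map M N f (\<gamma> t) v)"
  unfolding has_velocity_def
proof (intro conjI allI)
  note pt = has_velocity_points[OF v]
  show "f (\<gamma> t) \<in> points N" by (rule smooth_map_points[OF f pt])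
  obtain c where c: "c \<in> M" "\<gamma> t \<in> fst c"
    and tm: "tangent_map M N f (\<gamma> t) = (\<lambda>v d. if d \<in> N \<and> f (\<gamma> t) \<in> fst d
      then frechet_derivative (\<lambda>u. snd d (f (chart_inv c u))) (at (snd c (\<gamma> t))) (v c) else 0)"
    by (rule tangent_map_chart[OF pt, of N f])
  fix d
  show "if d \<in> N \<and> f (\<gamma> t) \<in> fst d
    then (\<forall>\<^sub>F s in nhds t. f (\<gamma> s) \<in> fst d) \<and>
      (snd d \<circ> (\<lambda>s. f (\<gamma> s)) has_vector_derivative tangent_map M N f (\<gamma> t) v d) (at t)
    else tangent_map M N f (\<gamma> t) v d = 0"
  proof (cases "d \<in> N \<and> f (\<gamma> t) \<in> fst d")
    case True
    then have d: "d \<in> N" "f (\<gamma> t) \<in> fst d" by auto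
    note ch = premanifold_chart[OF M c(1)]
    note fc = smooth_map_in_charts[OF M N f c(1) d(1)]
    note vc = has_velocity_chart[OF v c]
    let ?W = "{w \<in> fst c. f w \<in> fst d}"
    have mem: "snd c (\<gamma> t) \<in> snd c ` ?W" using c d by auto
    have "\<forall>\<^sub>F s in nhds t. snd c (\<gamma> s) \<in> snd c ` ?W"
      by (rule eventually_nhds_curve[OF vc(2) fc(1) mem])
    with vc(1) have evd: "\<forall>\<^sub>F s in nhds t. \<gamma> s \<in> ?W"
      by eventually_elim (use chart_mem_iff[OF ch, of _ ?W] in blast)
    have "((\<lambda>s. snd d (f (\<gamma> s))) has_vector_derivative
        frechet_derivative (\<lambda>u. snd d (f (chart_inv c u))) (at (snd c (\<gamma> t))) (v c)) (at t)"
      by (rule vector_derivative_cong[OF vector_derivative_compose_smooth[OF vc(2) mem fc(2)]])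
        (use evd in \<open>eventually_elim, simp add: chart_inv_chart[OF ch]\<close>)
    moreover have "\<forall>\<^sub>F s in nhds t. f (\<gamma> s) \<in> fst d" using evd by eventually_elim simp
    ultimately show ?thesis using d by (simp add: tm comp_def)
  qed (auto simp: tm)
qed

text \<open>Only the entry of a family in one chart enters \<open>tangent_map\<close>, and it enters
  linearly; hence \<open>v\<close> and \<open>w\<close> may be arbitrary families.\<close>

lemma tangent_map_diff:
  assumes M: "premanifold M" and N: "premanifold N" and f: "smooth_map M N f" and x: "x \<in> points M"
  shows "tangent_map M N f x (\<lambda>c. v c - w c) = (\<lambda>d. tangent_map M N f x v d - tangent_map M N f x w d)"
proof
  fix d
  obtain c where c: "c \<in> M" "x \<in> fst c"
    and tm: "tangent_map M N f x = (\<lambda>v d. if d \<in> N \<and> f x \<in> fst d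
      then frechet_derivative (\<lambda>u. snd d (f (chart_inv c u))) (at (snd c x)) (v c) else 0)"
    by (rule tangent_map_chart[OF x, of N f])
  show "tangent_map M N f x (\<lambda>c. v c - w c) d = tangent_map M N f x v d - tangent_map M N f x w d"
  proof (cases "d \<in> N \<and> f x \<in> fst d")
    case True
    then have "linear (frechet_derivative (\<lambda>u. snd d (f (chart_inv c u))) (at (snd c x)))"
      using smooth_on_frechet_linear[OF smooth_map_in_charts(2)[OF M N f c(1)]] c by blast
    then show ?thesis using True by (simp add: tm linear_diff)
  qed (auto simp: tm)
qed

lemma tangent_vector_diff:
  assumes M: "premanifold M" and c: "c \<in> M" "x \<in> fst c"
  shows "tangent_vector M x c (v - w) = (\<lambda>d. tangent_vector M x c v d - tangent_vector M x c w d)"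
proof
  fix d
  show "tangent_vector M x c (v - w) d = tangent_vector M x c v d - tangent_vector M x c w d"
  proof (cases "d \<in> M \<and> x \<in> fst d")
    case True
    then have "linear (frechet_derivative (\<lambda>u. snd d (chart_inv c u)) (at (snd c x)))"
      using smooth_on_frechet_linear[OF compatible_smooth[OF premanifold_compatible[OF M c(1)]]] c by blast
    then show ?thesis using True by (simp add: tangent_vector_def linear_diff comp_def)
  qed (auto simp: tangent_vector_def)
qed

text \<open>The coordinates in one chart determine a tangent vector linearly, so that a curve
  realises a difference of velocities as soon as it does so in the chart \<open>c\<close>.\<close>

lemma has_velocity_difference:
  assumes M: "premanifold M" and v: "has_velocity M \<alpha> t v" and w: "has_velocity M \<beta> t w"
    and eq: "\<alpha> t = \<gamma> t" "\<beta> t = \<gamma> t" and c: "c \<in> M" "\<gamma> t \<in> fst c"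
    and ev: "\<forall>\<^sub>F s in nhds t. \<gamma> s \<in> fst c"
    and der: "((\<lambda>s. snd c (\<gamma> s)) has_vector_derivative v c - w c) (at t)"
  shows "has_velocity M \<gamma> t (\<lambda>d. v d - w d)"
proof -
  have "v = tangent_vector M (\<gamma> t) c (v c)"
    using has_velocity_tangent_vector[OF M v c(1)] c(2) unfolding eq by blast
  moreover have "w = tangent_vector M (\<gamma> t) c (w c)"
    using has_velocity_tangent_vector[OF M w c(1)] c(2) unfolding eq by blast
  ultimately have "tangent_vector M (\<gamma> t) c (v c - w c) = (\<lambda>d. v d - w d)"
    using tangent_vector_diff[OF M c, of "v c" "w c"] by metis
  then show ?thesis using has_velocityI[OF M c ev der] by simp
qed

lemma finite_dim_real: "finite_dim TYPE(real)"
proof -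
  have "x \<in> span {1}" for x :: real
  proof -
    have "x *\<^sub>R 1 \<in> span {1 :: real}" by (intro span_scale span_base) simp
    then show ?thesis by (simp only: real_scaleR_def mult_1_right)
  qed
  then have "span {1 :: real} = UNIV" by auto
  then show ?thesis unfolding finite_dim_def by (intro exI[of _ "{1}"]) simp
qed

text \<open>The curve is a straight line in coordinates, restricted to times at which it stays in
  the image of the chart. It supplies smooth curves with a prescribed velocity, as
  \<open>darboux_lie\<close> demands.\<close>

lemma line_in_chart:
  assumes M: "premanifold M" and c: "c \<in> M" and x: "x \<in> fst c"
  obtains I \<gamma> where "0 \<in> I" "smooth_curve M I \<gamma>" "\<gamma> 0 = x" "has_velocity M \<gamma> 0 (tangent_vector M x c w)"
    "\<forall>\<^sub>F s in nhds 0. \<gamma> s \<in> fst c" "((\<lambda>s. snd c (\<gamma> s)) has_vector_derivative w) (at 0)"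
proof -
  note ch = premanifold_chart[OF M c]
  note op = premanifold_chart_open[OF M c]
  define y where "y t = snd c x + t *\<^sub>R w" for t :: real
  define \<gamma> where "\<gamma> t = chart_inv c (y t)" for t
  have cont: "continuous_on UNIV y" unfolding y_def by (intro continuous_intros)
  have "open (y -` (snd c ` fst c))" by (rule open_vimage[OF op cont])
  moreover have "0 \<in> y -` (snd c ` fst c)" using x by (simp add: y_def)
  ultimately obtain e where e: "e > 0" "ball 0 e \<subseteq> y -` (snd c ` fst c)"
    using open_contains_ball by blast
  define I where "I = {-e<..<e}"
  have I: "open I" "is_interval I" "0 \<in> I" using e(1) by (auto simp: I_def is_interval_oo)
  have yI: "y t \<in> snd c ` fst c" if "t \<in> I" for t
  proof -
    have "t \<in> ball 0 e" using that by (auto simp: I_def dist_real_def)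
    then show ?thesis using e(2) by blast
  qed
  have \<gamma>I: "\<gamma> t \<in> fst c" "snd c (\<gamma> t) = y t" if "t \<in> I" for t
    using yI[OF that] by (auto simp: \<gamma>_def chart_inv_chart[OF ch])
  note S = premanifold_std[OF finite_dim_real]
  have ICh: "(I, \<lambda>x. x) \<in> open_submanifold std_manifold I"
    using premanifold_restrict[OF S std_chart, of I] I by (simp add: open_submanifold_def)
  have smy: "smooth_on I y"
    unfolding y_def
    by (intro smooth_on_add smooth_on_const I smooth_on_bounded_linear[OF bounded_linear_scaleR_left _ smooth_on_ident])
  have "smooth_map (open_submanifold std_manifold I) M \<gamma>"
  proof (rule smooth_mapI[OF premanifold_open[OF S]])
    have pI: "t \<in> I" if "t \<in> points (open_submanifold std_manifold I)" for t
      using that by (auto simp: points_def open_submanifold_def)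
    fix t assume "t \<in> points (open_submanifold std_manifold I)"
    then have t: "t \<in> I" by (rule pI)
    have inv: "inv_into I (\<lambda>x. x) u = u" if "u \<in> I" for u
      using that by (metis (full_types) f_inv_into_f image_ident)
    have "smooth_on I (\<lambda>u. snd c (\<gamma> (inv_into I (\<lambda>x. x) u)))"
      by (rule smooth_on_cong[OF I(1) _ smy]) (simp add: inv \<gamma>I)
    then show "smooth_at (open_submanifold std_manifold I) M \<gamma> t"
      unfolding smooth_at_def
      using t I \<gamma>I(1) by (intro bexI[OF _ ICh] bexI[OF _ c] exI[of _ I]) auto
  qed
  then have sc: "smooth_curve M I \<gamma>" using I by (simp add: smooth_curve_def)
  have evI: "\<forall>\<^sub>F s in nhds 0. s \<in> I" using I by (simp add: eventually_nhds_in_open)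
  then have ev: "\<forall>\<^sub>F s in nhds 0. \<gamma> s \<in> fst c" by eventually_elim (rule \<gamma>I)
  have "(y has_vector_derivative w) (at 0)"
    unfolding y_def by (auto intro!: derivative_eq_intros)
  then have der: "((\<lambda>s. snd c (\<gamma> s)) has_vector_derivative w) (at 0)"
    by (rule vector_derivative_cong) (use evI in \<open>eventually_elim, simp add: \<gamma>I\<close>)
  have g0: "\<gamma> 0 = x" using x by (simp add: \<gamma>_def y_def chart_inv_chart[OF ch])
  show thesis
    using that[OF I(3) sc g0 _ ev der] has_velocityI[OF M c _ ev der] x unfolding g0 by blast
qed

text \<open>Every tangent vector is the velocity of a line, so the change of charts known for
  velocities applies to it.\<close>

lemma tangent_space_eq:
  assumes M: "premanifold M" and v: "v \<in> tangent_space M x" and c: "c \<in> M" "x \<in> fst c"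
  shows "v = tangent_vector M x c (v c)"
proof -
  from v obtain d w where d: "d \<in> M" "x \<in> fst d" "v = tangent_vector M x d w" unfolding tangent_space_def by blast
  obtain I \<gamma> where "\<gamma> 0 = x" "has_velocity M \<gamma> 0 (tangent_vector M x d w)"
    by (rule line_in_chart[OF M d(1,2)])
  then show ?thesis using has_velocity_tangent_vector[OF M _ c(1), of \<gamma> 0 v] c d(3) by simp
qed

section \<open>Integral curves\<close>

lemma vector_derivative_bound:
  fixes g :: "real \<Rightarrow> 'd::real_normed_vector"
  assumes "convex S" "\<And>s. s \<in> S \<Longrightarrow> (g has_vector_derivative g' s) (at s within S)"
    "\<And>s. s \<in> S \<Longrightarrow> norm (g' s) \<le> B" "a \<in> S" "b \<in> S"
  shows "norm (g b - g a) \<le> B * \<bar>b - a\<bar>"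
proof -
  have "norm (g b - g a) \<le> B * norm (b - a)"
  proof (rule differentiable_bound[OF assms(1), of g "\<lambda>s h. h *\<^sub>R g' s"])
    show "(g has_derivative (\<lambda>h. h *\<^sub>R g' s)) (at s within S)" if "s \<in> S" for s
      using assms(2)[OF that] by (simp add: has_vector_derivative_def)
    show "onorm (\<lambda>h. h *\<^sub>R g' s) \<le> B" if "s \<in> S" for s
    proof (rule onorm_le)
      show "norm (h *\<^sub>R g' s) \<le> B * norm h" for h
        using mult_left_mono[OF assms(3)[OF that] abs_ge_zero[of h]] by (simp add: mult.commute)
    qed
  qed (use assms in auto)
  then show ?thesis by simp
qed

text \<open>Banach's fixed point theorem for the Picard operator, on the closed set of bounded
  continuous curves with values in the ball.\<close>

lemma picard_lindelof_banach:
  fixes f :: "'d::banach \<Rightarrow> 'd"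
  assumes r: "r > 0" and L: "\<And>u v. u \<in> cball x r \<Longrightarrow> v \<in> cball x r \<Longrightarrow> norm (f u - f v) \<le> L * norm (u - v)"
  shows "\<exists>\<delta>>0. \<exists>w. w 0 = x \<and> (\<forall>t\<in>{-\<delta><..<\<delta>}. w t \<in> cball x r \<and> (w has_vector_derivative f (w t)) (at t))"
proof -
  \<comment> \<open>\<open>L\<close> may be zero or negative; a positive Lipschitz constant allows
    division.\<close>
  define K where "K = \<bar>L\<bar> + 1"
  have K: "K > 0" by (simp add: K_def)
  have LK: "norm (f u - f v) \<le> K * norm (u - v)" if "u \<in> cball x r" "v \<in> cball x r" for u v
    using L[OF that] by (rule order_trans) (simp add: K_def mult_right_mono)
  define B where "B = norm (f x) + K * r + 1"
  have B: "B > 0" using K r by (simp add: B_def add_nonneg_pos)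
  have fB: "norm (f u) \<le> B" if "u \<in> cball x r" for u
  proof -
    have "norm (f u) \<le> norm (f x) + norm (f u - f x)" using norm_triangle_sub by blast
    also have "norm (f u - f x) \<le> K * norm (u - x)" using LK[OF that] r by simp
    also have "\<dots> \<le> K * r" using that K by (simp add: dist_norm norm_minus_commute)
    finally show ?thesis by (simp add: B_def)
  qed
  have fcont: "continuous_on (cball x r) f"
  proof (rule continuous_onI)
    fix u e assume u: "u \<in> cball x r" and e: "(e :: real) > 0"
    have "dist (f v) (f u) \<le> e" if "v \<in> cball x r" "dist v u < e / K" for v
      using LK[OF that(1) u] that(2) K by (simp add: dist_norm field_simps)
    then show "\<exists>d>0. \<forall>v\<in>cball x r. dist v u < d \<longrightarrow> dist (f v) (f u) \<le> e"
      using e K by (intro exI[of _ "e / K"]) auto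
  qed
  \<comment> \<open>The first bound keeps Picard iterates inside the ball, since \<open>B\<close>
    bounds the speed there; the second makes the operator contract by one half.\<close>
  define \<delta> where "\<delta> = min (r / B) (1 / (2 * K))"
  have \<delta>: "\<delta> > 0" "B * \<delta> \<le> r" "K * \<delta> \<le> 1 / 2"
    using r B K by (auto simp: \<delta>_def min_def field_simps)
  let ?I = "{-\<delta>..\<delta>}"
  \<comment> \<open>The complete space at hand consists of functions on the whole line; the operator
    looks only at their values on \<open>?I\<close>.\<close>
  define Q where "Q = {u :: real \<Rightarrow>\<^sub>C 'd. \<forall>t. u t \<in> cball x r}"
  \<comment> \<open>Subtracting the integral up to 0 gives the oriented integral from 0 to
    \<open>s\<close>, also for negative \<open>s\<close>.\<close>
  define g where "g u s = integral {-\<delta>..s} (\<lambda>t. f (u t)) - integral {-\<delta>..0} (\<lambda>t. f (u t))"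
    for u :: "real \<Rightarrow>\<^sub>C 'd" and s
  have g': "(g u has_vector_derivative f (u s)) (at s within ?I)" if "u \<in> Q" "s \<in> ?I" for u s
  proof -
    have "continuous_on ?I (\<lambda>t. f (u t))"
      using that(1) by (intro continuous_on_compose2[OF fcont]) (auto simp: Q_def)
    from integral_has_vector_derivative[OF this that(2)]
    show ?thesis unfolding g_def by (auto intro!: derivative_eq_intros)
  qed
  have g0: "g u 0 = 0" for u by (simp add: g_def)
  have gB: "norm (g u s) \<le> r" if "u \<in> Q" "s \<in> ?I" for u s
  proof -
    have "norm (g u s - g u 0) \<le> B * \<bar>s - 0\<bar>"
      using that \<delta>(1) by (intro vector_derivative_bound[of ?I _ "\<lambda>s. f (u s)"] g' fB) (auto simp: Q_def)
    also have "\<dots> \<le> B * \<delta>" using that B by auto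
    finally show ?thesis using \<delta>(2) by (simp add: g0)
  qed
  \<comment> \<open>Freezing time at the ends of \<open>?I\<close> extends a Picard iterate to a
    bounded continuous function on the line.\<close>
  define clamp where "clamp t = max (-\<delta>) (min \<delta> t)" for t
  have clamp: "clamp t \<in> ?I" for t using \<delta>(1) by (auto simp: clamp_def)
  have clamp_id: "clamp t = t" if "t \<in> ?I" for t using that by (auto simp: clamp_def)
  define T where "T u = Bcontfun (\<lambda>t. x + g u (clamp t))" for u
  have T: "(T u) t = x + g u (clamp t)" if "u \<in> Q" for u t
  proof -
    have "continuous_on ?I (g u)"
      using g'[OF that] has_vector_derivative_continuous continuous_on_eq_continuous_within by blast
    then have "continuous_on UNIV (\<lambda>t. g u (clamp t))"
      by (rule continuous_on_compose2) (use clamp in \<open>auto simp: clamp_def intro!: continuous_intros\<close>)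
    moreover have "norm (x + g u (clamp t)) \<le> norm x + r" for t
      using gB[OF that clamp] by (intro order_trans[OF norm_triangle_ineq]) simp
    ultimately have "(\<lambda>t. x + g u (clamp t)) \<in> bcontfun"
      by (intro bcontfun_normI[where b = "norm x + r"] continuous_intros) auto
    then show ?thesis by (simp add: T_def Bcontfun_inverse)
  qed
  have "\<exists>!u\<in>Q. T u = u"
  proof (rule Banach_fix[where c = "1/2"])
    have "closed Q"
      unfolding closed_sequential_limits
    proof (intro allI impI)
      fix U u assume U: "(\<forall>n. U n \<in> Q) \<and> U \<longlonglongrightarrow> u"
      show "u \<in> Q" unfolding Q_def
      proof (intro CollectI allI)
        fix t
        have mem: "(U n) t \<in> cball x r" for n using U unfolding Q_def by blast
        have "(\<lambda>n. (U n) t) \<longlonglongrightarrow> u t"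
        proof (rule metric_LIMSEQ_I)
          fix e :: real assume "e > 0"
          with U obtain n0 where "\<And>n. n \<ge> n0 \<Longrightarrow> dist (U n) u < e" using metric_LIMSEQ_D by metis
          then show "\<exists>n0. \<forall>n\<ge>n0. dist ((U n) t) (u t) < e"
            using dist_bounded le_less_trans by metis
        qed
        then show "u t \<in> cball x r"
          by (rule closed_sequentially[OF closed_cball mem])
      qed
    qed
    then show "complete Q" by (simp add: complete_eq_closed)
    have "const_bcontfun x \<in> Q" using r by (auto simp: Q_def const_bcontfun.rep_eq)
    then show "Q \<noteq> {}" by blast
    show "T ` Q \<subseteq> Q"
    proof
      fix v assume "v \<in> T ` Q"
      then obtain u where u: "u \<in> Q" "v = T u" by blast
      show "v \<in> Q" using gB[OF u(1) clamp] by (simp add: u(2) Q_def T[OF u(1)] dist_norm)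
    qed
    show "dist (T u) (T v) \<le> 1 / 2 * dist u v" if "u \<in> Q" "v \<in> Q" for u v
    proof (rule dist_bound)
      fix t
      have "norm ((g u (clamp t) - g v (clamp t)) - (g u 0 - g v 0)) \<le> (K * dist u v) * \<bar>clamp t - 0\<bar>"
      proof (rule vector_derivative_bound[of ?I "\<lambda>s. g u s - g v s" "\<lambda>s. f (u s) - f (v s)"])
        show "((\<lambda>s. g u s - g v s) has_vector_derivative f (u s) - f (v s)) (at s within ?I)"
          if "s \<in> ?I" for s by (intro has_vector_derivative_diff g' that \<open>u \<in> Q\<close> \<open>v \<in> Q\<close>)
        show "norm (f (u s) - f (v s)) \<le> K * dist u v" for s
        proof -
          have "norm (f (u s) - f (v s)) \<le> K * norm (u s - v s)"
            using \<open>u \<in> Q\<close> \<open>v \<in> Q\<close> by (intro LK) (auto simp: Q_def)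
          also have "\<dots> \<le> K * dist u v"
            using dist_bounded[of u s v] K by (simp add: dist_norm)
          finally show ?thesis .
        qed
      qed (use clamp \<delta>(1) in auto)
      also have "\<dots> \<le> (K * dist u v) * \<delta>"
        using clamp[of t] K by (intro mult_left_mono) auto
      also have "\<dots> = (K * \<delta>) * dist u v" by simp
      also have "\<dots> \<le> 1 / 2 * dist u v" using \<delta>(3) by (rule mult_right_mono) simp
      finally show "dist ((T u) t) ((T v) t) \<le> 1 / 2 * dist u v"
        using that by (simp add: T g0 dist_norm)
    qed
  qed auto
  then obtain u where u: "u \<in> Q" "T u = u" by blast
  define w where "w t = x + g u t" for t
  have wu: "u t = w t" if "t \<in> ?I" for t
    using T[OF u(1), of t] that by (simp add: u(2) w_def clamp_id)
  have "w t \<in> cball x r \<and> (w has_vector_derivative f (w t)) (at t)" if "t \<in> {-\<delta><..<\<delta>}" for t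
  proof
    have t: "t \<in> ?I" using that by auto
    show "w t \<in> cball x r" using u(1) wu[OF t] by (metis (mono_tags, lifting) Q_def mem_Collect_eq)
    have "(w has_vector_derivative f (w t)) (at t within ?I)"
      using g'[OF u(1) t] unfolding w_def[abs_def] wu[OF t, unfolded w_def]
      by (auto intro!: derivative_eq_intros)
    then show "(w has_vector_derivative f (w t)) (at t)" using that by (simp add: at_within_Icc_at)
  qed
  moreover have "w 0 = x" by (simp add: w_def g0)
  ultimately show ?thesis using \<delta>(1) by blast
qed

text \<open>
  A finite-dimensional type need not be an instance of \<^class>\<open>banach\<close>, but its dual is one and
  contains it as a retract.
\<close>

lemma picard_lindelof:
  fixes f :: "'e::real_normed_vector \<Rightarrow> 'e"
  assumes fd: "finite_dim TYPE('e)" and r: "r > 0"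
    and L: "\<And>u v. u \<in> cball x r \<Longrightarrow> v \<in> cball x r \<Longrightarrow> norm (f u - f v) \<le> L * norm (u - v)"
  shows "\<exists>\<delta>>0. \<exists>w. w 0 = x \<and> (\<forall>t\<in>{-\<delta><..<\<delta>}. w t \<in> cball x r \<and> (w has_vector_derivative f (w t)) (at t))"
proof -
  obtain B :: "'e set" and \<kappa> where "coordinates B \<kappa>" using finite_dim_coordinates[OF fd] by blast
  note B = coordinatesD[OF this]
  \<comment> \<open>\<open>J\<close> identifies the space with its dual through the basis:
    \<open>J y\<close> takes the value \<open>\<kappa> b y\<close> at \<open>b\<close>. The map
    \<open>R\<close> recovers \<open>y\<close> from these values.\<close>
  define J :: "'e \<Rightarrow> ('e \<Rightarrow>\<^sub>L real)" where "J y = (\<Sum>b\<in>B. \<kappa> b y *\<^sub>R Blinfun (\<kappa> b))" for y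
  define R :: "('e \<Rightarrow>\<^sub>L real) \<Rightarrow> 'e" where "R \<Lambda> = (\<Sum>b\<in>B. blinfun_apply \<Lambda> b *\<^sub>R b)" for \<Lambda>
  have J: "bounded_linear J" unfolding J_def
    by (intro bounded_linear_sum bounded_linear_compose[OF bounded_linear_scaleR_left] B(2))
  have R: "bounded_linear R" unfolding R_def
    by (intro bounded_linear_sum bounded_linear_compose[OF bounded_linear_scaleR_left] blinfun.bounded_linear_left)
  have RJ: "R (J y) = y" for y
  proof -
    have "blinfun_apply (J y) b = \<kappa> b y" if b: "b \<in> B" for b
    proof -
      have "blinfun_apply (J y) b = (\<Sum>c\<in>B. \<kappa> c y * \<kappa> c b)"
        by (simp add: J_def blinfun.sum_left blinfun.scaleR_left bounded_linear_Blinfun_apply[OF B(2)])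
      also have "\<dots> = (\<Sum>c\<in>B. if c = b then \<kappa> c y else 0)"
        by (rule sum.cong) (use B(4)[OF _ b] in auto)
      finally show ?thesis using b B(1) by simp
    qed
    then have "R (J y) = (\<Sum>b\<in>B. \<kappa> b y *\<^sub>R b)" unfolding R_def by (intro sum.cong) auto
    also have "\<dots> = y" by (rule B(3)[symmetric])
    finally show ?thesis .
  qed
  obtain CJ where CJ: "CJ > 0" "\<And>y. norm (J y) \<le> norm y * CJ" using bounded_linear.pos_bounded[OF J] by blast
  obtain CR where CR: "CR > 0" "\<And>y. norm (R y) \<le> norm y * CR" using bounded_linear.pos_bounded[OF R] by blast
  \<comment> \<open>This radius makes \<open>R\<close> send the ball around \<open>J x\<close> into
    the ball around \<open>x\<close>.\<close>
  define \<rho> where "\<rho> = r / CR"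
  have \<rho>: "\<rho> > 0" using r CR by (simp add: \<rho>_def)
  have Rb: "R w \<in> cball x r" if "w \<in> cball (J x) \<rho>" for w
  proof -
    have "norm (R w - x) = norm (R (w - J x))" by (simp add: RJ linear_diff[OF bounded_linear.linear[OF R]])
    also have "\<dots> \<le> norm (w - J x) * CR" by (rule CR(2))
    also have "\<dots> \<le> \<rho> * CR" using that CR(1) by (simp add: dist_norm norm_minus_commute)
    finally show ?thesis using CR(1) by (simp add: \<rho>_def dist_norm norm_minus_commute)
  qed
  \<comment> \<open>The equation is transported to the dual with right-hand side
    \<open>J (f (R w))\<close>. Since \<open>R\<close> is linear and \<open>R (J u) = u\<close>,
    applying \<open>R\<close> to a solution solves the original equation.\<close>
  have "\<exists>\<delta>>0. \<exists>w. w 0 = J x \<and> (\<forall>t\<in>{-\<delta><..<\<delta>}. w t \<in> cball (J x) \<rho> \<and> (w has_vector_derivative J (f (R (w t)))) (at t))"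
  proof (rule picard_lindelof_banach[OF \<rho>])
    fix u v assume uv: "u \<in> cball (J x) \<rho>" "v \<in> cball (J x) \<rho>"
    have "norm (J (f (R u)) - J (f (R v))) = norm (J (f (R u) - f (R v)))"
      by (simp add: linear_diff[OF bounded_linear.linear[OF J]])
    also have "\<dots> \<le> norm (f (R u) - f (R v)) * CJ" by (rule CJ(2))
    also have "\<dots> \<le> (L * norm (R u - R v)) * CJ" using L[OF Rb[OF uv(1)] Rb[OF uv(2)]] CJ(1) by simp
    also have "\<dots> \<le> (\<bar>L\<bar> * norm (R u - R v)) * CJ" using CJ(1) by (intro mult_right_mono) auto
    also have "norm (R u - R v) \<le> norm (u - v) * CR"
      using CR(2)[of "u - v"] by (simp add: linear_diff[OF bounded_linear.linear[OF R]])
    then have "(\<bar>L\<bar> * norm (R u - R v)) * CJ \<le> (\<bar>L\<bar> * (norm (u - v) * CR)) * CJ"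
      using CJ(1) by (intro mult_right_mono mult_left_mono) auto
    finally show "norm (J (f (R u)) - J (f (R v))) \<le> (\<bar>L\<bar> * CR * CJ) * norm (u - v)" by (simp add: ac_simps)
  qed
  then obtain \<delta> w where \<delta>: "\<delta> > 0" and w0: "w 0 = J x"
    and w: "\<And>t. t \<in> {-\<delta><..<\<delta>} \<Longrightarrow> w t \<in> cball (J x) \<rho>"
      "\<And>t. t \<in> {-\<delta><..<\<delta>} \<Longrightarrow> (w has_vector_derivative J (f (R (w t)))) (at t)" by blast
  have "R (w t) \<in> cball x r \<and> ((\<lambda>t. R (w t)) has_vector_derivative f (R (w t))) (at t)" if "t \<in> {-\<delta><..<\<delta>}" for t
    using Rb[OF w(1)[OF that]] bounded_linear.has_vector_derivative[OF R w(2)[OF that]] by (simp add: RJ)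
  then show ?thesis using \<delta> w0 by (intro exI[of _ \<delta>] conjI exI[of _ "\<lambda>t. R (w t)"]) (auto simp: RJ)
qed

text \<open>Near \<open>x\<close> the finitely many partial derivatives along a basis are bounded by
  continuity. Coordinates turn this into a bound of the operator norm, and the mean value inequality
  applies on a ball.\<close>

lemma smooth_on_locally_lipschitz:
  fixes f :: "'e::real_normed_vector \<Rightarrow> 'f::real_normed_vector"
  assumes fd: "finite_dim TYPE('e)" and S: "open S" and x: "x \<in> S" and f: "smooth_on S f"
  obtains r L where "r > 0" "L > 0" "cball x r \<subseteq> S"
    "\<And>u v. u \<in> cball x r \<Longrightarrow> v \<in> cball x r \<Longrightarrow> norm (f u - f v) \<le> L * norm (u - v)"
proof -
  obtain B :: "'e set" and \<kappa> where "coordinates B \<kappa>" using finite_dim_coordinates[OF fd] by blast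
  note B = coordinatesD[OF this]
  let ?D = "\<lambda>u b. frechet_derivative f (at u) b"
  have "continuous_on S (\<lambda>u. ?D u b)" for b
  proof -
    have "Ck_on (Suc 0) S f" using f unfolding smooth_on_def by blast
    then show ?thesis by simp
  qed
  then have cont: "isCont (\<lambda>u. norm (?D u b)) x" for b
    using S x by (intro continuous_norm) (simp add: continuous_on_eq_continuous_at)
  have "((\<lambda>u. norm (?D u b)) \<longlongrightarrow> norm (?D x b)) (nhds x)" for b
    by (rule tendsto_at_iff_tendsto_nhds[THEN iffD1, OF cont[unfolded isCont_def]])
  then have "\<forall>\<^sub>F u in nhds x. norm (?D u b) < norm (?D x b) + 1" for b
    by (rule order_tendstoD) simp
  then have "\<forall>\<^sub>F u in nhds x. \<forall>b\<in>B. norm (?D u b) < norm (?D x b) + 1"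
    using B(1) by (simp add: eventually_ball_finite)
  moreover have "\<forall>\<^sub>F u in nhds x. u \<in> S" using S x by (rule eventually_nhds_in_open)
  ultimately have "\<forall>\<^sub>F u in nhds x. u \<in> S \<and> (\<forall>b\<in>B. norm (?D u b) < norm (?D x b) + 1)"
    by eventually_elim simp
  then obtain d where d: "d > 0" "\<And>u. dist u x < d \<Longrightarrow> u \<in> S \<and> (\<forall>b\<in>B. norm (?D u b) < norm (?D x b) + 1)"
    unfolding eventually_nhds_metric by blast
  define r where "r = d / 2"
  have r: "r > 0" "\<And>u. u \<in> cball x r \<Longrightarrow> u \<in> S" "\<And>u b. u \<in> cball x r \<Longrightarrow> b \<in> B \<Longrightarrow> norm (?D u b) \<le> norm (?D x b) + 1"
    using d by (auto simp: r_def dist_commute less_imp_le)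
  obtain C where C: "\<And>b. C b > 0" "\<And>b v. norm (\<kappa> b v) \<le> norm v * C b"
    using bounded_linear.pos_bounded[OF B(2)] by metis
  \<comment> \<open>\<open>C b\<close> bounds the coordinate functional and the other factor the
    partial derivative along \<open>b\<close>; the last summand makes \<open>L\<close>
    positive.\<close>
  define L where "L = (\<Sum>b\<in>B. C b * (norm (?D x b) + 1)) + 1"
  have L: "L > 0" unfolding L_def
    by (intro add_nonneg_pos sum_nonneg mult_nonneg_nonneg) (auto intro: less_imp_le[OF C(1)])
  have "norm (f u - f v) \<le> L * norm (u - v)" if uv: "u \<in> cball x r" "v \<in> cball x r" for u v
  proof (rule differentiable_bound[OF convex_cball[of x r], of f ?D])
    fix y assume y: "y \<in> cball x r"
    show "(f has_derivative ?D y) (at y within cball x r)"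
      by (rule has_derivative_at_withinI[OF smooth_on_has_derivative[OF f r(2)[OF y]]])
    have lin: "linear (?D y)" by (rule smooth_on_frechet_linear[OF f r(2)[OF y]])
    show "onorm (?D y) \<le> L"
    proof (rule onorm_bound)
      show "0 \<le> L" using L by simp
      fix w
      have "?D y w = ?D y (\<Sum>b\<in>B. \<kappa> b w *\<^sub>R b)" by (rule arg_cong[OF B(3)])
      also have "\<dots> = (\<Sum>b\<in>B. \<kappa> b w *\<^sub>R ?D y b)" by (simp add: linear_sum[OF lin] linear_cmul[OF lin])
      finally have "norm (?D y w) \<le> (\<Sum>b\<in>B. norm (\<kappa> b w *\<^sub>R ?D y b))" by (simp only: norm_sum)
      also have "\<dots> \<le> (\<Sum>b\<in>B. (norm w * C b) * (norm (?D x b) + 1))"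
        using C(2) r(3)[OF y] less_imp_le[OF C(1)] by (intro sum_mono) (auto intro!: mult_mono)
      also have "\<dots> = (\<Sum>b\<in>B. C b * (norm (?D x b) + 1)) * norm w"
        by (subst sum_distrib_right) (simp add: ac_simps)
      also have "\<dots> \<le> L * norm w" by (rule mult_right_mono) (auto simp: L_def)
      finally show "norm (?D y w) \<le> L * norm w" .
    qed
  qed (use uv in auto)
  then show thesis using that[OF r(1) L] r(2) by blast
qed

text \<open>Let \<open>m\<close> be a point of a short interval where the distance of the two
  solutions is maximal. The mean value inequality bounds this maximum by half of itself, so it
  vanishes.\<close>

lemma solution_local_unique:
  fixes f :: "'e::real_normed_vector \<Rightarrow> 'e"
  assumes L: "L > 0" "\<And>u v. u \<in> cball x r \<Longrightarrow> v \<in> cball x r \<Longrightarrow> norm (f u - f v) \<le> L * norm (u - v)" and r: "r > 0"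
    and y: "\<forall>\<^sub>F s in nhds t. (y has_vector_derivative f (y s)) (at s)" "y t = x"
    and z: "\<forall>\<^sub>F s in nhds t. (z has_vector_derivative f (z s)) (at s)" "z t = x"
  shows "\<forall>\<^sub>F s in nhds t. y s = z s"
proof -
  have "\<forall>\<^sub>F s in nhds t. y s \<in> ball x r"
    using eventually_nhds_x_imp_x[OF y(1)] r y(2) by (intro eventually_nhds_curve) auto
  moreover have "\<forall>\<^sub>F s in nhds t. z s \<in> ball x r"
    using eventually_nhds_x_imp_x[OF z(1)] r z(2) by (intro eventually_nhds_curve) auto
  ultimately have "\<forall>\<^sub>F s in nhds t. y s \<in> cball x r \<and> z s \<in> cball x r \<and>
      (y has_vector_derivative f (y s)) (at s) \<and> (z has_vector_derivative f (z s)) (at s)"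
    using y(1) z(1) by eventually_elim auto
  then obtain d where d: "d > 0" "\<And>s. dist s t < d \<Longrightarrow> y s \<in> cball x r \<and> z s \<in> cball x r \<and>
      (y has_vector_derivative f (y s)) (at s) \<and> (z has_vector_derivative f (z s)) (at s)"
    unfolding eventually_nhds_metric by blast
  \<comment> \<open>\<open>d / 2\<close> keeps the closed interval within the times where the
    equations hold; \<open>1 / (2 * L)\<close> yields the factor one half.\<close>
  define e where "e = min (d / 2) (1 / (2 * L))"
  have e: "e > 0" "e < d" "L * e \<le> 1 / 2" using d(1) L(1) by (auto simp: e_def min_def field_simps)
  let ?I = "cball t e"
  have I: "y s \<in> cball x r" "z s \<in> cball x r"
    "(y has_vector_derivative f (y s)) (at s within ?I)" "(z has_vector_derivative f (z s)) (at s within ?I)" if "s \<in> ?I" for s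
    using d(2)[of s] that e by (auto simp: dist_commute intro: has_vector_derivative_at_within)
  have "continuous_on ?I (\<lambda>s. norm (y s - z s))"
    using I by (intro continuous_intros continuous_on_vector_derivative) auto
  then obtain m where m: "m \<in> ?I" "\<And>s. s \<in> ?I \<Longrightarrow> norm (y s - z s) \<le> norm (y m - z m)"
    using continuous_attains_sup[of ?I "\<lambda>s. norm (y s - z s)"] e(1) by auto
  let ?N = "norm (y m - z m)"
  have "norm ((y m - z m) - (y t - z t)) \<le> (L * ?N) * \<bar>m - t\<bar>"
  proof (rule vector_derivative_bound[of ?I "\<lambda>s. y s - z s" "\<lambda>s. f (y s) - f (z s)"])
    show "((\<lambda>s. y s - z s) has_vector_derivative f (y s) - f (z s)) (at s within ?I)" if "s \<in> ?I" for s
      by (intro has_vector_derivative_diff I that)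
    show "norm (f (y s) - f (z s)) \<le> L * ?N" if "s \<in> ?I" for s
    proof (rule order_trans[OF L(2)[OF I(1,2)[OF that]]])
      show "L * norm (y s - z s) \<le> L * ?N" using m(2)[OF that] L(1) by simp
    qed
  qed (use m(1) e(1) in auto)
  also have "\<dots> \<le> (L * ?N) * e" using m(1) L(1) by (intro mult_left_mono) (auto simp: dist_real_def)
  also have "\<dots> = (L * e) * ?N" by simp
  also have "\<dots> \<le> 1 / 2 * ?N" using e(3) by (rule mult_right_mono) simp
  finally have "?N = 0" using y(2) z(2) by simp
  then have "y s = z s" if "s \<in> ?I" for s using m(2)[OF that] by simp
  then have "\<forall>s. dist s t < e \<longrightarrow> y s = z s" by (simp add: dist_commute)
  with e(1) show ?thesis unfolding eventually_nhds_metric by blast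
qed

section \<open>Integral curves and flows on manifolds\<close>

lemma vector_field_smooth:
  "vector_field M X \<Longrightarrow> c \<in> M \<Longrightarrow> smooth_on (snd c ` fst c) (\<lambda>u. X (chart_inv c u) c)"
  by (simp add: vector_field_def)

lemma integral_curve_exists:
  assumes M: "premanifold M" and X: "vector_field M X" and x: "x \<in> points M"
  shows "\<exists>I \<gamma>. integral_curve M X x I \<gamma>"
proof -
  obtain c where c: "c \<in> M" "x \<in> fst c" using points_chart[OF x] by blast
  note ch = premanifold_chart[OF M c(1)]
  let ?S = "snd c ` fst c" and ?f = "\<lambda>u. X (chart_inv c u) c"
  obtain r L where r: "r > 0" "L > 0" "cball (snd c x) r \<subseteq> ?S"
    and L: "\<And>u v. u \<in> cball (snd c x) r \<Longrightarrow> v \<in> cball (snd c x) r \<Longrightarrow> norm (?f u - ?f v) \<le> L * norm (u - v)"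
    using smooth_on_locally_lipschitz[OF premanifold_finite_dim[OF M] premanifold_chart_open[OF M c(1)] _ vector_field_smooth[OF X c(1)], of "snd c x"]
      c(2) by blast
  obtain \<delta> w where \<delta>: "\<delta> > 0" and w0: "w 0 = snd c x"
    and w: "\<And>t. t \<in> {-\<delta><..<\<delta>} \<Longrightarrow> w t \<in> cball (snd c x) r"
      "\<And>t. t \<in> {-\<delta><..<\<delta>} \<Longrightarrow> (w has_vector_derivative ?f (w t)) (at t)"
    using picard_lindelof[OF premanifold_finite_dim[OF M] r(1) L] by blast
  define \<gamma> where "\<gamma> t = chart_inv c (w t)" for t
  let ?I = "{-\<delta><..<\<delta>}"
  have \<gamma>: "\<gamma> t \<in> fst c" "snd c (\<gamma> t) = w t" if "t \<in> ?I" for t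
    using w(1)[OF that] r(3) by (auto simp: \<gamma>_def chart_inv_chart[OF ch] subset_iff)
  have "has_velocity M \<gamma> t (X (\<gamma> t))" if t: "t \<in> ?I" for t
  proof -
    have ev: "\<forall>\<^sub>F s in nhds t. s \<in> ?I" using t by (intro eventually_nhds_in_open) auto
    then have 1: "\<forall>\<^sub>F s in nhds t. \<gamma> s \<in> fst c" by eventually_elim (rule \<gamma>)
    have 2: "((\<lambda>s. snd c (\<gamma> s)) has_vector_derivative X (\<gamma> t) c) (at t)"
      by (rule vector_derivative_cong[of w])
        (use w(2)[OF t] ev in \<open>auto simp: \<gamma>_def[symmetric] \<gamma> elim: eventually_mono\<close>)
    have "X (\<gamma> t) \<in> tangent_space M (\<gamma> t)"
      using X chart_points[OF c(1) \<gamma>(1)[OF t]] by (simp add: vector_field_def)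
    from tangent_space_eq[OF M this c(1) \<gamma>(1)[OF t]] has_velocityI[OF M c(1) \<gamma>(1)[OF t] 1 2]
    show ?thesis by simp
  qed
  moreover have "\<gamma> 0 = x" using c(2) by (simp add: \<gamma>_def w0 chart_inv_chart[OF ch])
  ultimately have "integral_curve M X x ?I \<gamma>"
    using \<delta> by (auto simp: integral_curve_def is_interval_oo)
  then show ?thesis by blast
qed

lemma integral_curve_local_unique:
  assumes M: "premanifold M" and X: "vector_field M X"
    and \<alpha>: "\<forall>\<^sub>F s in nhds t. has_velocity M \<alpha> s (X (\<alpha> s))"
    and \<beta>: "\<forall>\<^sub>F s in nhds t. has_velocity M \<beta> s (X (\<beta> s))" and eq: "\<alpha> t = \<beta> t"
  shows "\<forall>\<^sub>F s in nhds t. \<alpha> s = \<beta> s"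
proof -
  note \<alpha>t = eventually_nhds_x_imp_x[OF \<alpha>] and \<beta>t = eventually_nhds_x_imp_x[OF \<beta>]
  obtain c where c: "c \<in> M" "\<alpha> t \<in> fst c" using points_chart[OF has_velocity_points[OF \<alpha>t]] by blast
  note ch = premanifold_chart[OF M c(1)]
  let ?S = "snd c ` fst c" and ?f = "\<lambda>u. X (chart_inv c u) c"
  obtain r L where r: "r > 0" "L > 0" "cball (snd c (\<alpha> t)) r \<subseteq> ?S"
    and L: "\<And>u v. u \<in> cball (snd c (\<alpha> t)) r \<Longrightarrow> v \<in> cball (snd c (\<alpha> t)) r \<Longrightarrow> norm (?f u - ?f v) \<le> L * norm (u - v)"
    using smooth_on_locally_lipschitz[OF premanifold_finite_dim[OF M] premanifold_chart_open[OF M c(1)] _ vector_field_smooth[OF X c(1)], of "snd c (\<alpha> t)"]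
      c(2) by blast
  have sol: "\<forall>\<^sub>F s in nhds t. \<gamma> s \<in> fst c"
    "\<forall>\<^sub>F s in nhds t. ((\<lambda>s. snd c (\<gamma> s)) has_vector_derivative ?f (snd c (\<gamma> s))) (at s)"
    if ev: "\<forall>\<^sub>F s in nhds t. has_velocity M \<gamma> s (X (\<gamma> s))" and "\<gamma> t \<in> fst c" for \<gamma>
  proof -
    show 1: "\<forall>\<^sub>F s in nhds t. \<gamma> s \<in> fst c"
      using has_velocity_chart(1)[OF eventually_nhds_x_imp_x[OF ev] c(1) that(2)] .
    show "\<forall>\<^sub>F s in nhds t. ((\<lambda>s. snd c (\<gamma> s)) has_vector_derivative ?f (snd c (\<gamma> s))) (at s)"
      using ev 1
    proof eventually_elim
      case (elim s)
      from has_velocity_chart(2)[OF elim(1) c(1) elim(2)] show ?case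
        using elim(2) by (simp add: chart_inv_chart[OF ch])
    qed
  qed
  have \<beta>c: "\<beta> t \<in> fst c" using c(2) eq by simp
  have "\<forall>\<^sub>F s in nhds t. snd c (\<alpha> s) = snd c (\<beta> s)"
    by (rule solution_local_unique[OF r(2) L r(1) sol(2)[OF \<alpha> c(2)] _ sol(2)[OF \<beta> \<beta>c]]) (auto simp: eq)
  with sol(1)[OF \<alpha> c(2)] sol(1)[OF \<beta> \<beta>c] show ?thesis
  proof eventually_elim
    case (elim s)
    then show ?case using ch by (auto simp: is_chart_def dest: inj_onD)
  qed
qed

text \<open>Continuity of a curve at a time where it has a velocity. It is used throughout to keep a
  curve inside a set of points while an identity valid there is applied.\<close>

lemma velocity_eventually_open:
  assumes M: "premanifold M" and v: "has_velocity M \<gamma> t v" and V: "openin (mtopology M) V" "\<gamma> t \<in> V"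
  shows "\<forall>\<^sub>F s in nhds t. \<gamma> s \<in> V"
proof -
  obtain c where c: "c \<in> M" "\<gamma> t \<in> fst c" "fst c \<subseteq> V" using chart_at_in_open[OF M V] by blast
  show ?thesis using has_velocity_chart(1)[OF v c(1,2)] by eventually_elim (use c(3) in blast)
qed

lemma integral_curve_velocity: "integral_curve M X x I \<gamma> \<Longrightarrow> s \<in> I \<Longrightarrow> has_velocity M \<gamma> s (X (\<gamma> s))"
  by (simp add: integral_curve_def)

lemma open_eventually:
  assumes "\<And>x. x \<in> S \<Longrightarrow> \<forall>\<^sub>F y in nhds x. y \<in> S"
  shows "open S"
proof (subst open_subopen, rule ballI)
  fix x assume "x \<in> S"
  from assms[OF this] obtain T where "open T" "x \<in> T" "\<forall>y\<in>T. y \<in> S" unfolding eventually_nhds by blast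
  then show "\<exists>T. open T \<and> x \<in> T \<and> T \<subseteq> S" by blast
qed

text \<open>The times of agreement form an open set by local uniqueness. The times of disagreement
  do so as well, because distinct points have disjoint neighbourhoods. The common interval is
  connected and contains 0.\<close>

lemma integral_curve_unique:
  assumes M: "is_manifold M" and X: "vector_field M X"
    and \<alpha>: "integral_curve M X x I \<alpha>" and \<beta>: "integral_curve M X x J \<beta>" and t: "t \<in> I" "t \<in> J"
  shows "\<alpha> t = \<beta> t"
proof -
  note P = is_manifold_premanifold[OF M]
  let ?K = "I \<inter> J"
  define E where "E = {s \<in> ?K. \<alpha> s = \<beta> s}"
  have K: "open ?K" "is_interval ?K" "0 \<in> ?K" and z: "\<alpha> 0 = \<beta> 0"
    using \<alpha> \<beta> by (auto simp: integral_curve_def is_interval_Int)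
  have evK: "\<forall>\<^sub>F s in nhds u. s \<in> ?K" if "u \<in> ?K" for u
    using K(1) that by (rule eventually_nhds_in_open)
  have "\<forall>\<^sub>F s in nhds u. s \<in> E" if "u \<in> E" for u
  proof -
    have u: "u \<in> ?K" "\<alpha> u = \<beta> u" using that by (auto simp: E_def)
    have "\<forall>\<^sub>F s in nhds u. has_velocity M \<alpha> s (X (\<alpha> s))"
      using evK[OF u(1)] by eventually_elim (use integral_curve_velocity[OF \<alpha>] in blast)
    moreover have "\<forall>\<^sub>F s in nhds u. has_velocity M \<beta> s (X (\<beta> s))"
      using evK[OF u(1)] by eventually_elim (use integral_curve_velocity[OF \<beta>] in blast)
    ultimately have "\<forall>\<^sub>F s in nhds u. \<alpha> s = \<beta> s" using u(2) by (rule integral_curve_local_unique[OF P X])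
    with evK[OF u(1)] show ?thesis by eventually_elim (simp add: E_def)
  qed
  then have "open E" by (rule open_eventually)
  have "\<forall>\<^sub>F s in nhds u. s \<in> ?K - E" if "u \<in> ?K - E" for u
  proof -
    have u: "u \<in> I" "u \<in> J" "\<alpha> u \<noteq> \<beta> u" using that by (auto simp: E_def)
    note v = integral_curve_velocity[OF \<alpha> u(1)] integral_curve_velocity[OF \<beta> u(2)]
    have "Hausdorff_space (mtopology M)" using M by (simp add: is_manifold_def)
    moreover have "\<alpha> u \<in> topspace (mtopology M)" "\<beta> u \<in> topspace (mtopology M)"
      using has_velocity_points[OF v(1)] has_velocity_points[OF v(2)] by (simp_all add: topspace_mtopology[OF P])
    ultimately obtain V W where VW: "openin (mtopology M) V" "openin (mtopology M) W" "\<alpha> u \<in> V" "\<beta> u \<in> W" "disjnt V W"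
      using u(3) unfolding Hausdorff_space_def by blast
    show ?thesis
      using velocity_eventually_open[OF P v(1) VW(1,3)] velocity_eventually_open[OF P v(2) VW(2,4)]
        evK[of u, OF IntI[OF u(1,2)]]
    proof eventually_elim
      case (elim s)
      then have "\<alpha> s \<noteq> \<beta> s" using VW(5) by (auto simp: disjnt_iff)
      then show ?case using elim by (simp add: E_def)
    qed
  qed
  then have "open (?K - E)" by (rule open_eventually)
  have "connected ?K" using K(2) is_interval_connected by blast
  then have "?K - E = {}"
    using \<open>open E\<close> \<open>open (?K - E)\<close> K(3) z unfolding connected_def E_def by blast
  then show ?thesis using t by (auto simp: E_def)
qed

lemma flow_integral_curve:
  assumes "is_manifold M" "vector_field M X" "integral_curve M X x I \<gamma>" "t \<in> I"
  shows "flow M X t x = \<gamma> t"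
  unfolding flow_def
proof (rule the_equality)
  show "\<exists>I \<gamma>'. integral_curve M X x I \<gamma>' \<and> t \<in> I \<and> \<gamma> t = \<gamma>' t" using assms by blast
  show "y = \<gamma> t" if "\<exists>I \<gamma>'. integral_curve M X x I \<gamma>' \<and> t \<in> I \<and> y = \<gamma>' t" for y
    using that integral_curve_unique[OF assms(1,2) _ assms(3) _ assms(4)] by blast
qed

lemma flow_velocity:
  assumes M: "is_manifold M" and X: "vector_field M X" and x: "x \<in> points M"
  shows "flow M X 0 x = x" "has_velocity M (\<lambda>t. flow M X t x) 0 (X x)"
proof -
  obtain I \<gamma> where \<gamma>: "integral_curve M X x I \<gamma>"
    using integral_curve_exists[OF is_manifold_premanifold[OF M] X x] by blast
  have I: "open I" "0 \<in> I" "\<gamma> 0 = x" using \<gamma> by (auto simp: integral_curve_def)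
  show "flow M X 0 x = x" using flow_integral_curve[OF M X \<gamma> I(2)] I(3) by simp
  have "\<forall>\<^sub>F s in nhds 0. \<gamma> s = flow M X s x"
    using eventually_nhds_in_open[OF I(1,2)] by eventually_elim (simp add: flow_integral_curve[OF M X \<gamma>])
  then show "has_velocity M (\<lambda>t. flow M X t x) 0 (X x)"
    using has_velocity_cong[OF integral_curve_velocity[OF \<gamma> I(2)]] I(3) by simp
qed

section \<open>Canonical lifts\<close>

text \<open>The functor acts on genuine manifolds, so the separation axioms of the open submanifold
  are a hypothesis. For flow domains they come with the morphism clause of
  \<open>canonical_lift\<close>.\<close>

lemma Mf_morphism_inclusion:
  assumes M: "is_manifold M" and U: "openin (mtopology M) U" and MU: "is_manifold (open_submanifold M U)"
  shows "Mf_morphism (open_submanifold M U) M (\<lambda>x. x)"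
proof -
  note PM = is_manifold_premanifold[OF M]
  note PU = premanifold_open[OF PM, of U]
  note pts = points_open[OF PM U]
  have sub: "open_submanifold (open_submanifold M U) U = open_submanifold M U"
    by (auto simp: open_submanifold_def)
  have "smooth_map (open_submanifold M U) (open_submanifold M U) (inv_into U (\<lambda>x. x))"
    by (rule smooth_map_cong[OF PU _ smooth_map_ident[OF PU]])
      (metis (full_types) pts f_inv_into_f image_ident)
  then have "diffeomorphism (open_submanifold (open_submanifold M U) U) (open_submanifold M ((\<lambda>x. x) ` U)) (\<lambda>x. x)"
    using smooth_map_ident[OF PU] by (simp add: diffeomorphism_def sub pts bij_betw_def)
  moreover have "openin (mtopology (open_submanifold M U)) U"
    using openin_points[OF PU] by (simp add: pts)
  ultimately have "local_diffeomorphism (open_submanifold M U) M (\<lambda>x. x)"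
    unfolding local_diffeomorphism_def pts
    using smooth_map_inclusion[OF PM U] U by (intro conjI ballI exI[of _ U]) auto
  then show ?thesis using M MU by (simp add: Mf_morphism_def)
qed

text \<open>Each \<open>arr\<close> covers its base map. Projecting the flow equation of the lift
  therefore turns both lifted inclusions into identities and leaves the flow of
  \<open>X\<close>.\<close>

lemma canonical_lift_flow:
  assumes F: "natural_bundle F" and M: "is_manifold M" and lift: "canonical_lift F M X Y"
    and y: "y \<in> points (obj F M)" and t: "y \<in> flow_domain (obj F M) Y t"
  shows "proj F M (flow (obj F M) Y t y) = flow M X t (proj F M y)"
proof -
  define U where "U s = flow_domain M X s" for s
  define MU where "MU s = open_submanifold M (U s)" for s
  define F\<iota> where "F\<iota> s = arr F (MU s) M (\<lambda>x. x)" for s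
  have L: "openin (mtopology M) (U s)" "Mf_morphism (MU s) (MU (- s)) (flow M X s)"
    "flow_domain (obj F M) Y s = F\<iota> s ` points (obj F (MU s))"
    "\<And>z. z \<in> points (obj F (MU s)) \<Longrightarrow>
      flow (obj F M) Y s (F\<iota> s z) = F\<iota> (- s) (arr F (MU s) (MU (- s)) (flow M X s) z)" for s
    using lift unfolding canonical_lift_def Let_def U_def MU_def F\<iota>_def by blast+
  have incl: "Mf_morphism (MU s) M (\<lambda>x. x)" for s
    unfolding MU_def by (rule Mf_morphism_inclusion[OF M L(1)]) (use L(2)[of s] in \<open>simp add: Mf_morphism_def MU_def\<close>)
  have "\<forall>M M' f. Mf_morphism M M' f \<longrightarrow>
      (\<forall>y\<in>points (obj F M). proj F M' (arr F M M' f y) = f (proj F M y)) \<and>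
      (\<forall>x\<in>points M. diffeomorphism (fiber_manifold (obj F M) M (proj F M) x)
         (fiber_manifold (obj F M') M' (proj F M') (f x)) (arr F M M' f))"
    using F unfolding natural_bundle_def by (elim conjE)
  then have proj: "proj F M'' (arr F M' M'' f z) = f (proj F M' z)"
    if "Mf_morphism M' M'' f" "z \<in> points (obj F M')" for M' M'' f z
    using that by blast
  have "\<forall>M M' f. Mf_morphism M M' f \<longrightarrow> smooth_map (obj F M) (obj F M') (arr F M M' f)"
    using F unfolding natural_bundle_def by (elim conjE)
  then have sm: "smooth_map (obj F M') (obj F M'') (arr F M' M'' f)" if "Mf_morphism M' M'' f" for M' M'' f
    using that by blast
  from t obtain z where z: "z \<in> points (obj F (MU t))" "y = F\<iota> t z" unfolding L(3) by blast
  let ?z = "arr F (MU t) (MU (- t)) (flow M X t) z"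
  have z': "?z \<in> points (obj F (MU (- t)))" by (rule smooth_map_points[OF sm[OF L(2)] z(1)])
  have "proj F M (flow (obj F M) Y t y) = proj F M (F\<iota> (- t) ?z)" unfolding z(2) L(4)[OF z(1)] ..
  also have "\<dots> = proj F (MU (- t)) ?z" unfolding F\<iota>_def by (rule proj[OF incl z'])
  also have "\<dots> = flow M X t (proj F (MU t) z)" by (rule proj[OF L(2) z(1)])
  also have "proj F (MU t) z = proj F M y" unfolding z(2) F\<iota>_def by (rule proj[OF incl z(1), symmetric])
  finally show ?thesis .
qed

lemma natural_bundle_manifold:
  assumes "natural_bundle F" "is_manifold M"
  shows "is_manifold (obj F M)" "smooth_map (obj F M) M (proj F M)"
proof -
  have "\<forall>M. is_manifold M \<longrightarrow> fiber_bundle (obj F M) M (proj F M)"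
    using assms(1) unfolding natural_bundle_def by (elim conjE)
  then have "fiber_bundle (obj F M) M (proj F M)" using assms(2) by blast
  then show "is_manifold (obj F M)" "smooth_map (obj F M) M (proj F M)"
    by (simp_all add: fiber_bundle_def)
qed

text \<open>Near time 0 the flow line of the lift lies over the flow line of \<open>X\<close>, so
  that both have the same velocity in the base. This is half of the verticality required by the
  Darboux-Lie derivative.\<close>

lemma canonical_lift_velocity:
  assumes F: "natural_bundle F" and M: "is_manifold M" and X: "vector_field M X"
    and lift: "canonical_lift F M X Y" and y: "y \<in> points (obj F M)"
  shows "has_velocity M (\<lambda>t. proj F M (flow (obj F M) Y t y)) 0 (X (proj F M y))"
proof -
  note E = natural_bundle_manifold[OF F M]
  have Y: "vector_field (obj F M) Y" using lift by (simp add: canonical_lift_def)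
  obtain I \<gamma> where \<gamma>: "integral_curve (obj F M) Y y I \<gamma>"
    using integral_curve_exists[OF is_manifold_premanifold[OF E(1)] Y y] by blast
  have I: "open I" "0 \<in> I" using \<gamma> by (auto simp: integral_curve_def)
  have "\<forall>\<^sub>F t in nhds 0. flow M X t (proj F M y) = proj F M (flow (obj F M) Y t y)"
    using eventually_nhds_in_open[OF I]
  proof eventually_elim
    case (elim t)
    then have "y \<in> flow_domain (obj F M) Y t" using y \<gamma> unfolding flow_domain_def by blast
    from canonical_lift_flow[OF F M lift y this] show ?case by simp
  qed
  then show ?thesis
    by (rule has_velocity_cong[OF flow_velocity(2)[OF M X smooth_map_points[OF E(2) y]]])
qed

section \<open>Principal bundles\<close>

locale principal_action =
  fixes G :: "('g, 'x) monoid_scheme" and GM :: "('g, 'h::real_normed_vector) manifold"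
    and M :: "('m, 'e::real_normed_vector) manifold"
    and P :: "('p, 'q::real_normed_vector, 'm, 'g) principal"
  assumes lie: "lie_group G GM" and principal: "principal_bundle G GM M P"
begin

abbreviation "T \<equiv> points (total P)"
abbreviation "\<pi> \<equiv> pproj P"

lemma group_G: "group G"
  using lie by (simp add: lie_group_def)

sublocale group G by (rule group_G)

lemma premanifolds: "premanifold GM" "premanifold M" "premanifold (total P)"
  using lie principal is_manifold_premanifold by (auto simp: lie_group_def principal_bundle_def)

lemma manifold_total: "is_manifold (total P)"
  using principal by (simp add: principal_bundle_def)

lemma points_G: "points GM = carrier G"
  using lie by (simp add: lie_group_def)

lemma smooth_mult: "smooth_map (prod_manifold GM GM) GM (\<lambda>z. fst z \<otimes>\<^bsub>G\<^esub> snd z)"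
  and smooth_inv: "smooth_map GM GM (\<lambda>g. inv\<^bsub>G\<^esub> g)"
  using lie by (simp_all add: lie_group_def case_prod_unfold)

lemma smooth_proj: "smooth_map (total P) M \<pi>"
  and smooth_ract_prod: "smooth_map (prod_manifold (total P) GM) (total P) (\<lambda>z. ract P (fst z) (snd z))"
  using principal by (simp_all add: principal_bundle_def case_prod_unfold)

lemma ract_one: "p \<in> T \<Longrightarrow> ract P p \<one>\<^bsub>G\<^esub> = p"
  and ract_mult: "p \<in> T \<Longrightarrow> g \<in> carrier G \<Longrightarrow> h \<in> carrier G \<Longrightarrow>
    ract P (ract P p g) h = ract P p (g \<otimes>\<^bsub>G\<^esub> h)"
  and proj_ract: "p \<in> T \<Longrightarrow> g \<in> carrier G \<Longrightarrow> \<pi> (ract P p g) = \<pi> p"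
  using principal unfolding principal_bundle_def by blast+

lemma proj_points: "p \<in> T \<Longrightarrow> \<pi> p \<in> points M"
  by (rule smooth_map_points[OF smooth_proj])

lemma smooth_map_ract:
  assumes Q: "premanifold Q" and \<sigma>: "smooth_map Q (total P) \<sigma>" and g: "smooth_map Q GM g"
  shows "smooth_map Q (total P) (\<lambda>x. ract P (\<sigma> x) (g x))"
  using smooth_map_compose[OF Q premanifold_prod[OF premanifolds(3,1)] premanifolds(3)
      smooth_map_Pair[OF Q premanifolds(3,1) \<sigma> g] smooth_ract_prod] by simp

lemma ract_points: "p \<in> T \<Longrightarrow> g \<in> carrier G \<Longrightarrow> ract P p g \<in> T"
  using smooth_map_points[OF smooth_ract_prod, of "(p, g)"]
  by (simp add: points_prod[OF premanifolds(3,1)] points_G)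

lemma smooth_right_translation: "g \<in> carrier G \<Longrightarrow> smooth_map (total P) (total P) (\<lambda>p. ract P p g)"
  by (intro smooth_map_ract premanifolds smooth_map_ident smooth_map_const) (simp add: points_G)

definition trivializes :: "'m set \<Rightarrow> ('p \<Rightarrow> 'm \<times> 'g) \<Rightarrow> bool"
  where "trivializes U \<Psi> \<longleftrightarrow> local_trivialization (total P) M \<pi> GM U \<Psi> \<and>
    (\<forall>p\<in>T. \<forall>g\<in>carrier G. \<pi> p \<in> U \<longrightarrow> \<Psi> (ract P p g) = (\<pi> p, snd (\<Psi> p) \<otimes>\<^bsub>G\<^esub> g))"

lemma trivialization: "x \<in> points M \<Longrightarrow> \<exists>U \<Psi>. x \<in> U \<and> trivializes U \<Psi>"
  using principal unfolding principal_bundle_def trivializes_def by simp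

lemma trivializesD:
  assumes "trivializes U \<Psi>"
  shows "openin (mtopology M) U"
    and "openin (mtopology (total P)) {p \<in> T. \<pi> p \<in> U}"
    and "bij_betw \<Psi> {p \<in> T. \<pi> p \<in> U} (U \<times> carrier G)"
    and "smooth_map (open_submanifold (total P) {p \<in> T. \<pi> p \<in> U}) (prod_manifold (open_submanifold M U) GM) \<Psi>"
    and "smooth_map (prod_manifold (open_submanifold M U) GM) (open_submanifold (total P) {p \<in> T. \<pi> p \<in> U})
      (inv_into {p \<in> T. \<pi> p \<in> U} \<Psi>)"
    and "\<And>p. p \<in> T \<Longrightarrow> \<pi> p \<in> U \<Longrightarrow> fst (\<Psi> p) = \<pi> p"
    and "\<And>p g. p \<in> T \<Longrightarrow> g \<in> carrier G \<Longrightarrow> \<pi> p \<in> U \<Longrightarrow> \<Psi> (ract P p g) = (\<pi> p, snd (\<Psi> p) \<otimes>\<^bsub>G\<^esub> g)"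
    and "\<And>p. p \<in> T \<Longrightarrow> \<pi> p \<in> U \<Longrightarrow> snd (\<Psi> p) \<in> carrier G"
proof -
  note lt = assms[unfolded trivializes_def local_trivialization_def diffeomorphism_def]
  show U: "openin (mtopology M) U" using lt by blast
  show V: "openin (mtopology (total P)) {p \<in> T. \<pi> p \<in> U}"
    by (rule smooth_map_open_preimage[OF premanifolds(3,2) smooth_proj U])
  have pts: "points (open_submanifold (total P) {p \<in> T. \<pi> p \<in> U}) = {p \<in> T. \<pi> p \<in> U}"
    by (rule points_open[OF premanifolds(3) V])
  have pts': "points (prod_manifold (open_submanifold M U) GM) = U \<times> carrier G"
    unfolding points_prod[OF premanifold_open[OF premanifolds(2)] premanifolds(1)]
      points_open[OF premanifolds(2) U] points_G ..
  show bij: "bij_betw \<Psi> {p \<in> T. \<pi> p \<in> U} (U \<times> carrier G)" using lt unfolding pts pts' by blast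
  show "smooth_map (open_submanifold (total P) {p \<in> T. \<pi> p \<in> U}) (prod_manifold (open_submanifold M U) GM) \<Psi>"
    using lt by blast
  show "smooth_map (prod_manifold (open_submanifold M U) GM) (open_submanifold (total P) {p \<in> T. \<pi> p \<in> U})
      (inv_into {p \<in> T. \<pi> p \<in> U} \<Psi>)" using lt unfolding pts by blast
  show "fst (\<Psi> p) = \<pi> p" if "p \<in> T" "\<pi> p \<in> U" for p using lt that by blast
  show "\<Psi> (ract P p g) = (\<pi> p, snd (\<Psi> p) \<otimes>\<^bsub>G\<^esub> g)" if "p \<in> T" "g \<in> carrier G" "\<pi> p \<in> U" for p g
    using lt that by blast
  show "snd (\<Psi> p) \<in> carrier G" if "p \<in> T" "\<pi> p \<in> U" for p
    using bspec[OF bij_betwE[OF bij], of p] that by (simp add: mem_Times_iff)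
qed

text \<open>Freeness comes from the group component of an equivariant trivialization, where right
  multiplication can be cancelled.\<close>

lemma ract_free:
  assumes "p \<in> T" "g \<in> carrier G" "ract P p g = p"
  shows "g = \<one>\<^bsub>G\<^esub>"
proof -
  obtain U \<Psi> where U: "\<pi> p \<in> U" "trivializes U \<Psi>" using trivialization[OF proj_points[OF assms(1)]] by blast
  note tr = trivializesD[OF U(2)]
  have "snd (\<Psi> p) = snd (\<Psi> p) \<otimes>\<^bsub>G\<^esub> g"
    using arg_cong[OF tr(7)[OF assms(1,2) U(1)], of snd] assms(3) by simp
  then show ?thesis using tr(8)[OF assms(1) U(1)] assms(2) by (metis l_cancel_one)
qed

lemma ract_inject:
  assumes "p \<in> T" "g \<in> carrier G" "h \<in> carrier G" "ract P p g = ract P p h"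
  shows "g = h"
proof -
  have "ract P p (g \<otimes>\<^bsub>G\<^esub> inv\<^bsub>G\<^esub> h) = ract P (ract P p h) (inv\<^bsub>G\<^esub> h)"
    using assms ract_mult[of p g "inv\<^bsub>G\<^esub> h"] by simp
  also have "\<dots> = p" using assms by (simp add: ract_mult ract_one)
  finally have "g \<otimes>\<^bsub>G\<^esub> inv\<^bsub>G\<^esub> h = \<one>\<^bsub>G\<^esub>" using assms by (intro ract_free) auto
  then show ?thesis using assms by (metis inv_equality inv_inv inv_closed)
qed

text \<open>Transitivity on fibres: the indicated element carries the group component of
  \<open>p\<close> to that of \<open>q\<close>, and \<Psi> is injective.\<close>

lemma ract_trivialization:
  assumes tr: "trivializes U \<Psi>" and p: "p \<in> T" "q \<in> T" and eq: "\<pi> p = \<pi> q" "\<pi> p \<in> U"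
  shows "q = ract P p (inv\<^bsub>G\<^esub> (snd (\<Psi> p)) \<otimes>\<^bsub>G\<^esub> snd (\<Psi> q))"
proof -
  note D = trivializesD[OF tr]
  let ?g = "inv\<^bsub>G\<^esub> (snd (\<Psi> p)) \<otimes>\<^bsub>G\<^esub> snd (\<Psi> q)"
  have c: "snd (\<Psi> p) \<in> carrier G" "snd (\<Psi> q) \<in> carrier G" using D(8) p eq by auto
  then have g: "?g \<in> carrier G" by auto
  have "\<Psi> (ract P p ?g) = \<Psi> q"
    using D(7)[OF p(1) g eq(2)] D(6)[OF p(2)] eq c by (metis m_assoc inv_closed r_inv l_one prod.collapse)
  then show ?thesis
    using D(3) p eq ract_points[OF p(1) g] proj_ract[OF p(1) g]
    by (auto simp: bij_betw_def dest: inj_onD)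
qed

text \<open>The difference map of a principal bundle, meaningful for two points of one
  fibre.\<close>

definition division :: "'p \<Rightarrow> 'p \<Rightarrow> 'g"
  where "division p q = (THE g. g \<in> carrier G \<and> ract P p g = q)"

lemma division_ract: "p \<in> T \<Longrightarrow> g \<in> carrier G \<Longrightarrow> division p (ract P p g) = g"
  unfolding division_def by (rule the_equality) (use ract_inject in auto)

lemma division_trivialization:
  assumes tr: "trivializes U \<Psi>" and p: "p \<in> T" "q \<in> T" and eq: "\<pi> p = \<pi> q" "\<pi> p \<in> U"
  shows "division p q = inv\<^bsub>G\<^esub> (snd (\<Psi> p)) \<otimes>\<^bsub>G\<^esub> snd (\<Psi> q)"
  using division_ract[OF p(1)] ract_trivialization[OF assms] trivializesD(8)[OF tr] p eq
  by (metis inv_closed m_closed)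

lemma division:
  assumes p: "p \<in> T" "q \<in> T" and eq: "\<pi> p = \<pi> q"
  shows "division p q \<in> carrier G" "ract P p (division p q) = q"
proof -
  obtain U \<Psi> where U: "\<pi> p \<in> U" "trivializes U \<Psi>" using trivialization[OF proj_points[OF p(1)]] by blast
  show "division p q \<in> carrier G"
    using division_trivialization[OF U(2) p eq U(1)] trivializesD(8)[OF U(2)] p eq U(1) by simp
  show "ract P p (division p q) = q"
    using division_trivialization[OF U(2) p eq U(1)] ract_trivialization[OF U(2) p eq U(1)] by simp
qed

text \<open>Over a trivializing set \<open>division_trivialization\<close> expresses the difference
  through smooth maps. Formulating it for two maps with the same projection avoids a manifold
  structure on the fibre product of \<open>P\<close> with itself.\<close>

lemma smooth_division:
  assumes Q: "premanifold Q" and \<sigma>: "smooth_map Q (total P) \<sigma>" and \<tau>: "smooth_map Q (total P) \<tau>"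
    and eq: "\<And>x. x \<in> points Q \<Longrightarrow> \<pi> (\<sigma> x) = \<pi> (\<tau> x)"
  shows "smooth_map Q GM (\<lambda>x. division (\<sigma> x) (\<tau> x))"
proof (rule smooth_map_local[OF Q])
  fix x assume x: "x \<in> points Q"
  obtain U \<Psi> where U: "\<pi> (\<sigma> x) \<in> U" "trivializes U \<Psi>"
    using trivialization[OF proj_points[OF smooth_map_points[OF \<sigma> x]]] by blast
  note D = trivializesD[OF U(2)]
  let ?T = "{p \<in> T. \<pi> p \<in> U}" and ?V = "{x \<in> points Q. \<pi> (\<sigma> x) \<in> U}"
  have V: "openin (mtopology Q) ?V"
    by (rule smooth_map_open_preimage[OF Q premanifolds(2) smooth_map_compose[OF Q premanifolds(3,2) \<sigma> smooth_proj] D(1)])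
  let ?Q = "open_submanifold Q ?V"
  note Q' = premanifold_open[OF Q, of ?V]
  note pts = points_open[OF Q V]
  note UG = premanifold_prod[OF premanifold_open[OF premanifolds(2), of U] premanifolds(1)]
  have sm: "smooth_map ?Q GM (\<lambda>x. snd (\<Psi> (\<upsilon> x)))"
    if \<upsilon>: "smooth_map Q (total P) \<upsilon>" and "\<And>x. x \<in> ?V \<Longrightarrow> \<pi> (\<upsilon> x) \<in> U" for \<upsilon>
  proof -
    have "smooth_map ?Q (open_submanifold (total P) ?T) \<upsilon>"
      by (rule smooth_map_into_open[OF Q' premanifolds(3) smooth_map_restrict[OF Q premanifolds(3) \<upsilon> V] D(2)])
        (use that smooth_map_points[OF \<upsilon>] in \<open>auto simp: pts\<close>)
    from smooth_map_compose[OF Q' premanifold_open[OF premanifolds(3)] UG this D(4)]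
    have "smooth_map ?Q (prod_manifold (open_submanifold M U) GM) (\<lambda>x. \<Psi> (\<upsilon> x))" .
    from smooth_map_compose[OF Q' UG premanifolds(1) this smooth_map_snd[OF premanifold_open[OF premanifolds(2)] premanifolds(1)]]
    show ?thesis .
  qed
  have 1: "smooth_map ?Q GM (\<lambda>x. snd (\<Psi> (\<sigma> x)))" by (rule sm[OF \<sigma>]) auto
  have 2: "smooth_map ?Q GM (\<lambda>x. snd (\<Psi> (\<tau> x)))" by (rule sm[OF \<tau>]) (auto simp: eq[symmetric])
  note i = smooth_map_compose[OF Q' premanifolds(1) premanifolds(1) 1 smooth_inv]
  have "smooth_map ?Q GM (\<lambda>x. inv\<^bsub>G\<^esub> (snd (\<Psi> (\<sigma> x))) \<otimes>\<^bsub>G\<^esub> snd (\<Psi> (\<tau> x)))"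
    using smooth_map_compose[OF Q' premanifold_prod[OF premanifolds(1,1)] premanifolds(1)
        smooth_map_Pair[OF Q' premanifolds(1,1) i 2] smooth_mult] by simp
  then have "smooth_map ?Q GM (\<lambda>x. division (\<sigma> x) (\<tau> x))"
    by (rule smooth_map_cong[OF Q', rotated])
      (use division_trivialization[OF U(2)] smooth_map_points[OF \<sigma>] smooth_map_points[OF \<tau>] eq in \<open>auto simp: pts\<close>)
  then show "\<exists>U. openin (mtopology Q) U \<and> x \<in> U \<and> smooth_map (open_submanifold Q U) GM (\<lambda>x. division (\<sigma> x) (\<tau> x))"
    using V x U(1) by (intro exI[of _ ?V]) auto
qed

definition section_on :: "('m, 'e) chart \<Rightarrow> ('m \<Rightarrow> 'p) \<Rightarrow> bool"
  where "section_on c s \<longleftrightarrow> smooth_map (open_submanifold M (fst c)) (total P) s \<and> (\<forall>x\<in>fst c. \<pi> (s x) = x)"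

lemma section_onD:
  assumes "section_on c s" "c \<in> M" "x \<in> fst c"
  shows "s x \<in> T" "\<pi> (s x) = x"
proof -
  have "x \<in> points (open_submanifold M (fst c))"
    using assms(2,3) chart_openin points_open premanifolds(2) by blast
  moreover have "smooth_map (open_submanifold M (fst c)) (total P) s" using assms(1) by (simp add: section_on_def)
  ultimately show "s x \<in> T" by (rule smooth_map_points[rotated])
  show "\<pi> (s x) = x" using assms by (simp add: section_on_def)
qed

text \<open>The section with constant group component in a trivialization. Passing through
  \<open>p\<close> itself, it yields charts of the associated bundle in which a class [p, z] has the
  fibre coordinates of \<open>z\<close>.\<close>

lemma section_through:
  assumes p: "p \<in> T"
  shows "\<exists>c\<in>M. \<exists>s. \<pi> p \<in> fst c \<and> section_on c s \<and> s (\<pi> p) = p"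
proof -
  obtain U \<Psi> where U: "\<pi> p \<in> U" "trivializes U \<Psi>" using trivialization[OF proj_points[OF p]] by blast
  note D = trivializesD[OF U(2)]
  let ?T = "{p \<in> T. \<pi> p \<in> U}"
  let ?U = "open_submanifold M U"
  note U' = premanifold_open[OF premanifolds(2), of U]
  define s where "s x = inv_into ?T \<Psi> (x, snd (\<Psi> p))" for x
  have g: "snd (\<Psi> p) \<in> carrier G" by (rule D(8)[OF p U(1)])
  have "smooth_map ?U (prod_manifold ?U GM) (\<lambda>x. (x, snd (\<Psi> p)))"
    using g by (intro smooth_map_Pair smooth_map_ident smooth_map_const U' premanifolds) (simp add: points_G)
  from smooth_map_compose[OF U' premanifold_prod[OF U' premanifolds(1)] premanifold_open[OF premanifolds(3)] this D(5)]
  have "smooth_map ?U (open_submanifold (total P) ?T) s" by (simp add: s_def[abs_def])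
  from smooth_map_compose[OF U' premanifold_open[OF premanifolds(3)] premanifolds(3) this
      smooth_map_inclusion[OF premanifolds(3) D(2)]]
  have sU: "smooth_map ?U (total P) s" .
  obtain c where c: "c \<in> M" "\<pi> p \<in> fst c" "fst c \<subseteq> U" using chart_at_in_open[OF premanifolds(2) D(1) U(1)] by blast
  have cU: "c \<in> ?U" using c by (simp add: open_submanifold_def)
  have "open_submanifold ?U (fst c) = open_submanifold M (fst c)" using c(3) by (auto simp: open_submanifold_def)
  then have "smooth_map (open_submanifold M (fst c)) (total P) s"
    using smooth_map_restrict[OF U' premanifolds(3) sU chart_openin[OF U' cU]] by simp
  moreover have "\<pi> (s x) = x" if "x \<in> fst c" for x
  proof -
    have "(x, snd (\<Psi> p)) \<in> \<Psi> ` ?T" using that c(3) g D(3) by (auto simp: bij_betw_def)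
    then have "s x \<in> ?T" "\<Psi> (s x) = (x, snd (\<Psi> p))"
      unfolding s_def by (rule inv_into_into, rule f_inv_into_f)
    then show ?thesis using D(6)[of "s x"] by simp
  qed
  moreover have "s (\<pi> p) = p"
  proof -
    have "(\<pi> p, snd (\<Psi> p)) = \<Psi> p" using D(6)[OF p U(1)] by (metis prod.collapse)
    then show ?thesis unfolding s_def using D(3) p U(1) by (simp add: bij_betw_def inv_into_f_f)
  qed
  ultimately show ?thesis using c unfolding section_on_def by blast
qed

end

section \<open>Classes in associated bundles\<close>

text \<open>Only the laws of an action on a set are required, so that facts about classes hold alike
  for fibres, for G-modules and for \<open>hom_action\<close>.\<close>

locale principal_set_action = principal_action G GM M P
  for G :: "('g, 'x) monoid_scheme" and GM :: "('g, 'h::real_normed_vector) manifold"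
    and M :: "('m, 'e::real_normed_vector) manifold"
    and P :: "('p, 'q::real_normed_vector, 'm, 'g) principal" +
  fixes S :: "'n set" and a :: "'g \<Rightarrow> 'n \<Rightarrow> 'n"
  assumes act_closed: "g \<in> carrier G \<Longrightarrow> z \<in> S \<Longrightarrow> a g z \<in> S"
    and act_one: "z \<in> S \<Longrightarrow> a \<one>\<^bsub>G\<^esub> z = z"
    and act_mult: "g \<in> carrier G \<Longrightarrow> k \<in> carrier G \<Longrightarrow> z \<in> S \<Longrightarrow> a g (a k z) = a (g \<otimes>\<^bsub>G\<^esub> k) z"
begin

abbreviation "cl \<equiv> assoc_class G P a"

text \<open>Reparametrize the orbit by left multiplication with \<open>g\<close>.\<close>

lemma class_ract:
  assumes p: "p \<in> T" and g: "g \<in> carrier G" and z: "z \<in> S"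
  shows "cl (ract P p g) z = cl p (a g z)"
proof (intro subset_antisym subsetI)
  fix \<xi> assume "\<xi> \<in> cl (ract P p g) z"
  then obtain k where k: "k \<in> carrier G" "\<xi> = (ract P (ract P p g) k, a (inv\<^bsub>G\<^esub> k) z)"
    by (auto simp: assoc_class_def)
  have "a (inv\<^bsub>G\<^esub> (g \<otimes>\<^bsub>G\<^esub> k)) (a g z) = a (inv\<^bsub>G\<^esub> k) z"
    using g k z by (simp add: act_mult inv_mult_group m_assoc)
  then have "\<xi> = (ract P p (g \<otimes>\<^bsub>G\<^esub> k), a (inv\<^bsub>G\<^esub> (g \<otimes>\<^bsub>G\<^esub> k)) (a g z))"
    using k g p by (simp add: ract_mult)
  then show "\<xi> \<in> cl p (a g z)" using k(1) g unfolding assoc_class_def by blast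
next
  fix \<xi> assume "\<xi> \<in> cl p (a g z)"
  then obtain k where k: "k \<in> carrier G" "\<xi> = (ract P p k, a (inv\<^bsub>G\<^esub> k) (a g z))"
    by (auto simp: assoc_class_def)
  let ?k = "inv\<^bsub>G\<^esub> g \<otimes>\<^bsub>G\<^esub> k"
  have "g \<otimes>\<^bsub>G\<^esub> ?k = k" using g k(1) by (simp flip: m_assoc)
  moreover have "inv\<^bsub>G\<^esub> ?k = inv\<^bsub>G\<^esub> k \<otimes>\<^bsub>G\<^esub> g" using g k(1) by (simp add: inv_mult_group)
  ultimately have "\<xi> = (ract P (ract P p g) ?k, a (inv\<^bsub>G\<^esub> ?k) z)"
    using g k p z by (simp add: ract_mult act_mult)
  then show "\<xi> \<in> cl (ract P p g) z" using g k(1) unfolding assoc_class_def by blast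
qed

lemma class_eqD:
  assumes p: "p \<in> T" "q \<in> T" and z: "z \<in> S" "w \<in> S" and eq: "cl p z = cl q w"
  obtains g where "g \<in> carrier G" "q = ract P p g" "z = a g w"
proof -
  have "(q, w) \<in> cl q w"
    using p z unfolding assoc_class_def
    by (intro CollectI exI[of _ "\<one>\<^bsub>G\<^esub>"]) (simp add: ract_one act_one)
  then have "(q, w) \<in> cl p z" by (simp only: eq)
  then obtain g where g: "g \<in> carrier G" "q = ract P p g" "w = a (inv\<^bsub>G\<^esub> g) z"
    unfolding assoc_class_def by auto
  have "a g w = z" using g z by (simp add: act_mult act_one)
  then show thesis using that g by blast
qed

lemma class_inject:
  assumes "p \<in> T" "z \<in> S" "w \<in> S" "cl p z = cl p w"
  shows "z = w"
  using class_eqD[OF assms(1,1,2,3,4)] ract_free assms act_one by metis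

lemma class_proj:
  assumes "p \<in> T" "q \<in> T" "z \<in> S" "w \<in> S" "cl p z = cl q w"
  shows "\<pi> p = \<pi> q"
  using class_eqD[OF assms] proj_ract assms(1) by metis

lemma class_division:
  assumes "p \<in> T" "q \<in> T" "\<pi> p = \<pi> q" "z \<in> S"
  shows "cl q z = cl p (a (division p q) z)"
  using class_ract[OF assms(1) division(1)[OF assms(1-3)] assms(4)] division(2)[OF assms(1-3)] by simp

end

section \<open>Associated bundles\<close>

lemma smooth_action_act:
  assumes "lie_group G GM" "smooth_action G GM N a"
  shows "g \<in> carrier G \<Longrightarrow> z \<in> points N \<Longrightarrow> a g z \<in> points N"
    and "z \<in> points N \<Longrightarrow> a \<one>\<^bsub>G\<^esub> z = z"
    and "g \<in> carrier G \<Longrightarrow> k \<in> carrier G \<Longrightarrow> z \<in> points N \<Longrightarrow> a g (a k z) = a (g \<otimes>\<^bsub>G\<^esub> k) z"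
proof -
  have act: "group_action G (points N) a" using assms(2) by (simp add: smooth_action_def)
  show "g \<in> carrier G \<Longrightarrow> z \<in> points N \<Longrightarrow> a g z \<in> points N"
    by (rule group_action.element_image[OF act]) auto
  show "z \<in> points N \<Longrightarrow> a \<one>\<^bsub>G\<^esub> z = z"
    using group_action.id_eq_one[OF act] by (metis restrict_apply')
  show "g \<in> carrier G \<Longrightarrow> k \<in> carrier G \<Longrightarrow> z \<in> points N \<Longrightarrow> a g (a k z) = a (g \<otimes>\<^bsub>G\<^esub> k) z"
    using group_action.composition_rule[OF act] by simp
qed

locale assoc_bundle = principal_action G GM M P
  for G :: "('g, 'x) monoid_scheme" and GM :: "('g, 'h::real_normed_vector) manifold"
    and M :: "('m, 'e::real_normed_vector) manifold"
    and P :: "('p, 'q::real_normed_vector, 'm, 'g) principal" +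
  fixes N :: "('n, 'f::real_normed_vector) manifold" and a :: "'g \<Rightarrow> 'n \<Rightarrow> 'n"
  assumes action: "smooth_action G GM N a"
begin

sublocale principal_set_action G GM M P "points N" a
  by unfold_locales (use smooth_action_act[OF lie action] in blast)+

abbreviation "A \<equiv> assoc_manifold G M P N a"

lemma premanifold_N: "premanifold N"
  using action by (simp add: smooth_action_def is_manifold_premanifold)

lemma smooth_action_prod: "smooth_map (prod_manifold GM N) N (\<lambda>z. a (fst z) (snd z))"
  using action by (simp add: smooth_action_def case_prod_unfold)

lemma smooth_map_act:
  assumes Q: "premanifold Q" and g: "smooth_map Q GM g" and \<zeta>: "smooth_map Q N \<zeta>"
  shows "smooth_map Q N (\<lambda>x. a (g x) (\<zeta> x))"
  using smooth_map_compose[OF Q premanifold_prod[OF premanifolds(1) premanifold_N] premanifold_N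
      smooth_map_Pair[OF Q premanifolds(1) premanifold_N g \<zeta>] smooth_action_prod] by simp

lemma smooth_left_translation: "g \<in> carrier G \<Longrightarrow> smooth_map N N (a g)"
  by (intro smooth_map_act[where g = "\<lambda>_. g" and \<zeta> = "\<lambda>x. x"] premanifold_N smooth_map_const smooth_map_ident)
    (simp add: points_G)

section \<open>The charts of the associated bundle and their transition maps\<close>

definition assoc_chart :: "('m, 'e) chart \<Rightarrow> ('n, 'f) chart \<Rightarrow> ('m \<Rightarrow> 'p) \<Rightarrow> (('p \<times> 'n) set, 'e \<times> 'f) chart"
  where "assoc_chart c d s = ({cl (s x) z | x z. x \<in> fst c \<and> z \<in> fst d},
    \<lambda>\<xi>. THE w. \<exists>x\<in>fst c. \<exists>z\<in>fst d. \<xi> = cl (s x) z \<and> w = (snd c x, snd d z))"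

definition assoc_atlas :: "(('p \<times> 'n) set, 'e \<times> 'f) chart set"
  where "assoc_atlas = {assoc_chart c d s | c d s. c \<in> M \<and> d \<in> N \<and> section_on c s}"

lemma A_eq: "A = generated assoc_atlas"
  unfolding assoc_manifold_def assoc_atlas_def assoc_chart_def section_on_def by simp

lemma section_class_eqD:
  assumes s: "section_on c s" "c \<in> M" and x: "x \<in> fst c" "y \<in> fst c" and z: "z \<in> points N" "w \<in> points N"
    and eq: "cl (s x) z = cl (s y) w"
  shows "x = y" "z = w"
proof -
  have "\<pi> (s x) = \<pi> (s y)" using class_proj[OF _ _ z eq] section_onD[OF s] x by blast
  then show "x = y" using section_onD(2)[OF s] x by simp
  then show "z = w" using class_inject[OF _ z] section_onD(1)[OF s] x eq by blast
qed

lemma fst_assoc_chart: "fst (assoc_chart c d s) = (\<lambda>u. cl (s (fst u)) (snd u)) ` (fst c \<times> fst d)"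
  unfolding assoc_chart_def by (auto simp: image_iff) blast+

lemma class_in_assoc_chart: "x \<in> fst c \<Longrightarrow> z \<in> fst d \<Longrightarrow> cl (s x) z \<in> fst (assoc_chart c d s)"
  unfolding assoc_chart_def by auto

lemma snd_assoc_chart:
  assumes s: "section_on c s" "c \<in> M" "d \<in> N" and x: "x \<in> fst c" "z \<in> fst d"
  shows "snd (assoc_chart c d s) (cl (s x) z) = (snd c x, snd d z)"
  unfolding assoc_chart_def snd_conv
proof (rule the_equality)
  show "\<exists>x'\<in>fst c. \<exists>z'\<in>fst d. cl (s x) z = cl (s x') z' \<and> (snd c x, snd d z) = (snd c x', snd d z')"
    using x by blast
  fix w assume "\<exists>x'\<in>fst c. \<exists>z'\<in>fst d. cl (s x) z = cl (s x') z' \<and> w = (snd c x', snd d z')"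
  then obtain x' z' where *: "x' \<in> fst c" "z' \<in> fst d" "cl (s x) z = cl (s x') z'" "w = (snd c x', snd d z')" by blast
  then have "x = x'" "z = z'"
    using section_class_eqD[OF s(1,2) x(1) *(1) _ _ *(3)] chart_points[OF s(3)] x(2) by blast+
  then show "w = (snd c x, snd d z)" using *(4) by simp
qed

lemma is_chart_assoc_chart:
  assumes s: "section_on c s" "c \<in> M" "d \<in> N"
  shows "is_chart (assoc_chart c d s)"
  unfolding is_chart_def
proof
  note ch = premanifold_chart[OF premanifolds(2) s(2)] premanifold_chart[OF premanifold_N s(3)]
  show "inj_on (snd (assoc_chart c d s)) (fst (assoc_chart c d s))"
  proof (rule inj_onI)
    fix \<xi> \<eta> assume "\<xi> \<in> fst (assoc_chart c d s)" "\<eta> \<in> fst (assoc_chart c d s)"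
      and eq: "snd (assoc_chart c d s) \<xi> = snd (assoc_chart c d s) \<eta>"
    then obtain x z y w where *: "x \<in> fst c" "z \<in> fst d" "y \<in> fst c" "w \<in> fst d" "\<xi> = cl (s x) z" "\<eta> = cl (s y) w"
      unfolding fst_assoc_chart by auto
    then have "snd c x = snd c y" "snd d z = snd d w" using eq by (simp_all add: snd_assoc_chart[OF s])
    then have "x = y" "z = w" using * ch by (auto simp: is_chart_def dest: inj_onD)
    then show "\<xi> = \<eta>" using * by simp
  qed
  have "snd (assoc_chart c d s) ` fst (assoc_chart c d s) = snd c ` fst c \<times> snd d ` fst d"
    unfolding fst_assoc_chart image_image
    by (auto simp: snd_assoc_chart[OF s] image_iff)
  then show "open (snd (assoc_chart c d s) ` fst (assoc_chart c d s))"
    using ch by (simp add: is_chart_def open_Times)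
qed

lemma assoc_chart_inv:
  assumes s: "section_on c s" "c \<in> M" "d \<in> N" and x: "x \<in> fst c" "z \<in> fst d"
  shows "chart_inv (assoc_chart c d s) (snd c x, snd d z) = cl (s x) z"
  using chart_inv_chart[OF is_chart_assoc_chart[OF s] class_in_assoc_chart[where s = s, OF x]] by (simp add: snd_assoc_chart[OF s x])

text \<open>If \<open>g x\<close> carries \<open>s' x\<close> to \<open>s x\<close>, then [s x, z] =
  [s' x, g(x) z]. The change of charts is thus the coordinate form of (x, z) \<mapsto> (x, g(x) z),
  which is smooth because \<open>division\<close> is.\<close>

lemma assoc_chart_transition:
  assumes s: "section_on c s" "c \<in> M" "d \<in> N" and s': "section_on c' s'" "c' \<in> M" "d' \<in> N"
  shows "smooth_transition (assoc_chart c d s) (assoc_chart c' d' s')"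
proof -
  let ?K = "assoc_chart c d s" and ?K' = "assoc_chart c' d' s'"
  let ?V = "fst c \<inter> fst c'"
  let ?Q = "open_submanifold M ?V"
  note pm = premanifolds premanifold_N
  note ch = premanifold_chart[OF pm(2) s(2)] premanifold_chart[OF pm(2) s'(2)]
  note chd = premanifold_chart[OF pm(4) s(3)] premanifold_chart[OF pm(4) s'(3)]
  note Q = premanifold_open[OF pm(2), of ?V]
  have V: "openin (mtopology M) ?V" using chart_openin[OF pm(2)] s(2) s'(2) by blast
  note pts = points_open[OF pm(2) V]
  have sub: "smooth_map ?Q (total P) s" if "section_on e s" "e \<in> M" "?V \<subseteq> fst e" for e s
  proof (rule smooth_map_compose[OF Q premanifold_open[OF pm(2)] pm(3)])
    show "smooth_map ?Q (open_submanifold M (fst e)) (\<lambda>x. x)"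
      using that by (intro smooth_map_into_open[OF Q pm(2) smooth_map_inclusion[OF pm(2) V] chart_openin[OF pm(2)]])
        (auto simp: pts)
    show "smooth_map (open_submanifold M (fst e)) (total P) s" using that(1) by (simp add: section_on_def)
  qed
  define g where "g x = division (s' x) (s x)" for x
  have g: "smooth_map ?Q GM g" unfolding g_def
    by (rule smooth_division[OF Q sub[OF s'(1,2)] sub[OF s(1,2)]])
      (use section_onD[OF s'(1,2)] section_onD[OF s(1,2)] in \<open>auto simp: pts\<close>)
  have gV: "g x \<in> carrier G" "cl (s x) z = cl (s' x) (a (g x) z)" if "x \<in> ?V" "z \<in> points N" for x z
    unfolding g_def
    using division(1) class_division section_onD[OF s(1,2)] section_onD[OF s'(1,2)] that by auto
  define \<kappa> where "\<kappa> u = (fst u, a (g (fst u)) (snd u))" for u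
  note QN = premanifold_prod[OF Q pm(4)]
  have \<kappa>: "smooth_map (prod_manifold ?Q N) (prod_manifold M N) \<kappa>"
    unfolding \<kappa>_def
    by (intro smooth_map_Pair smooth_map_act QN pm smooth_map_snd Q smooth_map_compose[OF QN Q pm(2) smooth_map_fst[OF Q pm(4)]]
        smooth_map_compose[OF QN Q pm(1) smooth_map_fst[OF Q pm(4)]] g smooth_map_inclusion[OF pm(2) V])
  let ?c = "(?V, snd c)"
  have cV: "open (snd c ` ?V)" by (rule compatible_open[OF premanifold_compatible[OF pm(2) s(2) s'(2)]])
  have cQ: "?c \<in> ?Q" using premanifold_restrict[OF pm(2) s(2) _ cV] by (simp add: open_submanifold_def)
  let ?C = "prod_chart ?c d" and ?C' = "prod_chart c' d'"
  note inC = smooth_map_in_charts[OF QN premanifold_prod[OF pm(2,4)] \<kappa> prod_chart_in[OF Q pm(4) cQ s(3)] prod_chart_in[OF pm(2,4) s'(2,3)]]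
  let ?W = "{w \<in> fst ?C. \<kappa> w \<in> fst ?C'}"
  \<comment> \<open>The overlap of the two charts, seen in product coordinates, is the set that
    \<kappa> maps into the second product chart; equal classes have equal base points and, in a
    fixed frame, equal fibre points.\<close>
  have img: "snd ?K ` (fst ?K \<inter> fst ?K') = snd ?C ` ?W"
  proof (intro subset_antisym subsetI)
    fix u assume "u \<in> snd ?K ` (fst ?K \<inter> fst ?K')"
    then obtain x z x' z' where *: "x \<in> fst c" "z \<in> fst d" "x' \<in> fst c'" "z' \<in> fst d'"
      "cl (s x) z = cl (s' x') z'" "u = snd ?K (cl (s x) z)"
      unfolding fst_assoc_chart by auto
    have zN: "z \<in> points N" "z' \<in> points N" using * chart_points[OF s(3)] chart_points[OF s'(3)] by blast+
    have "\<pi> (s x) = \<pi> (s' x')" using class_proj[OF _ _ zN *(5)] section_onD(1)[OF s(1,2) *(1)] section_onD(1)[OF s'(1,2) *(3)] by blast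
    then have xx: "x' = x" using section_onD(2)[OF s(1,2) *(1)] section_onD(2)[OF s'(1,2) *(3)] by simp
    have xV: "x \<in> ?V" using * xx by simp
    have "cl (s' x) (a (g x) z) = cl (s' x) z'" using gV(2)[OF xV zN(1)] *(5) xx by simp
    then have "a (g x) z = z'"
      using class_inject[OF section_onD(1)[OF s'(1,2)] act_closed[OF gV(1)[OF xV zN(1)] zN(1)] zN(2)] xV by blast
    then have "(x, z) \<in> ?W" using * xV by (simp add: \<kappa>_def)
    moreover have "u = snd ?C (x, z)" using *(6) snd_assoc_chart[OF s *(1,2)] by simp
    ultimately show "u \<in> snd ?C ` ?W" by blast
  next
    fix u assume "u \<in> snd ?C ` ?W"
    then obtain x z where *: "x \<in> ?V" "z \<in> fst d" "a (g x) z \<in> fst d'" "u = (snd c x, snd d z)"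
      by (auto simp: \<kappa>_def)
    have "cl (s x) z \<in> fst ?K \<inter> fst ?K'"
      using gV(2)[OF *(1) chart_points[OF s(3) *(2)]] * class_in_assoc_chart[of x c z d s]
        class_in_assoc_chart[of x c' "a (g x) z" d' s'] by simp
    moreover have "u = snd ?K (cl (s x) z)" using * snd_assoc_chart[OF s] by simp
    ultimately show "u \<in> snd ?K ` (fst ?K \<inter> fst ?K')" by blast
  qed
  have "smooth_on (snd ?C ` ?W) (snd ?K' \<circ> chart_inv ?K)"
  proof (rule smooth_on_cong[OF inC(1) _ inC(2)])
    fix u assume "u \<in> snd ?C ` ?W"
    then obtain x z where *: "x \<in> ?V" "z \<in> fst d" "a (g x) z \<in> fst d'" "u = (snd c x, snd d z)"
      by (auto simp: \<kappa>_def)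
    have "chart_inv ?C u = (x, z)"
      using chart_inv_prod[OF is_chart_restrict[OF ch(1) _ cV] chd(1), of x z] * by simp
    moreover have "chart_inv ?K u = cl (s' x) (a (g x) z)"
      using assoc_chart_inv[OF s, of x z] * gV(2)[OF *(1) chart_points[OF s(3) *(2)]] by simp
    moreover have "snd ?K' (cl (s' x) (a (g x) z)) = (snd c' x, snd d' (a (g x) z))"
      using * by (intro snd_assoc_chart[OF s']) auto
    ultimately show "snd ?C' (\<kappa> (chart_inv ?C u)) = (snd ?K' \<circ> chart_inv ?K) u"
      by (simp add: \<kappa>_def)
  qed
  then show ?thesis unfolding smooth_transition_def img using inC(1) by simp
qed

lemma smooth_atlas_assoc: "smooth_atlas assoc_atlas"
  unfolding smooth_atlas_def compatible_def assoc_atlas_def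
  using assoc_chart_transition is_chart_assoc_chart by blast

lemma premanifold_A: "premanifold A"
  unfolding A_eq
  by (rule premanifold_generated[OF finite_dim_prod[OF premanifold_finite_dim[OF premanifolds(2)]
        premanifold_finite_dim[OF premanifold_N]] smooth_atlas_assoc])

lemma assoc_chart_in_A: "section_on c s \<Longrightarrow> c \<in> M \<Longrightarrow> d \<in> N \<Longrightarrow> assoc_chart c d s \<in> A"
  using atlas_subset_generated[OF smooth_atlas_assoc] unfolding A_eq assoc_atlas_def by blast

lemma points_A_cases:
  assumes "\<xi> \<in> points A"
  obtains p z where "p \<in> T" "z \<in> points N" "\<xi> = cl p z"
proof -
  from assms have "\<xi> \<in> points assoc_atlas" unfolding A_eq points_generated[OF smooth_atlas_assoc] .
  then obtain K where "K \<in> assoc_atlas" "\<xi> \<in> fst K" unfolding points_def by blast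
  then obtain c d s where *: "c \<in> M" "d \<in> N" "section_on c s" "\<xi> \<in> fst (assoc_chart c d s)"
    unfolding assoc_atlas_def by blast
  then obtain x z where "x \<in> fst c" "z \<in> fst d" "\<xi> = cl (s x) z" unfolding fst_assoc_chart by auto
  then show thesis using that section_onD(1)[OF *(3,1)] chart_points[OF *(2)] by blast
qed

lemma assoc_proj_class:
  assumes "p \<in> T" "z \<in> points N"
  shows "assoc_proj G P N a (cl p z) = \<pi> p"
  unfolding assoc_proj_def
proof (rule the_equality)
  show "\<exists>p'\<in>T. \<exists>z'\<in>points N. cl p z = cl p' z' \<and> \<pi> p = \<pi> p'" using assms by blast
  show "x = \<pi> p" if "\<exists>p'\<in>T. \<exists>z'\<in>points N. cl p z = cl p' z' \<and> x = \<pi> p'" for x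
    using that class_proj[OF assms(1) _ assms(2)] by metis
qed

text \<open>Near a point, \<open>[\<sigma>, \<zeta>] = [s \<circ> \<pi> \<circ> \<sigma>, g \<zeta>]\<close> with \<open>g\<close> the smooth division of \<open>\<sigma>\<close> by \<open>s \<circ> \<pi> \<circ> \<sigma>\<close>.\<close>

lemma smooth_map_class:
  assumes Q: "premanifold Q" and \<sigma>: "smooth_map Q (total P) \<sigma>" and \<zeta>: "smooth_map Q N \<zeta>"
  shows "smooth_map Q A (\<lambda>x. cl (\<sigma> x) (\<zeta> x))"
proof -
  note pm = premanifolds premanifold_N
  have loc: "smooth_at Q A (\<lambda>x. cl (\<sigma> x) (\<zeta> x)) x" if x: "x \<in> points Q" for x
  proof -
    obtain c s where c: "c \<in> M" "\<pi> (\<sigma> x) \<in> fst c" "section_on c s"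
      using section_through[OF smooth_map_points[OF \<sigma> x]] by blast
    let ?V = "{x \<in> points Q. \<pi> (\<sigma> x) \<in> fst c}"
    note \<pi>\<sigma> = smooth_map_compose[OF Q pm(3,2) \<sigma> smooth_proj]
    note cM = chart_openin[OF pm(2) c(1)]
    have V: "openin (mtopology Q) ?V" by (rule smooth_map_open_preimage[OF Q pm(2) \<pi>\<sigma> cM])
    let ?Q = "open_submanifold Q ?V"
    note Q' = premanifold_open[OF Q, of ?V]
    note pts = points_open[OF Q V]
    note \<sigma>' = smooth_map_restrict[OF Q pm(3) \<sigma> V]
    note \<pi>\<sigma>' = smooth_map_restrict[OF Q pm(2) \<pi>\<sigma> V]
    have "smooth_map ?Q (open_submanifold M (fst c)) (\<lambda>x. \<pi> (\<sigma> x))"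
      by (rule smooth_map_into_open[OF Q' pm(2) \<pi>\<sigma>' cM]) (simp add: pts)
    then have s: "smooth_map ?Q (total P) (\<lambda>x. s (\<pi> (\<sigma> x)))"
      by (rule smooth_map_compose[OF Q' premanifold_open[OF pm(2)] pm(3)])
        (use c(3) in \<open>simp add: section_on_def\<close>)
    define g where "g x = division (s (\<pi> (\<sigma> x))) (\<sigma> x)" for x
    have g: "smooth_map ?Q GM g" unfolding g_def
      by (rule smooth_division[OF Q' s \<sigma>']) (use section_onD(2)[OF c(3,1)] in \<open>simp add: pts\<close>)
    have gV: "g x \<in> carrier G" "cl (\<sigma> x) z = cl (s (\<pi> (\<sigma> x))) (a (g x) z)" if "x \<in> ?V" "z \<in> points N" for x z
      unfolding g_def
      using division(1) class_division section_onD[OF c(3,1)] smooth_map_points[OF \<sigma>] that by auto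
    define \<kappa> where "\<kappa> x = (\<pi> (\<sigma> x), a (g x) (\<zeta> x))" for x
    have \<kappa>: "smooth_map ?Q (prod_manifold M N) \<kappa>"
      unfolding \<kappa>_def
      by (intro smooth_map_Pair smooth_map_act Q' pm \<pi>\<sigma>' g smooth_map_restrict[OF Q pm(4) \<zeta> V])
    have xV: "x \<in> ?V" using x c(2) by simp
    then obtain e where e: "e \<in> ?Q" "x \<in> fst e" using points_chart[of x ?Q] unfolding pts by blast
    have eV: "fst e \<subseteq> ?V" "e \<in> Q" using e(1) by (auto simp: open_submanifold_def)
    obtain d where d: "d \<in> N" "a (g x) (\<zeta> x) \<in> fst d"
      using points_chart[OF act_closed[OF gV(1)[OF xV] smooth_map_points[OF \<zeta> x]]] smooth_map_points[OF \<zeta> x] by blast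
    let ?C = "prod_chart c d" and ?K = "assoc_chart c d s"
    note inC = smooth_map_in_charts[OF Q' premanifold_prod[OF pm(2,4)] \<kappa> e(1) prod_chart_in[OF pm(2,4) c(1) d(1)]]
    let ?W = "{w \<in> fst e. \<kappa> w \<in> fst ?C}"
    \<comment> \<open>Read in the chart \<open>?K\<close>, the class map has the same coordinates as
      \<kappa>.\<close>
    have W: "cl (\<sigma> w) (\<zeta> w) \<in> fst ?K \<and> snd ?K (cl (\<sigma> w) (\<zeta> w)) = snd ?C (\<kappa> w)" if w: "w \<in> ?W" for w
    proof -
      have wV: "w \<in> ?V" using w eV(1) by blast
      then have eq: "cl (\<sigma> w) (\<zeta> w) = cl (s (\<pi> (\<sigma> w))) (a (g w) (\<zeta> w))"
        using smooth_map_points[OF \<zeta>] by (intro gV(2)) auto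
      have mem: "\<pi> (\<sigma> w) \<in> fst c" "a (g w) (\<zeta> w) \<in> fst d" using w by (auto simp: \<kappa>_def)
      show ?thesis unfolding eq
        using class_in_assoc_chart[of _ c _ d s, OF mem] snd_assoc_chart[OF c(3,1) d(1) mem] by (simp add: \<kappa>_def)
    qed
    have "smooth_on (snd e ` ?W) (\<lambda>u. snd ?K (cl (\<sigma> (chart_inv e u)) (\<zeta> (chart_inv e u))))"
    proof (rule smooth_on_cong[OF inC(1) _ inC(2)])
      fix u assume "u \<in> snd e ` ?W"
      then obtain w where w: "w \<in> ?W" "u = snd e w" by blast
      then have "chart_inv e u = w" using chart_inv_chart[OF premanifold_chart[OF Q eV(2)]] by simp
      then show "snd ?C (\<kappa> (chart_inv e u)) = snd ?K (cl (\<sigma> (chart_inv e u)) (\<zeta> (chart_inv e u)))"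
        using W[OF w(1)] by simp
    qed
    then show ?thesis
      unfolding smooth_at_def using inC(1) W e(2) c(2) d(2)
      by (intro bexI[OF _ eV(2)] bexI[OF _ assoc_chart_in_A[OF c(3,1) d(1)]] exI[of _ ?W]) (auto simp: \<kappa>_def)
  qed
  show ?thesis by (rule smooth_mapI[OF Q loc])
qed

text \<open>In product coordinates (x, z) \<mapsto> [s x, z] is the inverse of a chart, so
  smoothness may be tested after composing with it. This is the form in which the quotient property
  of the associated bundle is used.\<close>

lemma smooth_map_from_assoc:
  assumes Q: "premanifold Q"
    and f: "\<And>c s. c \<in> M \<Longrightarrow> section_on c s \<Longrightarrow>
      smooth_map (prod_manifold (open_submanifold M (fst c)) N) Q (\<lambda>u. f (cl (s (fst u)) (snd u)))"
  shows "smooth_map A Q f"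
proof -
  note pm = premanifolds premanifold_N
  have loc: "smooth_at A Q f \<xi>" if \<xi>: "\<xi> \<in> points A" for \<xi>
  proof -
    obtain p z where p: "p \<in> T" "z \<in> points N" "\<xi> = cl p z" by (rule points_A_cases[OF \<xi>])
    obtain c s where c: "c \<in> M" "\<pi> p \<in> fst c" "section_on c s" "s (\<pi> p) = p" using section_through[OF p(1)] by blast
    obtain d where d: "d \<in> N" "z \<in> fst d" using points_chart[OF p(2)] by blast
    let ?Q = "open_submanifold M (fst c)"
    let ?F = "\<lambda>u. f (cl (s (fst u)) (snd u))"
    note Q' = premanifold_open[OF pm(2), of "fst c"]
    note F = f[OF c(1,3)]
    have cQ: "c \<in> ?Q" using c(1) by (simp add: open_submanifold_def)
    have "(\<pi> p, z) \<in> points (prod_manifold ?Q N)"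
      using c(2) p(2) by (simp add: points_prod[OF Q' pm(4)] points_open[OF pm(2) chart_openin[OF pm(2) c(1)]])
    from smooth_map_points[OF F this] have fQ: "f \<xi> \<in> points Q" using c(4) p(3) by simp
    obtain e where e: "e \<in> Q" "f \<xi> \<in> fst e" using points_chart[OF fQ] by blast
    let ?C = "prod_chart c d" and ?K = "assoc_chart c d s"
    note inC = smooth_map_in_charts[OF premanifold_prod[OF Q' pm(4)] Q F prod_chart_in[OF Q' pm(4) cQ d(1)] e(1)]
    let ?W' = "{w \<in> fst ?C. ?F w \<in> fst e}"
    \<comment> \<open>The part of the chart domain sent into \<open>e\<close>; its openness is
      visible in product coordinates.\<close>
    let ?W = "(\<lambda>u. cl (s (fst u)) (snd u)) ` ?W'"
    have KC: "snd ?K (cl (s (fst u)) (snd u)) = snd ?C u" if "u \<in> ?W'" for u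
      using that snd_assoc_chart[OF c(3,1) d(1), of "fst u" "snd u"] by (auto simp: mem_Times_iff map_prod_def case_prod_unfold)
    have img: "snd ?K ` ?W = snd ?C ` ?W'" unfolding image_image using KC by (rule image_cong[OF refl])
    have o: "open (snd ?K ` ?W)" unfolding img by (rule inC(1))
    have sm: "smooth_on (snd ?K ` ?W) (\<lambda>u. snd e (f (chart_inv ?K u)))"
      unfolding img
    proof (rule smooth_on_cong[OF inC(1) _ inC(2)])
      fix u assume "u \<in> snd ?C ` ?W'"
      then obtain x w where *: "x \<in> fst c" "w \<in> fst d" "u = (snd c x, snd d w)" by auto
      then show "snd e (?F (chart_inv ?C u)) = snd e (f (chart_inv ?K u))"
        using chart_inv_prod[OF premanifold_chart[OF pm(2) c(1)] premanifold_chart[OF pm(4) d(1)] *(1,2)]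
          assoc_chart_inv[OF c(3,1) d(1) *(1,2)] by simp
    qed
    have "?W \<subseteq> fst ?K" unfolding fst_assoc_chart by (rule image_mono) auto
    moreover have "\<xi> \<in> ?W"
      using c(2,4) d(2) e(2) p(3) by (intro image_eqI[of _ _ "(\<pi> p, z)"]) auto
    ultimately show ?thesis
      unfolding smooth_at_def using o sm
      by (intro bexI[OF _ assoc_chart_in_A[OF c(3,1) d(1)]] bexI[OF _ e(1)] exI[of _ ?W]) auto
  qed
  then show ?thesis by (rule smooth_mapI[OF premanifold_A])
qed

end

section \<open>The Darboux-Lie derivative\<close>

context principal_action begin

text \<open>By invariance a right translate of an integral curve is again an integral curve, and
  uniqueness identifies it with the flow line. The claim is confined to times near 0, where the
  integral curve exists.\<close>

lemma flow_ract:
  assumes inv: "invariant_field G P Xt" and p: "p \<in> T" and g: "g \<in> carrier G"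
  shows "\<forall>\<^sub>F t in nhds 0. flow (total P) Xt t (ract P p g) = ract P (flow (total P) Xt t p) g"
proof -
  have X: "vector_field (total P) Xt" using inv by (simp add: invariant_field_def)
  obtain I \<gamma> where \<gamma>: "integral_curve (total P) Xt p I \<gamma>"
    using integral_curve_exists[OF premanifolds(3) X p] by blast
  have I: "open I" "is_interval I" "0 \<in> I" "\<gamma> 0 = p" using \<gamma> by (auto simp: integral_curve_def)
  have "has_velocity (total P) (\<lambda>t. ract P (\<gamma> t) g) t (Xt (ract P (\<gamma> t) g))" if t: "t \<in> I" for t
  proof -
    note v = integral_curve_velocity[OF \<gamma> t]
    have "Xt (ract P (\<gamma> t) g) = tangent_map (total P) (total P) (\<lambda>q. ract P q g) (\<gamma> t) (Xt (\<gamma> t))"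
      using inv has_velocity_points[OF v] g by (simp add: invariant_field_def)
    then show ?thesis
      using has_velocity_push[OF premanifolds(3,3) smooth_right_translation[OF g] v] by simp
  qed
  then have \<gamma>': "integral_curve (total P) Xt (ract P p g) I (\<lambda>t. ract P (\<gamma> t) g)"
    using I by (simp add: integral_curve_def)
  show ?thesis
    using eventually_nhds_in_open[OF I(1,3)]
    by eventually_elim (simp add: flow_integral_curve[OF manifold_total X \<gamma>] flow_integral_curve[OF manifold_total X \<gamma>'])
qed

lemma flow_points:
  assumes "vector_field (total P) Xt" "p \<in> T"
  shows "\<forall>\<^sub>F t in nhds 0. flow (total P) Xt t p \<in> T"
  using velocity_eventually_open[OF premanifolds(3) flow_velocity(2)[OF manifold_total assms] openin_points[OF premanifolds(3)]]
    flow_velocity(1)[OF manifold_total assms] assms(2) by simp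

end

context assoc_bundle begin

text \<open>Two representatives differ by a group element, which by \<open>flow_ract\<close> can be
  moved across the class at all times near 0. Hence all admissible curves have the same velocity and
  the description is unique.\<close>

lemma assoc_field_velocity:
  assumes inv: "invariant_field G P Xt" and p: "p \<in> T" and z: "z \<in> points N"
  shows "has_velocity A (\<lambda>t. cl (flow (total P) Xt t p) z) 0 (assoc_field G M P N a Xt (cl p z))"
proof -
  have X: "vector_field (total P) Xt" using inv by (simp add: invariant_field_def)
  note P = premanifolds(3)
  define v where "v = tangent_map (total P) A (\<lambda>q. cl q z) (flow (total P) Xt 0 p) (Xt p)"
  have v: "has_velocity A (\<lambda>t. cl (flow (total P) Xt t p) z) 0 v"
    unfolding v_def
    by (rule has_velocity_push[OF P premanifold_A smooth_map_class[OF P smooth_map_ident[OF P] smooth_map_const[OF P z]]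
          flow_velocity(2)[OF manifold_total X p]])
  have "assoc_field G M P N a Xt (cl p z) = v"
    unfolding assoc_field_def
  proof (rule the_equality)
    show "\<exists>q\<in>T. \<exists>w\<in>points N. cl p z = cl q w \<and> has_velocity A (\<lambda>t. cl (flow (total P) Xt t q) w) 0 v"
      using p z v by blast
    fix u assume "\<exists>q\<in>T. \<exists>w\<in>points N. cl p z = cl q w \<and> has_velocity A (\<lambda>t. cl (flow (total P) Xt t q) w) 0 u"
    then obtain q w where q: "q \<in> T" "w \<in> points N" "cl p z = cl q w"
      and u: "has_velocity A (\<lambda>t. cl (flow (total P) Xt t q) w) 0 u" by blast
    obtain g where g: "g \<in> carrier G" "q = ract P p g" "z = a g w" by (rule class_eqD[OF p q(1) z q(2,3)])
    have "\<forall>\<^sub>F t in nhds 0. cl (flow (total P) Xt t q) w = cl (flow (total P) Xt t p) z"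
      using flow_ract[OF inv p g(1)] flow_points[OF X p]
      by eventually_elim (simp add: g(2,3) class_ract[OF _ g(1) q(2)])
    then show "u = v" by (rule has_velocity_unique[OF has_velocity_cong[OF u] v])
  qed
  then show ?thesis using v by simp
qed

lemma fst_assoc_chart_coordinates:
  assumes s: "section_on c s" "c \<in> M" "d \<in> N" and \<xi>: "\<xi> \<in> fst (assoc_chart c d s)"
  shows "fst (snd (assoc_chart c d s) \<xi>) = snd c (assoc_proj G P N a \<xi>)"
proof -
  obtain x z where *: "x \<in> fst c" "z \<in> fst d" "\<xi> = cl (s x) z" using \<xi> unfolding fst_assoc_chart by auto
  show ?thesis
    using snd_assoc_chart[OF s *(1,2)] assoc_proj_class[OF section_onD(1)[OF s(1,2) *(1)] chart_points[OF s(3) *(2)]]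
      section_onD(2)[OF s(1,2) *(1)] by (simp add: *(3))
qed

text \<open>The data quantified over in \<open>darboux_lie\<close>, with the vertical vector
  \<open>D\<close> and its base point as parameters.\<close>

definition darboux_curve ::
  "(('p \<times> 'n) set, 'e \<times> 'f) tangent \<Rightarrow> ('p \<times> 'n) set \<Rightarrow> 'p \<Rightarrow> real set \<Rightarrow> (real \<Rightarrow> 'n) \<Rightarrow> ('n, 'f) tangent \<Rightarrow> bool"
  where "darboux_curve D \<xi> p I \<gamma> v \<longleftrightarrow> p \<in> T \<and> 0 \<in> I \<and> smooth_curve N I \<gamma> \<and> has_velocity N \<gamma> 0 v \<and>
    has_velocity A (\<lambda>t. cl p (\<gamma> t)) 0 D \<and> cl p (\<gamma> 0) = \<xi>"

text \<open>
  A difference of two velocities with the same image in \<open>M\<close> is vertical, so a straight line in a chart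
  of the fibre realises it.
\<close>

lemma darboux_curve_exists:
  assumes v: "has_velocity A \<alpha> 0 v" and w: "has_velocity A \<beta> 0 w" and eq: "\<alpha> 0 = \<xi>" "\<beta> 0 = \<xi>"
    and \<alpha>: "has_velocity M (\<lambda>t. assoc_proj G P N a (\<alpha> t)) 0 u"
    and \<beta>: "has_velocity M (\<lambda>t. assoc_proj G P N a (\<beta> t)) 0 u"
  obtains p I \<gamma> b where "darboux_curve (\<lambda>k. v k - w k) \<xi> p I \<gamma> b"
proof -
  have "\<xi> \<in> points A" using has_velocity_points[OF v] eq by simp
  then obtain p z where p: "p \<in> T" "z \<in> points N" "\<xi> = cl p z" by (rule points_A_cases)
  obtain c s where c: "c \<in> M" "\<pi> p \<in> fst c" "section_on c s" "s (\<pi> p) = p" using section_through[OF p(1)] by blast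
  obtain d where d: "d \<in> N" "z \<in> fst d" using points_chart[OF p(2)] by blast
  let ?K = "assoc_chart c d s"
  note K = assoc_chart_in_A[OF c(3,1) d(1)]
  have \<xi>K: "\<xi> \<in> fst ?K" using class_in_assoc_chart[of "\<pi> p" c z d s] c d p(3) by simp
  have pr: "assoc_proj G P N a \<xi> = \<pi> p" using assoc_proj_class p by simp
  \<comment> \<open>The first chart component of a class is the base coordinate, so the first
    component of a velocity is the projected velocity. The two first components therefore cancel in
    the difference.\<close>
  have fst_vel: "fst (b ?K) = u c"
    if b: "has_velocity A \<beta> 0 b" and \<beta>0: "\<beta> 0 = \<xi>" and \<beta>: "has_velocity M (\<lambda>t. assoc_proj G P N a (\<beta> t)) 0 u" for \<beta> b
  proof -
    note vc = has_velocity_chart[OF b K, unfolded \<beta>0, OF \<xi>K]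
    have "((\<lambda>t. fst (snd ?K (\<beta> t))) has_vector_derivative fst (b ?K)) (at 0)"
      by (rule bounded_linear.has_vector_derivative[OF bounded_linear_fst vc(2)])
    then have "((\<lambda>t. snd c (assoc_proj G P N a (\<beta> t))) has_vector_derivative fst (b ?K)) (at 0)"
      by (rule vector_derivative_cong)
        (use vc(1) in \<open>eventually_elim, simp add: fst_assoc_chart_coordinates[OF c(3,1) d(1)]\<close>)
    moreover have "((\<lambda>t. snd c (assoc_proj G P N a (\<beta> t))) has_vector_derivative u c) (at 0)"
      by (rule has_velocity_chart(2)[OF \<beta> c(1)]) (simp add: \<beta>0 pr c(2))
    ultimately show ?thesis by (rule vector_derivative_unique_at)
  qed
  have D: "v ?K - w ?K = (0, snd (v ?K - w ?K))"
    using fst_vel[OF v eq(1) \<alpha>] fst_vel[OF w eq(2) \<beta>] by (simp add: prod_eq_iff)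
  obtain I \<gamma> where \<gamma>: "0 \<in> I" "smooth_curve N I \<gamma>" "\<gamma> 0 = z"
    "has_velocity N \<gamma> 0 (tangent_vector N z d (snd (v ?K - w ?K)))"
    "\<forall>\<^sub>F t in nhds 0. \<gamma> t \<in> fst d" "((\<lambda>t. snd d (\<gamma> t)) has_vector_derivative snd (v ?K - w ?K)) (at 0)"
    by (rule line_in_chart[OF premanifold_N d])
  have ev: "\<forall>\<^sub>F t in nhds 0. cl p (\<gamma> t) \<in> fst ?K \<and> snd ?K (cl p (\<gamma> t)) = (snd c (\<pi> p), snd d (\<gamma> t))"
    using \<gamma>(5)
  proof eventually_elim
    case (elim t)
    show ?case
      using class_in_assoc_chart[of "\<pi> p" c "\<gamma> t" d s, OF c(2) elim] snd_assoc_chart[OF c(3,1) d(1) c(2) elim] by (simp add: c(4))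
  qed
  have "((\<lambda>t. (snd c (\<pi> p), snd d (\<gamma> t))) has_vector_derivative (0, snd (v ?K - w ?K))) (at 0)"
    by (intro has_vector_derivative_Pair has_vector_derivative_const \<gamma>(6))
  then have "((\<lambda>t. (snd c (\<pi> p), snd d (\<gamma> t))) has_vector_derivative v ?K - w ?K) (at 0)"
    by (subst D)
  then have der: "((\<lambda>t. snd ?K (cl p (\<gamma> t))) has_vector_derivative v ?K - w ?K) (at 0)"
    by (rule vector_derivative_cong) (use ev in \<open>eventually_elim, simp\<close>)
  have g0: "cl p (\<gamma> 0) = \<xi>" by (simp add: \<gamma>(3) p(3))
  have "has_velocity A (\<lambda>t. cl p (\<gamma> t)) 0 (\<lambda>k. v k - w k)"
    by (rule has_velocity_difference[OF premanifold_A v w _ _ K _ _ der])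
      (use ev \<xi>K in \<open>auto simp: g0 eq elim: eventually_mono\<close>)
  then have "darboux_curve (\<lambda>k. v k - w k) \<xi> p I \<gamma> (tangent_vector N z d (snd (v ?K - w ?K)))"
    using p(1) \<gamma> g0 by (simp add: darboux_curve_def)
  then show thesis by (rule that)
qed

text \<open>In a chart built from a section through \<open>p\<close>, the curve [p, \<gamma>(t)] has
  the fibre coordinates of \<gamma>(t). Its velocity \<open>D\<close> thus determines that of
  \<gamma>.\<close>

lemma class_velocity_inject:
  assumes p: "p \<in> T" and v: "has_velocity N \<gamma> 0 v" and w: "has_velocity N \<delta> 0 w" and eq: "\<gamma> 0 = \<delta> 0"
    and D: "has_velocity A (\<lambda>t. cl p (\<gamma> t)) 0 D" "has_velocity A (\<lambda>t. cl p (\<delta> t)) 0 D"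
  shows "v = w"
proof -
  obtain c s where c: "c \<in> M" "\<pi> p \<in> fst c" "section_on c s" "s (\<pi> p) = p" using section_through[OF p] by blast
  obtain d where d: "d \<in> N" "\<delta> 0 \<in> fst d" using points_chart[OF has_velocity_points[OF w]] by blast
  let ?K = "assoc_chart c d s"
  note K = assoc_chart_in_A[OF c(3,1) d(1)]
  have vel: "b d = snd (D ?K)"
    if b: "has_velocity N \<beta> 0 b" and \<beta>0: "\<beta> 0 = \<delta> 0" and \<beta>: "has_velocity A (\<lambda>t. cl p (\<beta> t)) 0 D" for \<beta> b
  proof -
    have \<beta>d: "\<beta> 0 \<in> fst d" using d \<beta>0 by simp
    have \<beta>K: "cl p (\<beta> 0) \<in> fst ?K" using class_in_assoc_chart[of "\<pi> p" c "\<beta> 0" d s] c \<beta>d by simp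
    note vc = has_velocity_chart[OF b d(1) \<beta>d]
    have ev: "\<forall>\<^sub>F t in nhds 0. snd (snd ?K (cl p (\<beta> t))) = snd d (\<beta> t)"
      using vc(1)
    proof eventually_elim
      case (elim t)
      show ?case using snd_assoc_chart[OF c(3,1) d(1) c(2) elim] by (simp add: c(4))
    qed
    have "((\<lambda>t. snd (snd ?K (cl p (\<beta> t)))) has_vector_derivative snd (D ?K)) (at 0)"
      by (rule bounded_linear.has_vector_derivative[OF bounded_linear_snd has_velocity_chart(2)[OF \<beta> K \<beta>K]])
    then have "((\<lambda>t. snd d (\<beta> t)) has_vector_derivative snd (D ?K)) (at 0)"
      by (rule vector_derivative_cong[OF _ ev])
    then show ?thesis using vc(2) by (rule vector_derivative_unique_at[rotated])
  qed
  have "v d = w d" using vel[OF v eq D(1)] vel[OF w refl D(2)] by simp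
  moreover have "v = tangent_vector N (\<delta> 0) d (v d)"
    using has_velocity_tangent_vector[OF premanifold_N v d(1)] d(2) by (simp add: eq)
  moreover have "w = tangent_vector N (\<delta> 0) d (w d)"
    by (rule has_velocity_tangent_vector[OF premanifold_N w d])
  ultimately show ?thesis by simp
qed

text \<open>The second curve is rewritten in the frame of the first, [q, \<delta>] =
  [p, g \<delta>]. Then both start at the same fibre point, and \<open>class_velocity_inject\<close>
  compares them.\<close>

lemma darboux_curve_unique:
  assumes 1: "darboux_curve D \<xi> p I \<gamma> v" and 2: "darboux_curve D \<xi> q J \<delta> w"
  obtains g where "g \<in> carrier G" "q = ract P p g" "\<gamma> 0 = a g (\<delta> 0)" "v = tangent_map N N (a g) (\<delta> 0) w"
proof -
  have p: "p \<in> T" "q \<in> T" and v: "has_velocity N \<gamma> 0 v" and w: "has_velocity N \<delta> 0 w"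
    and D: "has_velocity A (\<lambda>t. cl p (\<gamma> t)) 0 D" "has_velocity A (\<lambda>t. cl q (\<delta> t)) 0 D"
    and eq: "cl p (\<gamma> 0) = cl q (\<delta> 0)"
    using 1 2 by (auto simp: darboux_curve_def)
  obtain g where g: "g \<in> carrier G" "q = ract P p g" "\<gamma> 0 = a g (\<delta> 0)"
    by (rule class_eqD[OF p has_velocity_points[OF v] has_velocity_points[OF w] eq])
  note gw = has_velocity_push[OF premanifold_N premanifold_N smooth_left_translation[OF g(1)] w]
  have "\<forall>\<^sub>F t in nhds 0. \<delta> t \<in> points N"
    by (rule velocity_eventually_open[OF premanifold_N w openin_points[OF premanifold_N] has_velocity_points[OF w]])
  then have "\<forall>\<^sub>F t in nhds 0. cl q (\<delta> t) = cl p (a g (\<delta> t))"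
    by eventually_elim (simp add: g(2) class_ract[OF p(1) g(1)])
  then have "has_velocity A (\<lambda>t. cl p (a g (\<delta> t))) 0 D" by (rule has_velocity_cong[OF D(2)])
  from class_velocity_inject[OF p(1) v gw g(3) D(1) this] show thesis using that g by blast
qed

text \<open>A change of representative by \<open>g\<close> multiplies the value of the form by
  \<open>\<rho> g\<close>, by equivariance; this is absorbed by [p, g u] = [pg, u].\<close>

lemma darboux_lie_eq:
  fixes \<rho> :: "'g \<Rightarrow> 'v \<Rightarrow> 'v::real_normed_vector"
  assumes \<rho>: "principal_set_action G GM M P UNIV \<rho>" and \<omega>: "equivariant_form G N a \<rho> \<omega>"
    and \<gamma>: "darboux_curve (\<lambda>c. tangent_map E A h y (FX y) c - assoc_field G M P N a Xt (h y) c) (h y) p I \<gamma> v"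
  shows "darboux_lie G M P N a \<rho> \<omega> E FX Xt h y = assoc_class G P \<rho> p (\<omega> (\<gamma> 0) v)"
  unfolding darboux_lie_def
proof (rule the_equality)
  let ?D = "\<lambda>c. tangent_map E A h y (FX y) c - assoc_field G M P N a Xt (h y) c"
  show "\<exists>q\<in>T. \<exists>J \<delta> w. 0 \<in> J \<and> smooth_curve N J \<delta> \<and> has_velocity N \<delta> 0 w \<and> has_velocity A (\<lambda>t. cl q (\<delta> t)) 0 ?D \<and>
      cl q (\<delta> 0) = h y \<and> assoc_class G P \<rho> p (\<omega> (\<gamma> 0) v) = assoc_class G P \<rho> q (\<omega> (\<delta> 0) w)"
    using \<gamma> unfolding darboux_curve_def by blast
  fix \<xi> assume "\<exists>q\<in>T. \<exists>J \<delta> w. 0 \<in> J \<and> smooth_curve N J \<delta> \<and> has_velocity N \<delta> 0 w \<and> has_velocity A (\<lambda>t. cl q (\<delta> t)) 0 ?D \<and>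
      cl q (\<delta> 0) = h y \<and> \<xi> = assoc_class G P \<rho> q (\<omega> (\<delta> 0) w)"
  then obtain q J \<delta> w where \<delta>: "darboux_curve ?D (h y) q J \<delta> w" and \<xi>: "\<xi> = assoc_class G P \<rho> q (\<omega> (\<delta> 0) w)"
    unfolding darboux_curve_def by blast
  obtain g where g: "g \<in> carrier G" "q = ract P p g" "\<gamma> 0 = a g (\<delta> 0)" "v = tangent_map N N (a g) (\<delta> 0) w"
    by (rule darboux_curve_unique[OF \<gamma> \<delta>])
  have p: "p \<in> T" and w: "has_velocity N \<delta> 0 w" using \<gamma> \<delta> by (auto simp: darboux_curve_def)
  have "\<omega> (\<gamma> 0) v = \<rho> g (\<omega> (\<delta> 0) w)"
    using \<omega> g(1) has_velocity_points[OF w] has_velocity_tangent_space[OF premanifold_N w]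
    by (simp add: equivariant_form_def g(3,4))
  then show "\<xi> = assoc_class G P \<rho> p (\<omega> (\<gamma> 0) v)"
    using principal_set_action.class_ract[OF \<rho> p g(1)] by (simp add: \<xi> g(2))
qed

end

section \<open>Induced maps of associated bundles\<close>

text \<open>Equivariance makes the value independent of the representative. Stated for actions on
  sets, it also applies to \<phi>, whose values lie in \<open>\<Rightarrow>\<^sub>L\<close>.\<close>

lemma assoc_map_class:
  assumes a: "principal_set_action G GM M P S a" and b: "principal_set_action G GM M P S' b"
    and f: "\<And>z. z \<in> S \<Longrightarrow> f z \<in> S'" "equivariant G S a b f" and p: "p \<in> points (total P)" "z \<in> S"
  shows "assoc_map G P S a b f (assoc_class G P a p z) = assoc_class G P b p (f z)"
  unfolding assoc_map_def
proof (rule the_equality)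
  show "\<exists>q\<in>points (total P). \<exists>w\<in>S. assoc_class G P a p z = assoc_class G P a q w \<and>
      assoc_class G P b p (f z) = assoc_class G P b q (f w)" using p by blast
  fix \<eta> assume "\<exists>q\<in>points (total P). \<exists>w\<in>S. assoc_class G P a p z = assoc_class G P a q w \<and> \<eta> = assoc_class G P b q (f w)"
  then obtain q w where q: "q \<in> points (total P)" "w \<in> S" "assoc_class G P a p z = assoc_class G P a q w"
    "\<eta> = assoc_class G P b q (f w)" by blast
  obtain g where g: "g \<in> carrier G" "q = ract P p g" "z = a g w"
    by (rule principal_set_action.class_eqD[OF a p(1) q(1) p(2) q(2,3)])
  then show "\<eta> = assoc_class G P b p (f z)"
    using principal_set_action.class_ract[OF b p(1) g(1) f(1)[OF q(2)]] f(2) q(2) by (simp add: q(4) equivariant_def)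
qed

lemma assoc_bundle_map_class:
  assumes N: "assoc_bundle G GM M P N a" and N': "assoc_bundle G GM M P N' b"
    and f: "smooth_map N N' f" "equivariant G (points N) a b f" and p: "p \<in> points (total P)" "z \<in> points N"
  shows "assoc_map G P (points N) a b f (assoc_class G P a p z) = assoc_class G P b p (f z)"
proof -
  interpret N: assoc_bundle G GM M P N a by (rule N)
  interpret N': assoc_bundle G GM M P N' b by (rule N')
  show ?thesis
    by (rule assoc_map_class[OF N.principal_set_action_axioms N'.principal_set_action_axioms smooth_map_points[OF f(1)] f(2) p])
qed

text \<open>Along a local section the map is (x, z) \<mapsto> [s x, f z], which is smooth by
  \<open>smooth_map_class\<close>.\<close>

lemma smooth_assoc_map:
  assumes N: "assoc_bundle G GM M P N a" and N': "assoc_bundle G GM M P N' b"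
    and f: "smooth_map N N' f" "equivariant G (points N) a b f"
  shows "smooth_map (assoc_manifold G M P N a) (assoc_manifold G M P N' b) (assoc_map G P (points N) a b f)"
proof -
  interpret N: assoc_bundle G GM M P N a by (rule N)
  interpret N': assoc_bundle G GM M P N' b by (rule N')
  note cls = assoc_bundle_map_class[OF N N' f]
  show ?thesis
  proof (rule N.smooth_map_from_assoc[OF N'.premanifold_A])
    fix c s assume c: "c \<in> M" "N.section_on c s"
    note Q = premanifold_open[OF N.premanifolds(2), of "fst c"]
    note QN = premanifold_prod[OF Q N.premanifold_N]
    have s: "smooth_map (open_submanifold M (fst c)) (total P) s" using c(2) by (simp add: N.section_on_def)
    have "smooth_map (prod_manifold (open_submanifold M (fst c)) N) N'.A (\<lambda>u. N'.cl (s (fst u)) (f (snd u)))"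
      by (rule N'.smooth_map_class[OF QN smooth_map_compose[OF QN Q N.premanifolds(3) smooth_map_fst[OF Q N.premanifold_N] s]
            smooth_map_compose[OF QN N.premanifold_N N'.premanifold_N smooth_map_snd[OF Q N.premanifold_N] f(1)]])
    then show "smooth_map (prod_manifold (open_submanifold M (fst c)) N) N'.A
        (\<lambda>u. assoc_map G P (points N) a b f (N.cl (s (fst u)) (snd u)))"
      by (rule smooth_map_cong[OF QN, rotated])
        (auto simp: points_prod[OF Q N.premanifold_N] points_open[OF N.premanifolds(2) chart_openin[OF N.premanifolds(2) c(1)]]
          intro!: cls[symmetric] N.section_onD(1)[OF c(2,1)])
  qed
qed

text \<open>Both sides are the velocity at 0 of the curve [\<Phi>(t) p, f z], where \<Phi> is the
  flow of \<open>Xt\<close>.\<close>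

lemma tangent_map_assoc_field:
  assumes N: "assoc_bundle G GM M P N a" and N': "assoc_bundle G GM M P N' b"
    and f: "smooth_map N N' f" "equivariant G (points N) a b f"
    and X: "invariant_field G P Xt" and \<xi>: "\<xi> \<in> points (assoc_manifold G M P N a)"
  shows "tangent_map (assoc_manifold G M P N a) (assoc_manifold G M P N' b) (assoc_map G P (points N) a b f) \<xi>
      (assoc_field G M P N a Xt \<xi>) = assoc_field G M P N' b Xt (assoc_map G P (points N) a b f \<xi>)"
proof -
  interpret N: assoc_bundle G GM M P N a by (rule N)
  interpret N': assoc_bundle G GM M P N' b by (rule N')
  note cls = assoc_bundle_map_class[OF N N' f]
  have Xv: "vector_field (total P) Xt" using X by (simp add: invariant_field_def)
  obtain p z where p: "p \<in> N.T" "z \<in> points N" "\<xi> = N.cl p z" by (rule N.points_A_cases[OF \<xi>])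
  have start: "flow (total P) Xt 0 p = p" by (rule flow_velocity(1)[OF N.manifold_total Xv p(1)])
  note v = has_velocity_push[OF N.premanifold_A N'.premanifold_A smooth_assoc_map[OF N N' f] N.assoc_field_velocity[OF X p(1,2)]]
  have "\<forall>\<^sub>F t in nhds 0. assoc_map G P (points N) a b f (N.cl (flow (total P) Xt t p) z) = N'.cl (flow (total P) Xt t p) (f z)"
    using N.flow_points[OF Xv p(1)] by eventually_elim (rule cls[OF _ p(2)])
  from has_velocity_unique[OF has_velocity_cong[OF v this] N'.assoc_field_velocity[OF X p(1) smooth_map_points[OF f(1) p(2)]]]
  show ?thesis by (simp add: p(3) start cls[OF p(1,2)])
qed

lemma G_module_action:
  assumes "principal_action G GM M P" and \<rho>: "G_module G GM (\<rho> :: 'g \<Rightarrow> 'v \<Rightarrow> 'v::real_normed_vector)"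
  shows "principal_set_action G GM M P UNIV \<rho>" "g \<in> carrier G \<Longrightarrow> bounded_linear (\<rho> g)"
proof -
  interpret principal_action G GM M P by fact
  have sa: "smooth_action G GM std_manifold \<rho>" and lin: "\<And>g. g \<in> carrier G \<Longrightarrow> linear (\<rho> g)"
    using \<rho> by (auto simp: G_module_def)
  show "principal_set_action G GM M P UNIV \<rho>"
    by unfold_locales (use smooth_action_act[OF lie sa] in \<open>auto simp: points_std\<close>)
  have "finite_dim TYPE('v)" using sa by (simp add: smooth_action_def is_manifold_def)
  then show "g \<in> carrier G \<Longrightarrow> bounded_linear (\<rho> g)" using lin finite_dim_linear_bounded by blast
qed

text \<open>\<open>Blinfun\<close> returns the intended map only when it is bounded, which finite
  dimension guarantees for the module operators.\<close>

lemma hom_action_apply: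
  assumes "principal_action G GM M P" "G_module G GM \<rho>" "G_module G GM \<rho>'" "g \<in> carrier G"
  shows "blinfun_apply (hom_action G \<rho> \<rho>' g \<alpha>) v = \<rho>' g (blinfun_apply \<alpha> (\<rho> (inv\<^bsub>G\<^esub> g) v))"
proof -
  interpret principal_action G GM M P by fact
  have "bounded_linear (\<lambda>v. \<rho>' g (blinfun_apply \<alpha> (\<rho> (inv\<^bsub>G\<^esub> g) v)))"
    by (rule bounded_linear_compose[OF G_module_action(2)[OF assms(1,3,4)]
          bounded_linear_compose[OF blinfun.bounded_linear_right G_module_action(2)[OF assms(1,2) inv_closed[OF assms(4)]]]])
  then show ?thesis by (simp add: hom_action_def bounded_linear_Blinfun_apply)
qed

lemma hom_action_action:
  assumes P: "principal_action G GM M P" and \<rho>: "G_module G GM \<rho>" and \<rho>': "G_module G GM \<rho>'"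
  shows "principal_set_action G GM M P UNIV (hom_action G \<rho> \<rho>')"
proof -
  interpret principal_action G GM M P by fact
  interpret V: principal_set_action G GM M P UNIV \<rho> by (rule G_module_action[OF P \<rho>])
  interpret W: principal_set_action G GM M P UNIV \<rho>' by (rule G_module_action[OF P \<rho>'])
  note app = hom_action_apply[OF P \<rho> \<rho>']
  show ?thesis
  proof unfold_locales
    show "hom_action G \<rho> \<rho>' \<one>\<^bsub>G\<^esub> \<alpha> = \<alpha>" for \<alpha>
      by (rule blinfun_eqI) (simp add: app V.act_one W.act_one)
    show "hom_action G \<rho> \<rho>' g (hom_action G \<rho> \<rho>' k \<alpha>) = hom_action G \<rho> \<rho>' (g \<otimes>\<^bsub>G\<^esub> k) \<alpha>"
      if "g \<in> carrier G" "k \<in> carrier G" for g k \<alpha>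
      by (rule blinfun_eqI) (simp add: app V.act_mult W.act_mult inv_mult_group that)
  qed auto
qed

lemma assoc_eval_class:
  assumes P: "principal_action G GM M P" and \<rho>: "G_module G GM \<rho>" and \<rho>': "G_module G GM \<rho>'" and p: "p \<in> points (total P)"
  shows "assoc_eval G P \<rho> \<rho>' (assoc_class G P (hom_action G \<rho> \<rho>') p \<alpha>) (assoc_class G P \<rho> p v) =
    assoc_class G P \<rho>' p (blinfun_apply \<alpha> v)"
  unfolding assoc_eval_def
proof (rule the_equality)
  interpret principal_action G GM M P by fact
  interpret V: principal_set_action G GM M P UNIV \<rho> by (rule G_module_action[OF P \<rho>])
  interpret W: principal_set_action G GM M P UNIV \<rho>' by (rule G_module_action[OF P \<rho>'])
  interpret H: principal_set_action G GM M P UNIV "hom_action G \<rho> \<rho>'" by (rule hom_action_action[OF P \<rho> \<rho>'])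
  show "\<exists>q\<in>T. \<exists>\<beta> w. H.cl p \<alpha> = H.cl q \<beta> \<and> V.cl p v = V.cl q w \<and> W.cl p (blinfun_apply \<alpha> v) = W.cl q (blinfun_apply \<beta> w)"
    using p by blast
  fix \<eta> assume "\<exists>q\<in>T. \<exists>\<beta> w. H.cl p \<alpha> = H.cl q \<beta> \<and> V.cl p v = V.cl q w \<and> \<eta> = W.cl q (blinfun_apply \<beta> w)"
  then obtain q \<beta> w where q: "q \<in> T" "H.cl p \<alpha> = H.cl q \<beta>" "V.cl p v = V.cl q w" "\<eta> = W.cl q (blinfun_apply \<beta> w)" by blast
  obtain g where g: "g \<in> carrier G" "q = ract P p g" "\<alpha> = hom_action G \<rho> \<rho>' g \<beta>"
    by (rule H.class_eqD[OF p q(1) UNIV_I UNIV_I q(2)])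
  obtain k where k: "k \<in> carrier G" "q = ract P p k" "v = \<rho> k w"
    by (rule V.class_eqD[OF p q(1) UNIV_I UNIV_I q(3)])
  \<comment> \<open>The two equalities of classes provide unrelated group elements; freeness
    identifies them, and then \<open>g\<close> cancels against its inverse inside
    \<open>hom_action\<close>.\<close>
  have "k = g" using ract_inject[OF p k(1) g(1)] g(2) k(2) by simp
  then have "blinfun_apply \<alpha> v = \<rho>' g (blinfun_apply \<beta> w)"
    using g(1) k(3) by (simp add: g(3) hom_action_apply[OF P \<rho> \<rho>'] V.act_mult V.act_one)
  then show "\<eta> = W.cl p (blinfun_apply \<alpha> v)" using W.class_ract[OF p g(1)] by (simp add: q(4) g(2))
qed

theorem mainTheorem11:
  fixes F :: "('m, 'e::real_normed_vector, 't, 'k::real_normed_vector) bundle_functor"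
    and M :: "('m, 'e) manifold"
    and G :: "'g monoid" and GM :: "('g, 'gd::real_normed_vector) manifold"
    and P :: "('p, 'pd::real_normed_vector, 'm, 'g) principal"
    and N :: "('n, 'nd::real_normed_vector) manifold" and a :: "'g \<Rightarrow> 'n \<Rightarrow> 'n"
    and N' :: "('n1, 'nd1::real_normed_vector) manifold" and a' :: "'g \<Rightarrow> 'n1 \<Rightarrow> 'n1"
    and \<rho> :: "'g \<Rightarrow> 'v \<Rightarrow> 'v::real_normed_vector"
    and \<rho>' :: "'g \<Rightarrow> 'v1 \<Rightarrow> 'v1::real_normed_vector"
    and f :: "'n \<Rightarrow> 'n1"
    and \<omega> :: "'n \<Rightarrow> ('n, 'nd) tangent \<Rightarrow> 'v"
    and \<omega>' :: "'n1 \<Rightarrow> ('n1, 'nd1) tangent \<Rightarrow> 'v1"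
    and \<phi> :: "'n \<Rightarrow> ('v \<Rightarrow>\<^sub>L 'v1)"
    and h :: "'t \<Rightarrow> ('p \<times> 'n) set"
    and Xt :: "'p \<Rightarrow> ('p, 'pd) tangent" and X :: "'m \<Rightarrow> ('m, 'e) tangent"
    and FX :: "'t \<Rightarrow> ('t, 'e \<times> 'k) tangent" and y :: 't
  assumes "natural_bundle F" and "is_manifold M"
    and "lie_group G GM" and "principal_bundle G GM M P"
    and "smooth_action G GM N a" and "smooth_action G GM N' a'"
    and "smooth_map N N' f" and "equivariant G (points N) a a' f"
    and "G_module G GM \<rho>" and "G_module G GM \<rho>'"
    and "equivariant_form G N a \<rho> \<omega>" and "equivariant_form G N' a' \<rho>' \<omega>'"
    and "smooth_map N std_manifold \<phi>" and "equivariant G (points N) a (hom_action G \<rho> \<rho>') \<phi>"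
    and "\<forall>z\<in>points N. \<forall>v\<in>tangent_space N z.
           pullback N N' f \<omega>' z v = blinfun_apply (\<phi> z) (\<omega> z v)"
    and "bundle_map_to_assoc G M P N a (obj F M) (proj F M) h"
    and "invariant_field G P Xt" and "field_over M P Xt X" and "canonical_lift F M X FX"
    and "y \<in> points (obj F M)"
  shows "darboux_lie G M P N' a' \<rho>' \<omega>' (obj F M) FX Xt
           (assoc_map G P (points N) a a' f \<circ> h) y =
         assoc_eval G P \<rho> \<rho>'
           (assoc_map G P (points N) a (hom_action G \<rho> \<rho>') \<phi> (h y))
           (darboux_lie G M P N a \<rho> \<omega> (obj F M) FX Xt h y)"
proof -
  let ?E = "obj F M"
  note nat = assms(1) and man = assms(2) and f = assms(7,8) and \<rho> = assms(9) and \<rho>' = assms(10) and \<omega> = assms(11,12)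
  have PA: "principal_action G GM M P" by unfold_locales (rule assms(3), rule assms(4))
  have BN: "assoc_bundle G GM M P N a"
    by (intro assoc_bundle.intro PA assoc_bundle_axioms.intro assms(5))
  have BN': "assoc_bundle G GM M P N' a'"
    by (intro assoc_bundle.intro PA assoc_bundle_axioms.intro assms(6))
  interpret principal_action G GM M P by (rule PA)
  interpret N: assoc_bundle G GM M P N a by (rule BN)
  interpret N': assoc_bundle G GM M P N' a' by (rule BN')
  let ?f = "assoc_map G P (points N) a a' f"
  note cls = assoc_bundle_map_class[OF BN BN' f]
  have X: "vector_field M X" and XX: "\<And>p. p \<in> T \<Longrightarrow> tangent_map (total P) M \<pi> p (Xt p) = X (\<pi> p)"
    using assms(18) by (auto simp: field_over_def)
  have Xt: "vector_field (total P) Xt" using assms(17) by (simp add: invariant_field_def)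
  have FX: "vector_field ?E FX" using assms(19) by (simp add: canonical_lift_def)
  have h: "smooth_map ?E N.A h" and hp: "\<And>y. y \<in> points ?E \<Longrightarrow> assoc_proj G P N a (h y) = proj F M y"
    using assms(16) by (auto simp: bundle_map_to_assoc_def)
  note E = natural_bundle_manifold[OF nat man]
  note pE = is_manifold_premanifold[OF E(1)]
  note y = assms(20)
  note sf = smooth_assoc_map[OF BN BN' f]
  \<comment> \<open>The flow line of the lift is a curve with velocity \<open>FX y\<close>; tangent
    maps at \<open>y\<close> are computed along it.\<close>
  define \<eta> where "\<eta> t = flow ?E FX t y" for t
  have \<eta>: "\<eta> 0 = y" "has_velocity ?E \<eta> 0 (FX y)"
    using flow_velocity[OF E(1) FX y] by (simp_all add: \<eta>_def[abs_def])
  have \<eta>E: "\<forall>\<^sub>F t in nhds 0. \<eta> t \<in> points ?E"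
    by (rule velocity_eventually_open[OF pE \<eta>(2) openin_points[OF pE]]) (simp add: \<eta>(1) y)
  have hA: "h y \<in> points N.A" by (rule smooth_map_points[OF h y])
  obtain p0 z0 where p0: "p0 \<in> T" "z0 \<in> points N" "h y = N.cl p0 z0" by (rule N.points_A_cases[OF hA])
  have \<pi>p0: "\<pi> p0 = proj F M y" using N.assoc_proj_class[OF p0(1,2)] hp[OF y] p0(3) by simp
  note start = flow_velocity(1)[OF manifold_total Xt p0(1)]
  note hv = has_velocity_push[OF pE N.premanifold_A h \<eta>(2), unfolded \<eta>(1)]
  note fv = N.assoc_field_velocity[OF assms(17) p0(1,2), folded p0(3)]
  let ?D = "\<lambda>c. tangent_map ?E N.A h y (FX y) c - assoc_field G M P N a Xt (h y) c"
  let ?D' = "\<lambda>c. tangent_map ?E N'.A (?f \<circ> h) y (FX y) c - assoc_field G M P N' a' Xt ((?f \<circ> h) y) c"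
  \<comment> \<open>Verticality of \<open>?D\<close>: the curves \<open>h (\<eta> t)\<close> and
    [\<Phi>(t) p0, z0], where \<Phi> is the flow of \<open>Xt\<close>, start at \<open>h y\<close>
    and both project to curves in \<open>M\<close> with velocity \<open>X\<close> at the base point
    of \<open>y\<close>.\<close>
  obtain p I \<gamma> v where \<gamma>: "N.darboux_curve ?D (h y) p I \<gamma> v"
  proof (rule N.darboux_curve_exists[OF hv fv])
    show "h (\<eta> 0) = h y" by (simp add: \<eta>(1))
    show "N.cl (flow (total P) Xt 0 p0) z0 = h y" by (simp add: start p0(3))
    have "\<forall>\<^sub>F t in nhds 0. proj F M (\<eta> t) = assoc_proj G P N a (h (\<eta> t))"
      using \<eta>E by eventually_elim (simp add: hp)
    then show "has_velocity M (\<lambda>t. assoc_proj G P N a (h (\<eta> t))) 0 (X (proj F M y))"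
      unfolding \<eta>_def by (rule has_velocity_cong[OF canonical_lift_velocity[OF nat man X assms(19) y]])
    have "\<forall>\<^sub>F t in nhds 0. \<pi> (flow (total P) Xt t p0) = assoc_proj G P N a (N.cl (flow (total P) Xt t p0) z0)"
      using flow_points[OF Xt p0(1)] by eventually_elim (simp add: N.assoc_proj_class[OF _ p0(2)])
    moreover have "has_velocity M (\<lambda>t. \<pi> (flow (total P) Xt t p0)) 0 (X (proj F M y))"
      using has_velocity_push[OF premanifolds(3,2) smooth_proj flow_velocity(2)[OF manifold_total Xt p0(1)]]
      by (simp add: start XX[OF p0(1)] \<pi>p0)
    ultimately show "has_velocity M (\<lambda>t. assoc_proj G P N a (N.cl (flow (total P) Xt t p0) z0)) 0 (X (proj F M y))"
      by (rule has_velocity_cong[rotated])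
  qed (rule that)
  have p: "p \<in> T" "0 \<in> I" "smooth_curve N I \<gamma>" and v: "has_velocity N \<gamma> 0 v"
    and D: "has_velocity N.A (\<lambda>t. N.cl p (\<gamma> t)) 0 ?D" and hy: "N.cl p (\<gamma> 0) = h y"
    using \<gamma> by (auto simp: N.darboux_curve_def)
  note z = has_velocity_points[OF v]
  \<comment> \<open>The chain rule at \<open>y\<close>, obtained by computing the velocity of the
    image of \<eta> in two ways.\<close>
  have Tfh: "tangent_map N.A N'.A ?f (h y) (tangent_map ?E N.A h y (FX y)) = tangent_map ?E N'.A (?f \<circ> h) y (FX y)"
    using has_velocity_unique[OF has_velocity_push[OF N.premanifold_A N'.premanifold_A sf hv]
        has_velocity_push[OF pE N'.premanifold_A smooth_map_compose[OF pE N.premanifold_A N'.premanifold_A h sf] \<eta>(2)]]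
    by (simp add: \<eta>(1) comp_def)
  have TD: "tangent_map N.A N'.A ?f (h y) ?D = ?D'"
    unfolding tangent_map_diff[OF N.premanifold_A N'.premanifold_A sf hA] Tfh
      tangent_map_assoc_field[OF BN BN' f assms(17) hA] by simp
  \<comment> \<open>The representative of the image keeps the frame \<open>p\<close> and the
    interval; only the curve in the fibre is composed with \<open>f\<close>.\<close>
  have \<gamma>': "N'.darboux_curve ?D' ((?f \<circ> h) y) p I (\<lambda>t. f (\<gamma> t)) (tangent_map N N' f (\<gamma> 0) v)"
    unfolding N'.darboux_curve_def
  proof (intro conjI)
    show "smooth_curve N' I (\<lambda>t. f (\<gamma> t))"
      using p(3) smooth_map_compose[OF premanifold_open[OF premanifold_std[OF finite_dim_real]]
          N.premanifold_N N'.premanifold_N _ f(1)]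
      by (simp add: smooth_curve_def)
    show "has_velocity N' (\<lambda>t. f (\<gamma> t)) 0 (tangent_map N N' f (\<gamma> 0) v)"
      by (rule has_velocity_push[OF N.premanifold_N N'.premanifold_N f(1) v])
    have "\<forall>\<^sub>F t in nhds 0. \<gamma> t \<in> points N"
      by (rule velocity_eventually_open[OF N.premanifold_N v openin_points[OF N.premanifold_N] z])
    then have "\<forall>\<^sub>F t in nhds 0. ?f (N.cl p (\<gamma> t)) = N'.cl p (f (\<gamma> t))"
      by eventually_elim (rule cls[OF p(1)])
    from has_velocity_cong[OF has_velocity_push[OF N.premanifold_A N'.premanifold_A sf D] this]
    show "has_velocity N'.A (\<lambda>t. N'.cl p (f (\<gamma> t))) 0 ?D'" unfolding hy TD .
    show "N'.cl p (f (\<gamma> 0)) = (?f \<circ> h) y" using cls[OF p(1) z] hy by simp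
  qed (use p in auto)
  have lhs: "darboux_lie G M P N' a' \<rho>' \<omega>' ?E FX Xt (?f \<circ> h) y =
      assoc_class G P \<rho>' p (\<omega>' (f (\<gamma> 0)) (tangent_map N N' f (\<gamma> 0) v))"
    by (rule N'.darboux_lie_eq[where h = "?f \<circ> h" and y = y and FX = FX and \<gamma> = "\<lambda>t. f (\<gamma> t)",
          OF G_module_action(1)[OF PA \<rho>'] \<omega>(2) \<gamma>'])
  have rhs: "darboux_lie G M P N a \<rho> \<omega> ?E FX Xt h y = assoc_class G P \<rho> p (\<omega> (\<gamma> 0) v)"
    by (rule N.darboux_lie_eq[where h = h and y = y and FX = FX and \<gamma> = \<gamma>, OF G_module_action(1)[OF PA \<rho>] \<omega>(1) \<gamma>])
  \<comment> \<open>The assumption on the pullback, taken at \<gamma>(0) and at \<open>v\<close>,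
    which is tangent there because it is a velocity.\<close>
  have "\<omega>' (f (\<gamma> 0)) (tangent_map N N' f (\<gamma> 0) v) = blinfun_apply (\<phi> (\<gamma> 0)) (\<omega> (\<gamma> 0) v)"
    using assms(15) z has_velocity_tangent_space[OF N.premanifold_N v] by (simp add: pullback_def)
  moreover have "assoc_map G P (points N) a (hom_action G \<rho> \<rho>') \<phi> (h y) = assoc_class G P (hom_action G \<rho> \<rho>') p (\<phi> (\<gamma> 0))"
    unfolding hy[symmetric]
    by (rule assoc_map_class[OF N.principal_set_action_axioms hom_action_action[OF PA \<rho> \<rho>'] UNIV_I assms(14) p(1) z])
  ultimately show ?thesis
    unfolding lhs rhs
    by (simp add: assoc_eval_class[OF PA \<rho> \<rho>' p(1)])
qed

end
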